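(* Let $\mathbb{K}$ be an algebraically closed field and let $n$ be a positive integer. Let $G_1,\ldots,G_s$ be a finite collection of subgroups of $\mathrm{Aut}(\mathbb{A}^n)$, each of which is a connected triangular algebraic subgroup. Then the subgroup of $\mathrm{Aut}(\mathbb{A}^n)$ generated by $G_1,\ldots,G_s$ is a connected solvable algebraic subgroup of $\mathrm{Aut}(\mathbb{A}^n)$.
   Context: $\mathbb{A}^n$ is the affine space over $\mathbb{K}$, and $\mathrm{Aut}(\mathbb{A}^n)$ is its group of polynomial automorphisms, identified with the group of $\mathbb{K}$-algebra automorphisms of $\mathbb{K}[x_1,\ldots,x_n]$. An automorphism $\varphi$ is represented by the tuple $(f_1,\ldots,f_n)$ with $f_i=\varphi(x_i)$. An automorphism is triangular if its tuple satisfies $f_i=\lambda_i x_i+h_i$ for all $i$, where the $\lambda_i\in\mathbb{K}$ are nonzero scalars, $h_i\in\mathbb{K}[x_1,\ldots,x_{i-1}]$ for $i=2,\ldots,n$, and $h_1\in\mathbb{K}$. A subgroup of $\mathrm{Aut}(\mathbb{A}^n)$ is triangular if it consists of triangular automorphisms. A subgroup $G$ of $\mathrm{Aut}(\mathbb{A}^n)$ is algebraic if $G$ has a structure of an algebraic group over $\mathbb{K}$ such that the action $G\times\mathbb{A}^n\to\mathbb{A}^n$ is a morphism of algebraic varieties. It is connected if it is connected as an algebraic group. *)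

theory Defs
  imports
    "HOL-Algebra.Bij"
    "HOL-Algebra.Solvable_Groups"
    "HOL-Analysis.Abstract_Topology"
    "HOL-Computational_Algebra.Polynomial"
    "HOL-Library.Poly_Mapping"
begin

section \<open>Polynomials and the Zariski topology\<close>

text \<open>Variables are indexed from \<open>0\<close>: the polynomial ring in \<open>n\<close> variables uses the
  variables with indices \<open>0, \<dots>, n - 1\<close>. Points of affine \<open>n\<close>-space are lists of length \<open>n\<close>.\<close>

type_synonym 'k mpoly = "(nat \<Rightarrow>\<^sub>0 nat) \<Rightarrow>\<^sub>0 'k"

definition poly_ring :: "nat \<Rightarrow> 'k::comm_ring_1 mpoly set" where
  "poly_ring n = {p. \<forall>m\<in>Poly_Mapping.keys p. Poly_Mapping.keys m \<subseteq> {..<n}}"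

definition eval_monom :: "(nat \<Rightarrow>\<^sub>0 nat) \<Rightarrow> 'k::comm_ring_1 list \<Rightarrow> 'k" where
  "eval_monom m a = (\<Prod>i\<in>Poly_Mapping.keys m. (a ! i) ^ Poly_Mapping.lookup m i)"

definition eval :: "'k::comm_ring_1 mpoly \<Rightarrow> 'k list \<Rightarrow> 'k" where
  "eval p a = (\<Sum>m\<in>Poly_Mapping.keys p. Poly_Mapping.lookup p m * eval_monom m a)"

definition affine_space :: "nat \<Rightarrow> 'k list set" where
  "affine_space n = {a. length a = n}"

definition zero_set :: "nat \<Rightarrow> 'k::comm_ring_1 mpoly set \<Rightarrow> 'k list set" where
  "zero_set n S = {a \<in> affine_space n. \<forall>p\<in>S. eval p a = 0}"

definition zariski_open :: "nat \<Rightarrow> 'k::comm_ring_1 list set \<Rightarrow> bool" where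
  "zariski_open n U \<longleftrightarrow>
     U \<subseteq> affine_space n \<and> (\<exists>S \<subseteq> poly_ring n. affine_space n - U = zero_set n S)"

definition zariski :: "nat \<Rightarrow> 'k::comm_ring_1 list topology" where
  "zariski n = topology (zariski_open n)"

lemma eval_superset:
  assumes "finite A" "Poly_Mapping.keys p \<subseteq> A"
  shows "eval p a = (\<Sum>m\<in>A. Poly_Mapping.lookup p m * eval_monom m a)"
  unfolding eval_def using assms
  by (intro sum.mono_neutral_left) (auto simp: in_keys_iff)

lemma eval_monom_superset:
  assumes "finite A" "Poly_Mapping.keys m \<subseteq> A"
  shows "eval_monom m a = (\<Prod>i\<in>A. (a ! i) ^ Poly_Mapping.lookup m i)"
  unfolding eval_monom_def using assms
  by (intro prod.mono_neutral_left) (auto simp: in_keys_iff)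

lemma eval_0 [simp]: "eval 0 a = 0"
  by (simp add: eval_def)

lemma eval_single: "eval (Poly_Mapping.single m c) a = c * eval_monom m a"
  by (subst eval_superset[of "{m}"]) (auto split: if_splits)

lemma eval_add: "eval (p + q) a = eval p a + eval q a"
proof -
  let ?A = "Poly_Mapping.keys p \<union> Poly_Mapping.keys q"
  have "eval (p + q) a = (\<Sum>m\<in>?A. Poly_Mapping.lookup (p + q) m * eval_monom m a)"
    by (rule eval_superset) (use Poly_Mapping.keys_add[of p q] in auto)
  also have "\<dots> = (\<Sum>m\<in>?A. Poly_Mapping.lookup p m * eval_monom m a)
      + (\<Sum>m\<in>?A. Poly_Mapping.lookup q m * eval_monom m a)"
    by (simp add: lookup_add distrib_right sum.distrib)
  also have "\<dots> = eval p a + eval q a"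
    by (simp add: eval_superset[of ?A])
  finally show ?thesis .
qed

lemma eval_monom_add: "eval_monom (m + m') a = eval_monom m a * eval_monom m' a"
proof -
  let ?A = "Poly_Mapping.keys m \<union> Poly_Mapping.keys m'"
  have "eval_monom (m + m') a = (\<Prod>i\<in>?A. (a ! i) ^ Poly_Mapping.lookup (m + m') i)"
    by (rule eval_monom_superset) (use Poly_Mapping.keys_add[of m m'] in auto)
  also have "\<dots> = eval_monom m a * eval_monom m' a"
    by (simp add: eval_monom_superset[of ?A] lookup_add power_add prod.distrib)
  finally show ?thesis .
qed

lemma eval_sum: "eval (sum f I) a = (\<Sum>i\<in>I. eval (f i) a)"
  by (induction I rule: infinite_finite_induct) (auto simp: eval_add)

lemma mpoly_sum_monoms:
  "p = (\<Sum>m\<in>Poly_Mapping.keys p. Poly_Mapping.single m (Poly_Mapping.lookup p m))"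
  by (rule poly_mapping_eqI) (auto simp: lookup_sum lookup_single when_def in_keys_iff)

lemma eval_mult: "eval (p * q) a = eval p a * eval q a"
proof -
  have "p * q = (\<Sum>m\<in>Poly_Mapping.keys p. \<Sum>m'\<in>Poly_Mapping.keys q.
      Poly_Mapping.single (m + m') (Poly_Mapping.lookup p m * Poly_Mapping.lookup q m'))"
    by (subst (1) mpoly_sum_monoms[of p], subst (1) mpoly_sum_monoms[of q])
       (simp add: sum_product mult_single)
  then have "eval (p * q) a = (\<Sum>m\<in>Poly_Mapping.keys p. \<Sum>m'\<in>Poly_Mapping.keys q.
      (Poly_Mapping.lookup p m * eval_monom m a) * (Poly_Mapping.lookup q m' * eval_monom m' a))"
    by (simp add: eval_sum eval_single eval_monom_add mult_ac)
  then show ?thesis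
    by (simp add: eval_def sum_product)
qed

lemma poly_ring_mult: "p \<in> poly_ring n \<Longrightarrow> q \<in> poly_ring n \<Longrightarrow> p * q \<in> poly_ring n"
  unfolding poly_ring_def
proof safe
  fix m i
  assume p: "\<forall>m\<in>Poly_Mapping.keys p. Poly_Mapping.keys m \<subseteq> {..<n}"
    and q: "\<forall>m\<in>Poly_Mapping.keys q. Poly_Mapping.keys m \<subseteq> {..<n}"
    and m: "m \<in> Poly_Mapping.keys (p * q)" and i: "i \<in> Poly_Mapping.keys m"
  from m obtain a b where ab: "a \<in> Poly_Mapping.keys p" "b \<in> Poly_Mapping.keys q" "m = a + b"
    using Poly_Mapping.keys_mult[of p q] by blast
  with i have "i \<in> Poly_Mapping.keys a \<or> i \<in> Poly_Mapping.keys b"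
    using Poly_Mapping.keys_add[of a b] by blast
  with p q ab show "i < n"
    by blast
qed

lemma istopology_zariski: "istopology (zariski_open n :: 'k::idom list set \<Rightarrow> bool)"
proof -
  have int: "zariski_open n (U \<inter> V)" if U: "zariski_open n U" and V: "zariski_open n V"
    for U V :: "'k list set"
  proof -
    from U V obtain S T where S: "S \<subseteq> poly_ring n" "affine_space n - U = zero_set n S"
      and T: "T \<subseteq> poly_ring n" "affine_space n - V = zero_set n T"
      and UV: "U \<subseteq> affine_space n"
      unfolding zariski_open_def by blast
    let ?P = "{p * q | p q. p \<in> S \<and> q \<in> T}"
    have "affine_space n - U \<inter> V = zero_set n S \<union> zero_set n T"
      using S T by blast
    also have "\<dots> = zero_set n ?P"
    proof
      show "zero_set n S \<union> zero_set n T \<subseteq> zero_set n ?P"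
        by (auto simp: zero_set_def eval_mult)
      show "zero_set n ?P \<subseteq> zero_set n S \<union> zero_set n T"
      proof
        fix a assume a: "a \<in> zero_set n ?P"
        show "a \<in> zero_set n S \<union> zero_set n T"
        proof (rule ccontr)
          assume "a \<notin> zero_set n S \<union> zero_set n T"
          with a obtain p q where "p \<in> S" "q \<in> T" "eval p a \<noteq> 0" "eval q a \<noteq> 0"
            by (auto simp: zero_set_def)
          moreover from this have "eval (p * q) a = 0"
            using a by (auto simp: zero_set_def)
          ultimately show False
            by (simp add: eval_mult)
        qed
      qed
    qed
    finally have "affine_space n - U \<inter> V = zero_set n ?P" .
    moreover have "?P \<subseteq> poly_ring n"
      using S T poly_ring_mult by blast
    ultimately show ?thesis
      using UV unfolding zariski_open_def by blast
  qed
  have union: "zariski_open n (\<Union>\<U>)" if "\<forall>U\<in>\<U>. zariski_open n U" for \<U> :: "'k list set set"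
  proof -
    from that obtain S where S: "\<And>U. U \<in> \<U> \<Longrightarrow> S U \<subseteq> poly_ring n"
      "\<And>U. U \<in> \<U> \<Longrightarrow> affine_space n - U = zero_set n (S U)"
      and sub: "\<And>U. U \<in> \<U> \<Longrightarrow> U \<subseteq> affine_space n"
      unfolding zariski_open_def by metis
    have "affine_space n - \<Union>\<U> = zero_set n (\<Union>U\<in>\<U>. S U)"
    proof (intro equalityI subsetI)
      fix a assume a: "a \<in> affine_space n - \<Union>\<U>"
      then have "\<And>U. U \<in> \<U> \<Longrightarrow> a \<in> zero_set n (S U)"
        using S(2) by blast
      then show "a \<in> zero_set n (\<Union>U\<in>\<U>. S U)"
        using a by (auto simp: zero_set_def)
    next
      fix a assume a: "a \<in> zero_set n (\<Union>U\<in>\<U>. S U)"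
      then have "\<And>U. U \<in> \<U> \<Longrightarrow> a \<in> affine_space n - U"
        by (subst S(2)) (auto simp: zero_set_def)
      then show "a \<in> affine_space n - \<Union>\<U>"
        using a by (auto simp: zero_set_def)
    qed
    then show ?thesis
      using S(1) sub unfolding zariski_open_def by (blast intro!: exI[of _ "\<Union>U\<in>\<U>. S U"])
  qed
  show ?thesis
    unfolding istopology_def using int union by blast
qed

lemma openin_zariski: "openin (zariski n :: 'k::idom list topology) = zariski_open n"
  unfolding zariski_def using istopology_zariski by (rule topology_inverse')

lemma zariski_open_affine_space: "zariski_open n (affine_space n :: 'k::idom list set)"
  unfolding zariski_open_def
proof (intro conjI exI[of _ "{1}"])
  have "eval 1 a = 1" for a :: "'k list"
    using eval_single[of 0 1 a] by (simp add: eval_monom_def)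
  then show "affine_space n - affine_space n = zero_set n ({1} :: 'k mpoly set)"
    by (simp add: zero_set_def)
qed (auto simp: poly_ring_def)

lemma topspace_zariski [simp]: "topspace (zariski n :: 'k::idom list topology) = affine_space n"
proof
  show "topspace (zariski n :: 'k list topology) \<subseteq> affine_space n"
    unfolding topspace_def openin_zariski by (auto simp: zariski_open_def)
  show "affine_space n \<subseteq> topspace (zariski n :: 'k list topology)"
    by (rule openin_subset) (simp add: openin_zariski zariski_open_affine_space)
qed

lemma closedin_zariski:
  "closedin (zariski n) (Z :: 'k::idom list set) \<longleftrightarrow> (\<exists>S \<subseteq> poly_ring n. Z = zero_set n S)"
proof -
  have "zero_set n S \<subseteq> affine_space n" for S :: "'k mpoly set"
    by (auto simp: zero_set_def)
  then show ?thesis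
    unfolding closedin_def openin_zariski topspace_zariski zariski_open_def
    by (metis Diff_subset double_diff order_refl)
qed


section \<open>Varieties\<close>

definition regular_function :: "nat \<Rightarrow> 'k::field list set \<Rightarrow> ('k list \<Rightarrow> 'k) \<Rightarrow> bool" where
  "regular_function m W f \<longleftrightarrow>
     (\<forall>a\<in>W. \<exists>U p q. openin (zariski m) U \<and> a \<in> U \<and> p \<in> poly_ring m \<and> q \<in> poly_ring m \<and>
        (\<forall>b \<in> W \<inter> U. eval q b \<noteq> 0 \<and> f b = eval p b / eval q b))"

definition regular_map ::
  "nat \<Rightarrow> 'k::field list set \<Rightarrow> nat \<Rightarrow> ('k list \<Rightarrow> 'k list) \<Rightarrow> bool" where
  "regular_map m W k F \<longleftrightarrow>
     (\<forall>a\<in>W. F a \<in> affine_space k) \<and> (\<forall>i<k. regular_function m W (\<lambda>a. F a ! i))"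

text \<open>An abstract variety over an algebraically closed field is given by a finite atlas whose
  charts identify subsets of the point set with closed subsets of affine spaces. Overlaps are open
  with regular transition maps, and the separation axiom asks that the diagonal is closed, i.e.
  that for any two charts the image of their overlap in the product of the charts is closed.
  Varieties may be reducible, disconnected and non-affine.\<close>

record ('x, 'k) chart =
  chart_dom :: "'x set"
  chart_dim :: nat
  chart_coord :: "'x \<Rightarrow> 'k list"

record ('x, 'k) variety =
  points :: "'x set"
  charts :: "('x, 'k) chart set"

abbreviation chart_image :: "('x, 'k) chart \<Rightarrow> 'k list set" where
  "chart_image c \<equiv> chart_coord c ` chart_dom c"

abbreviation chart_inv :: "('x, 'k) chart \<Rightarrow> 'k list \<Rightarrow> 'x" where
  "chart_inv c \<equiv> inv_into (chart_dom c) (chart_coord c)"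

abbreviation chart_topology :: "('x, 'k::field) chart \<Rightarrow> 'k list topology" where
  "chart_topology c \<equiv> subtopology (zariski (chart_dim c)) (chart_image c)"

definition is_variety :: "('x, 'k::field) variety \<Rightarrow> bool" where
  "is_variety X \<longleftrightarrow>
     finite (charts X) \<and>
     (\<Union>c\<in>charts X. chart_dom c) = points X \<and>
     (\<forall>c\<in>charts X. inj_on (chart_coord c) (chart_dom c) \<and>
        closedin (zariski (chart_dim c)) (chart_image c)) \<and>
     (\<forall>c\<in>charts X. \<forall>d\<in>charts X.
        openin (chart_topology c) (chart_coord c ` (chart_dom c \<inter> chart_dom d)) \<and>
        regular_map (chart_dim c) (chart_coord c ` (chart_dom c \<inter> chart_dom d))
          (chart_dim d) (chart_coord d \<circ> chart_inv c) \<and>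
        closedin (zariski (chart_dim c + chart_dim d))
          ((\<lambda>x. chart_coord c x @ chart_coord d x) ` (chart_dom c \<inter> chart_dom d)))"

definition variety_open :: "('x, 'k::field) variety \<Rightarrow> 'x set \<Rightarrow> bool" where
  "variety_open X U \<longleftrightarrow> U \<subseteq> points X \<and>
     (\<forall>c\<in>charts X. openin (chart_topology c) (chart_coord c ` (U \<inter> chart_dom c)))"

definition variety_topology :: "('x, 'k::field) variety \<Rightarrow> 'x topology" where
  "variety_topology X = topology (variety_open X)"

lemma istopology_variety:
  assumes "is_variety X"
  shows "istopology (variety_open X)"
proof -
  have int: "variety_open X (U \<inter> V)" if "variety_open X U" "variety_open X V" for U V
    unfolding variety_open_def
  proof (intro conjI ballI)
    show "U \<inter> V \<subseteq> points X"
      using that by (auto simp: variety_open_def)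
    fix c assume c: "c \<in> charts X"
    then have "inj_on (chart_coord c) (chart_dom c)"
      using assms by (auto simp: is_variety_def)
    then have "chart_coord c ` (U \<inter> V \<inter> chart_dom c) =
        chart_coord c ` (U \<inter> chart_dom c) \<inter> chart_coord c ` (V \<inter> chart_dom c)"
      by (subst inj_on_image_Int[symmetric, where C = "chart_dom c"])
         (auto intro: arg_cong[where f = "\<lambda>A. chart_coord c ` A"])
    then show "openin (chart_topology c) (chart_coord c ` (U \<inter> V \<inter> chart_dom c))"
      using that c by (auto simp: variety_open_def)
  qed
  have union: "variety_open X (\<Union>\<U>)" if "\<forall>U\<in>\<U>. variety_open X U" for \<U>
    unfolding variety_open_def
  proof (intro conjI ballI)
    show "\<Union>\<U> \<subseteq> points X"
      using that by (auto simp: variety_open_def)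
    fix c assume c: "c \<in> charts X"
    have "chart_coord c ` (\<Union>\<U> \<inter> chart_dom c) = (\<Union>U\<in>\<U>. chart_coord c ` (U \<inter> chart_dom c))"
      by auto
    also have "openin (chart_topology c) \<dots>"
      using that c by (intro openin_Union) (auto simp: variety_open_def)
    finally show "openin (chart_topology c) (chart_coord c ` (\<Union>\<U> \<inter> chart_dom c))" .
  qed
  show ?thesis
    unfolding istopology_def using int union by blast
qed

lemma openin_variety_topology:
  "is_variety X \<Longrightarrow> openin (variety_topology X) = variety_open X"
  unfolding variety_topology_def by (rule topology_inverse'[OF istopology_variety])

text \<open>The openness condition, for all pairs of charts, expresses continuity.\<close>

definition variety_morphism ::
  "('x, 'k::field) variety \<Rightarrow> ('y, 'k) variety \<Rightarrow> ('x \<Rightarrow> 'y) \<Rightarrow> bool" where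
  "variety_morphism X Y f \<longleftrightarrow>
     f \<in> points X \<rightarrow> points Y \<and>
     (\<forall>c\<in>charts X. \<forall>d\<in>charts Y.
        openin (chart_topology c) (chart_coord c ` (chart_dom c \<inter> f -` chart_dom d)) \<and>
        regular_map (chart_dim c) (chart_coord c ` (chart_dom c \<inter> f -` chart_dom d))
          (chart_dim d) (chart_coord d \<circ> f \<circ> chart_inv c))"

definition product_chart :: "('x, 'k) chart \<Rightarrow> ('y, 'k) chart \<Rightarrow> ('x \<times> 'y, 'k) chart" where
  "product_chart c d =
     \<lparr>chart_dom = chart_dom c \<times> chart_dom d,
      chart_dim = chart_dim c + chart_dim d,
      chart_coord = (\<lambda>(x, y). chart_coord c x @ chart_coord d y)\<rparr>"

definition product_variety ::
  "('x, 'k) variety \<Rightarrow> ('y, 'k) variety \<Rightarrow> ('x \<times> 'y, 'k) variety" where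
  "product_variety X Y =
     \<lparr>points = points X \<times> points Y,
      charts = {product_chart c d | c d. c \<in> charts X \<and> d \<in> charts Y}\<rparr>"

definition affine_space_variety :: "nat \<Rightarrow> ('k list, 'k) variety" where
  "affine_space_variety n =
     \<lparr>points = affine_space n,
      charts = {\<lparr>chart_dom = affine_space n, chart_dim = n, chart_coord = (\<lambda>a. a)\<rparr>}\<rparr>"


section \<open>Automorphisms of affine space and algebraic groups\<close>

definition coordinate_tuple ::
  "nat \<Rightarrow> ('k::field list \<Rightarrow> 'k list) \<Rightarrow> 'k mpoly list \<Rightarrow> bool" where
  "coordinate_tuple n F fs \<longleftrightarrow>
     length fs = n \<and> set fs \<subseteq> poly_ring n \<and> (\<forall>a\<in>affine_space n. F a = map (\<lambda>f. eval f a) fs)"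

text \<open>Polynomial automorphisms as bijections of \<open>n\<close>-space with a polynomial inverse, under
  composition. Over an infinite field the coordinate tuple of such a map is unique; it consists of
  the images of the variables under the corresponding algebra automorphism of the polynomial
  ring.\<close>

definition Aut_affine :: "nat \<Rightarrow> ('k::field list \<Rightarrow> 'k list) monoid" where
  "Aut_affine n = BijGroup (affine_space n)
     \<lparr>carrier := {F \<in> Bij (affine_space n).
        (\<exists>fs. coordinate_tuple n F fs) \<and>
        (\<exists>gs. coordinate_tuple n (inv_into (affine_space n) F) gs)}\<rparr>"

text \<open>With \<open>0\<close>-based indices, the \<open>i\<close>-th component is \<open>l * x\<^sub>i + h\<close> with \<open>h\<close> in the first \<open>i\<close>
  variables; in particular \<open>h\<close> is a constant for \<open>i = 0\<close>.\<close>

definition triangular :: "nat \<Rightarrow> ('k::field list \<Rightarrow> 'k list) \<Rightarrow> bool" where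
  "triangular n F \<longleftrightarrow>
     (\<exists>fs. coordinate_tuple n F fs \<and>
        (\<forall>i<n. \<exists>l h. l \<noteq> 0 \<and> h \<in> poly_ring i \<and>
           fs ! i = Poly_Mapping.single (Poly_Mapping.single i 1) l + h))"

definition triangular_subgroup :: "nat \<Rightarrow> ('k::field list \<Rightarrow> 'k list) set \<Rightarrow> bool" where
  "triangular_subgroup n H \<longleftrightarrow> subgroup H (Aut_affine n) \<and> (\<forall>F\<in>H. triangular n F)"

definition algebraic_group :: "('g, 'm) monoid_scheme \<Rightarrow> ('g, 'k::field) variety \<Rightarrow> bool" where
  "algebraic_group G X \<longleftrightarrow>
     group G \<and> is_variety X \<and> points X = carrier G \<and>
     variety_morphism (product_variety X X) X (\<lambda>(g, h). g \<otimes>\<^bsub>G\<^esub> h) \<and>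
     variety_morphism X X (\<lambda>g. inv\<^bsub>G\<^esub> g)"

definition algebraic_structure ::
  "nat \<Rightarrow> ('k::field list \<Rightarrow> 'k list) set \<Rightarrow> ('k list \<Rightarrow> 'k list, 'k) variety \<Rightarrow> bool" where
  "algebraic_structure n H X \<longleftrightarrow>
     algebraic_group (Aut_affine n\<lparr>carrier := H\<rparr>) X \<and>
     variety_morphism (product_variety X (affine_space_variety n)) (affine_space_variety n)
       (\<lambda>(F, a). F a)"

definition connected_algebraic_subgroup :: "nat \<Rightarrow> ('k::field list \<Rightarrow> 'k list) set \<Rightarrow> bool" where
  "connected_algebraic_subgroup n H \<longleftrightarrow>
     subgroup H (Aut_affine n) \<and>
     (\<exists>X. algebraic_structure n H X \<and> connected_space (variety_topology X))"

end

theory Submission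
  imports Defs
begin

text \<open>
  Give the variables the weights \<open>1, D, D\<^sup>2, \<dots>\<close>. A triangular automorphism of degree at most \<open>D\<close> has an
  \<open>i\<close>-th component of weighted degree at most \<open>D\<^sup>i\<close>, and this property is stable under composition, so
  the components of all elements of the generated group \<open>H\<close> lie in one finite-dimensional space of
  polynomials. Hence an automorphism in \<open>H\<close> is determined by its values at finitely many points;
  these values together with those of the inverse embed \<open>H\<close> in an affine space, such that the group
  operations are restrictions of polynomial maps and the closure of \<open>H\<close> is again a group.

  The image of each \<open>G\<^sub>i\<close> is constructible by Chevalley's theorem, and irreducible since it is
  connected and homogeneous. Among the products of such images there is one with a maximal closure,
  because chains of irreducible sets have bounded length. It is dense in \<open>H\<close> and contains a nonempty
  open subset of the closure, so that \<open>H\<close> is closed and irreducible. Solvability follows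
  from the triangular form: the derived series fixes one more coordinate after every second step.
\<close>

section \<open>Polynomial functions\<close>

text \<open>The automorphism group of affine space is not an algebraic group of finite dimension,
  and degrees usually grow without bound under composition; so the classical result on subgroups
  generated by connected ones has no ambient group to live in. The weights provide one: substituting
  for each variable a function whose weighted degree is at most the weight of that variable does not
  raise weighted degrees. No bound on degrees is among the hypotheses. It has to be extracted from
  an abstract, possibly non-affine variety structure on each \<open>G i\<close>, through the sole
  fact that the action is a morphism. Values of the inverse belong to the code for a reason: the
  scalings of a line, coded by their factor alone, form a punctured line, which is not closed, while
  the pairs of a factor and its inverse form a hyperbola. Polynomials are mostly handled as
  functions, which turns substitution into composition. Dimension theory is replaced by counting
  monomials.\<close>

definition polyfun :: "nat \<Rightarrow> ('k::comm_ring_1 list \<Rightarrow> 'k) \<Rightarrow> bool" where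
  "polyfun m f \<longleftrightarrow> (\<exists>p\<in>poly_ring m. \<forall>a\<in>affine_space m. f a = eval p a)"

definition wmonoms :: "nat \<Rightarrow> (nat \<Rightarrow> nat) \<Rightarrow> nat \<Rightarrow> (nat \<Rightarrow>\<^sub>0 nat) set" where
  "wmonoms m w e = {k. Poly_Mapping.keys k \<subseteq> {..<m} \<and> (\<Sum>i<m. w i * Poly_Mapping.lookup k i) \<le> e}"

text \<open>One representing polynomial within the bound is enough. A bound is thus proved by
  exhibiting a polynomial, and it passes to every function with the same values on
  \<open>m\<close>-space.\<close>

definition wpolyfun :: "nat \<Rightarrow> (nat \<Rightarrow> nat) \<Rightarrow> nat \<Rightarrow> ('k::comm_ring_1 list \<Rightarrow> 'k) \<Rightarrow> bool" where
  "wpolyfun m w e f \<longleftrightarrow>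
     (\<exists>p. Poly_Mapping.keys p \<subseteq> wmonoms m w e \<and> (\<forall>a\<in>affine_space m. f a = eval p a))"

lemma affine_space_iff [simp]: "a \<in> affine_space m \<longleftrightarrow> length a = m"
  by (simp add: affine_space_def)

lemma wpolyfun_imp_polyfun: "wpolyfun m w e f \<Longrightarrow> polyfun m f"
  unfolding wpolyfun_def polyfun_def poly_ring_def wmonoms_def by blast

lemma polyfun_imp_wpolyfun:
  assumes "polyfun m f" obtains e where "wpolyfun m w e f"
proof -
  obtain p where p: "p \<in> poly_ring m" "\<forall>a\<in>affine_space m. f a = eval p a"
    using assms by (auto simp: polyfun_def)
  let ?d = "\<lambda>k. \<Sum>i<m. w i * Poly_Mapping.lookup k i"
  have "Poly_Mapping.keys p \<subseteq> wmonoms m w (\<Sum>k\<in>Poly_Mapping.keys p. ?d k)"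
    using p(1) by (auto simp: wmonoms_def poly_ring_def intro: member_le_sum)
  then show ?thesis
    using that p(2) unfolding wpolyfun_def by blast
qed

lemma wpolyfun_cong:
  "wpolyfun m w e f \<Longrightarrow> (\<And>a. length a = m \<Longrightarrow> f a = g a) \<Longrightarrow> wpolyfun m w e g"
  unfolding wpolyfun_def by auto

lemma wpolyfun_mono: "wpolyfun m w e f \<Longrightarrow> e \<le> e' \<Longrightarrow> wpolyfun m w e' f"
  unfolding wpolyfun_def wmonoms_def by fastforce

lemma wpolyfun_const: "wpolyfun m w e (\<lambda>_. c)"
  unfolding wpolyfun_def
  by (intro exI[of _ "Poly_Mapping.single 0 c"])
     (auto simp: eval_single eval_monom_def wmonoms_def split: if_splits)

lemma eval_monom_single: "eval_monom (Poly_Mapping.single i d) a = (a ! i) ^ d"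
  by (cases "d = 0") (auto simp: eval_monom_def)

lemma wpolyfun_nth: "i < m \<Longrightarrow> w i \<le> e \<Longrightarrow> wpolyfun m w e (\<lambda>a. a ! i)"
  unfolding wpolyfun_def
  by (intro exI[of _ "Poly_Mapping.single (Poly_Mapping.single i 1) 1"])
     (auto simp: eval_single eval_monom_single wmonoms_def lookup_single when_def
        if_distrib[of "\<lambda>x. w _ * x"] cong: if_cong)

lemma wpolyfun_add:
  "wpolyfun m w e f \<Longrightarrow> wpolyfun m w e g \<Longrightarrow> wpolyfun m w e (\<lambda>a. f a + g a)"
  unfolding wpolyfun_def
proof clarify
  fix p q :: "'a mpoly"
  assume "Poly_Mapping.keys p \<subseteq> wmonoms m w e" "Poly_Mapping.keys q \<subseteq> wmonoms m w e"
    "\<forall>a\<in>affine_space m. f a = eval p a" "\<forall>a\<in>affine_space m. g a = eval q a"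
  then show "\<exists>p. Poly_Mapping.keys p \<subseteq> wmonoms m w e \<and>
      (\<forall>a\<in>affine_space m. f a + g a = eval p a)"
    using Poly_Mapping.keys_add[of p q] by (intro exI[of _ "p + q"]) (auto simp: eval_add)
qed

lemma wmonoms_add:
  "k \<in> wmonoms m w e \<Longrightarrow> k' \<in> wmonoms m w e' \<Longrightarrow> k + k' \<in> wmonoms m w (e + e')"
  using Poly_Mapping.keys_add[of k k']
  by (auto simp: wmonoms_def lookup_add distrib_left sum.distrib)

lemma wpolyfun_mult:
  "wpolyfun m w e f \<Longrightarrow> wpolyfun m w e' g \<Longrightarrow> wpolyfun m w (e + e') (\<lambda>a. f a * g a)"
  unfolding wpolyfun_def
proof clarify
  fix p q :: "'a mpoly"
  assume "Poly_Mapping.keys p \<subseteq> wmonoms m w e" "Poly_Mapping.keys q \<subseteq> wmonoms m w e'"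
    "\<forall>a\<in>affine_space m. f a = eval p a" "\<forall>a\<in>affine_space m. g a = eval q a"
  moreover from this have "Poly_Mapping.keys (p * q) \<subseteq> wmonoms m w (e + e')"
    using Poly_Mapping.keys_mult[of p q] wmonoms_add by blast
  ultimately show "\<exists>p. Poly_Mapping.keys p \<subseteq> wmonoms m w (e + e') \<and>
      (\<forall>a\<in>affine_space m. f a * g a = eval p a)"
    by (intro exI[of _ "p * q"]) (simp add: eval_mult)
qed

lemma wpolyfun_cmult: "wpolyfun m w e f \<Longrightarrow> wpolyfun m w e (\<lambda>a. c * f a)"
  using wpolyfun_mult[OF wpolyfun_const[of m w 0 c]] by simp

lemma wpolyfun_sum:
  "(\<And>i. i \<in> I \<Longrightarrow> wpolyfun m w e (f i)) \<Longrightarrow> wpolyfun m w e (\<lambda>a. \<Sum>i\<in>I. f i a)"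
  by (induction I rule: infinite_finite_induct) (auto intro: wpolyfun_const wpolyfun_add)

lemma wpolyfun_power: "wpolyfun m w e f \<Longrightarrow> wpolyfun m w (d * e) (\<lambda>a. f a ^ d)"
  by (induction d) (auto intro: wpolyfun_const wpolyfun_mult)

lemma wpolyfun_prod:
  "(\<And>i. i \<in> I \<Longrightarrow> wpolyfun m w (e i) (f i)) \<Longrightarrow> wpolyfun m w (\<Sum>i\<in>I. e i) (\<lambda>a. \<Prod>i\<in>I. f i a)"
  by (induction I rule: infinite_finite_induct) (auto intro: wpolyfun_const wpolyfun_mult)

text \<open>Positive weights bound every exponent by \<open>e\<close>, so exponent vectors embed
  into \<open>{..<m} \<rightarrow>\<^sub>E {..e}\<close>. The crude count suffices for the
  comparison of powers in \<open>no_infinite_irr_chain\<close>.\<close>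

lemma finite_wmonoms:
  assumes "\<And>i. i < m \<Longrightarrow> w i \<ge> 1"
  shows "finite (wmonoms m w e)" "card (wmonoms m w e) \<le> (e + 1) ^ m"
proof -
  let ?r = "\<lambda>k. restrict (Poly_Mapping.lookup k) {..<m}"
  have inj: "inj_on ?r (wmonoms m w e)"
  proof (rule inj_onI)
    fix k k' assume k: "k \<in> wmonoms m w e" "k' \<in> wmonoms m w e" "?r k = ?r k'"
    have "Poly_Mapping.lookup k i = Poly_Mapping.lookup k' i" for i
    proof (cases "i < m")
      case True
      then show ?thesis using fun_cong[OF k(3), of i] by simp
    next
      case False
      then have "i \<notin> Poly_Mapping.keys k" "i \<notin> Poly_Mapping.keys k'"
        using k by (auto simp: wmonoms_def)
      then show ?thesis by (simp add: in_keys_iff)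
    qed
    then show "k = k'" by (rule poly_mapping_eqI)
  qed
  have sub: "?r ` wmonoms m w e \<subseteq> {..<m} \<rightarrow>\<^sub>E {..e}"
  proof clarify
    fix k assume k: "k \<in> wmonoms m w e"
    have "Poly_Mapping.lookup k i \<le> e" if i: "i < m" for i
    proof -
      have "Poly_Mapping.lookup k i \<le> w i * Poly_Mapping.lookup k i"
        using assms[OF i] by simp
      also have "\<dots> \<le> (\<Sum>i<m. w i * Poly_Mapping.lookup k i)"
        using i by (intro member_le_sum) auto
      finally show ?thesis using k by (simp add: wmonoms_def)
    qed
    then show "?r k \<in> {..<m} \<rightarrow>\<^sub>E {..e}" by auto
  qed
  have fin: "finite ({..<m} \<rightarrow>\<^sub>E {..e})" by (intro finite_PiE) auto
  show "finite (wmonoms m w e)"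
    using inj_on_finite[OF inj sub fin] .
  show "card (wmonoms m w e) \<le> (e + 1) ^ m"
    using card_inj_on_le[OF inj sub fin] by (simp add: card_PiE)
qed

text \<open>All functions within the bound are expanded over the same finite index set
  \<open>wmonoms m w e\<close>; its span is the finite-dimensional space in which linear algebra is
  done later.\<close>

lemma wpolyfunE:
  assumes "wpolyfun m w e f" "\<And>i. i < m \<Longrightarrow> w i \<ge> 1"
  obtains c where "\<And>a. length a = m \<Longrightarrow> f a = (\<Sum>k\<in>wmonoms m w e. c k * eval_monom k a)"
proof -
  obtain p where p: "Poly_Mapping.keys p \<subseteq> wmonoms m w e" "\<forall>a\<in>affine_space m. f a = eval p a"
    using assms(1) by (auto simp: wpolyfun_def)
  have "f a = (\<Sum>k\<in>wmonoms m w e. Poly_Mapping.lookup p k * eval_monom k a)" if "length a = m" for a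
    using eval_superset[OF finite_wmonoms(1)[of m w e] p(1)] p(2) assms(2) that by simp
  then show ?thesis using that by blast
qed

lemma polyfun_eval: "p \<in> poly_ring m \<Longrightarrow> polyfun m (eval p)"
  by (auto simp: polyfun_def)

lemma polyfun_cong:
  "polyfun m f \<Longrightarrow> (\<And>a. length a = m \<Longrightarrow> f a = g a) \<Longrightarrow> polyfun m g"
  unfolding polyfun_def by auto

lemma polyfun_const: "polyfun m (\<lambda>_. c)"
  using wpolyfun_const by (rule wpolyfun_imp_polyfun)

lemma polyfun_nth: "i < m \<Longrightarrow> polyfun m (\<lambda>a. a ! i)"
  using wpolyfun_nth[OF _ order_refl] by (rule wpolyfun_imp_polyfun)

lemma polyfun_mult: "polyfun m f \<Longrightarrow> polyfun m g \<Longrightarrow> polyfun m (\<lambda>a. f a * g a)"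
proof -
  assume "polyfun m f" "polyfun m g"
  then obtain p q where "p \<in> poly_ring m" "\<forall>a\<in>affine_space m. f a = eval p a"
    "q \<in> poly_ring m" "\<forall>a\<in>affine_space m. g a = eval q a"
    by (auto simp: polyfun_def)
  then show "polyfun m (\<lambda>a. f a * g a)"
    unfolding polyfun_def by (intro bexI[of _ "p * q"]) (simp_all add: eval_mult poly_ring_mult)
qed

lemma poly_ring_add: "p \<in> poly_ring n \<Longrightarrow> q \<in> poly_ring n \<Longrightarrow> p + q \<in> poly_ring n"
  using Poly_Mapping.keys_add[of p q] by (auto simp: poly_ring_def)

lemma polyfun_add: "polyfun m f \<Longrightarrow> polyfun m g \<Longrightarrow> polyfun m (\<lambda>a. f a + g a)"
proof -
  assume "polyfun m f" "polyfun m g"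
  then obtain p q where "p \<in> poly_ring m" "\<forall>a\<in>affine_space m. f a = eval p a"
    "q \<in> poly_ring m" "\<forall>a\<in>affine_space m. g a = eval q a"
    by (auto simp: polyfun_def)
  then show "polyfun m (\<lambda>a. f a + g a)"
    unfolding polyfun_def by (intro bexI[of _ "p + q"]) (simp_all add: eval_add poly_ring_add)
qed

lemma polyfun_minus: "polyfun m f \<Longrightarrow> polyfun m (\<lambda>a. - f a)"
  using polyfun_mult[OF polyfun_const[of m "-1"]] by simp

lemma polyfun_diff: "polyfun m f \<Longrightarrow> polyfun m g \<Longrightarrow> polyfun m (\<lambda>a. f a - g a)"
  using polyfun_add[OF _ polyfun_minus[of m g]] by simp

lemma polyfun_sum:
  "(\<And>i. i \<in> I \<Longrightarrow> polyfun m (f i)) \<Longrightarrow> polyfun m (\<lambda>a. \<Sum>i\<in>I. f i a)"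
  by (induction I rule: infinite_finite_induct) (auto intro: polyfun_const polyfun_add)

lemma polyfun_prod:
  "(\<And>i. i \<in> I \<Longrightarrow> polyfun m (f i)) \<Longrightarrow> polyfun m (\<lambda>a. \<Prod>i\<in>I. f i a)"
  by (induction I rule: infinite_finite_induct) (auto intro: polyfun_const polyfun_mult)

lemma polyfun_power: "polyfun m f \<Longrightarrow> polyfun m (\<lambda>a. f a ^ d)"
  by (induction d) (auto intro: polyfun_const polyfun_mult)

lemmas polyfun_intros = polyfun_const polyfun_nth polyfun_add polyfun_mult polyfun_diff
  polyfun_minus polyfun_sum polyfun_prod polyfun_power

text \<open>Polynomial functions are generated by constants and coordinates under sums and products.
  The case \<open>cong\<close> reflects that \<open>polyfun m\<close> sees values only on lists of
  length \<open>m\<close>.\<close>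

lemma polyfun_induct [consumes 1, case_names const nth add mult cong]:
  assumes "polyfun m f"
    and const: "\<And>c. P (\<lambda>_. c)"
    and nth: "\<And>i. i < m \<Longrightarrow> P (\<lambda>a. a ! i)"
    and add: "\<And>f g. P f \<Longrightarrow> P g \<Longrightarrow> P (\<lambda>a. f a + g a)"
    and mult: "\<And>f g. P f \<Longrightarrow> P g \<Longrightarrow> P (\<lambda>a. f a * g a)"
    and cong: "\<And>f g. P f \<Longrightarrow> (\<And>a. length a = m \<Longrightarrow> f a = g a) \<Longrightarrow> P g"
  shows "P f"
proof -
  obtain p where p: "p \<in> poly_ring m" "\<forall>a\<in>affine_space m. f a = eval p a"
    using assms(1) by (auto simp: polyfun_def)
  have power: "P (\<lambda>a. g a ^ d)" if "P g" for g d
    by (induction d) (use const[of 1] mult[OF that] in auto)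
  have prod: "P (\<lambda>a. \<Prod>i\<in>I. g i a)" if "\<And>i. i \<in> I \<Longrightarrow> P (g i)" for g and I :: "nat set"
    using that by (induction I rule: infinite_finite_induct) (use const[of 1] in \<open>auto intro: mult\<close>)
  have sum: "P (\<lambda>a. \<Sum>i\<in>I. g i a)" if "\<And>i. i \<in> I \<Longrightarrow> P (g i)"
    for g and I :: "(nat \<Rightarrow>\<^sub>0 nat) set"
    using that by (induction I rule: infinite_finite_induct) (use const[of 0] in \<open>auto intro: add\<close>)
  have "P (eval p)"
    unfolding eval_def eval_monom_def
    by (intro sum mult prod power const nth) (use p(1) in \<open>auto simp: poly_ring_def\<close>)
  then show ?thesis
    by (rule cong) (use p(2) in auto)
qed

section \<open>Polynomial maps, substitution and restriction to lines\<close>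

definition polymap :: "nat \<Rightarrow> nat \<Rightarrow> ('k::comm_ring_1 list \<Rightarrow> 'k list) \<Rightarrow> bool" where
  "polymap m k F \<longleftrightarrow>
     (\<forall>a. length a = m \<longrightarrow> length (F a) = k) \<and> (\<forall>i<k. polyfun m (\<lambda>a. F a ! i))"

lemma polymap_length: "polymap m k F \<Longrightarrow> length a = m \<Longrightarrow> length (F a) = k"
  by (simp add: polymap_def)

lemma polyfun_compose: "polyfun k f \<Longrightarrow> polymap m k F \<Longrightarrow> polyfun m (\<lambda>a. f (F a))"
proof (induction rule: polyfun_induct)
  case (cong f g)
  show ?case
    by (rule polyfun_cong[OF cong.IH[OF cong.prems]]) (use cong in \<open>auto simp: polymap_def\<close>)
qed (auto intro: polyfun_intros simp: polymap_def)

lemma polymap_compose: "polymap k l G \<Longrightarrow> polymap m k F \<Longrightarrow> polymap m l (\<lambda>a. G (F a))"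
  using polyfun_compose[of k _ m F] by (auto simp: polymap_def)

lemma polymap_append:
  assumes "polymap m k F" "polymap m l G"
  shows "polymap m (k + l) (\<lambda>a. F a @ G a)"
  unfolding polymap_def
proof (intro conjI allI impI)
  fix i assume i: "i < k + l"
  show "polyfun m (\<lambda>a. (F a @ G a) ! i)"
  proof (cases "i < k")
    case True
    then have "polyfun m (\<lambda>a. F a ! i)" using assms by (simp add: polymap_def)
    then show ?thesis
      by (rule polyfun_cong) (use True assms in \<open>auto simp: polymap_def nth_append\<close>)
  next
    case False
    then have "polyfun m (\<lambda>a. G a ! (i - k))" using assms i by (simp add: polymap_def)
    then show ?thesis
      by (rule polyfun_cong) (use False assms in \<open>auto simp: polymap_def nth_append\<close>)
  qed
qed (use assms in \<open>auto simp: polymap_def\<close>)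

lemma polymap_take: "k \<le> m \<Longrightarrow> polymap m k (take k)"
  unfolding polymap_def by (auto intro: polyfun_nth)

lemma polymap_drop: "polymap (m + k) k (drop m)"
  unfolding polymap_def
  by (auto intro!: polyfun_cong[OF polyfun_nth[of "m + _" "m + k"]])

lemma polymap_id: "polymap m m (\<lambda>a. a)"
  by (auto simp: polymap_def intro: polyfun_nth)

lemma polymap_const: "length c = k \<Longrightarrow> polymap m k (\<lambda>_. c)"
  by (auto simp: polymap_def intro: polyfun_const)

lemma polymap_map:
  "(\<And>i. i < k \<Longrightarrow> polyfun m (\<lambda>a. f i a)) \<Longrightarrow> polymap m k (\<lambda>a. map (\<lambda>i. f i a) [0..<k])"
  by (auto simp: polymap_def)

text \<open>A monomial of weighted degree at most \<open>e\<close> stays within \<open>e\<close>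
  when the variable \<open>i\<close> of weight \<open>w i\<close> is replaced by something of
  weighted degree at most \<open>w i\<close>. With \<open>m = k\<close> and \<open>v = w\<close>
  this is the stability under composition on which the bounded degree of the generated group
  rests.\<close>

lemma wpolyfun_compose:
  assumes "wpolyfun k w e f" "\<And>i. i < k \<Longrightarrow> w i \<ge> 1"
    and len: "\<And>a. length a = m \<Longrightarrow> length (F a) = k"
    and F: "\<And>i. i < k \<Longrightarrow> wpolyfun m v (w i) (\<lambda>a. F a ! i)"
  shows "wpolyfun m v e (\<lambda>a. f (F a))"
proof -
  obtain c where c: "\<And>a. length a = k \<Longrightarrow> f a = (\<Sum>\<kappa>\<in>wmonoms k w e. c \<kappa> * eval_monom \<kappa> a)"
    using wpolyfunE[OF assms(1,2)] by blast
  have "wpolyfun m v e (\<lambda>a. \<Sum>\<kappa>\<in>wmonoms k w e. c \<kappa> *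
      (\<Prod>i<k. (F a ! i) ^ Poly_Mapping.lookup \<kappa> i))"
  proof (intro wpolyfun_sum wpolyfun_cmult)
    fix \<kappa> assume \<kappa>: "\<kappa> \<in> wmonoms k w e"
    have "wpolyfun m v (\<Sum>i<k. Poly_Mapping.lookup \<kappa> i * w i)
        (\<lambda>a. \<Prod>i<k. (F a ! i) ^ Poly_Mapping.lookup \<kappa> i)"
      by (intro wpolyfun_prod wpolyfun_power F) auto
    then show "wpolyfun m v e (\<lambda>a. \<Prod>i<k. (F a ! i) ^ Poly_Mapping.lookup \<kappa> i)"
      by (rule wpolyfun_mono) (use \<kappa> in \<open>simp add: wmonoms_def mult.commute\<close>)
  qed
  then show ?thesis
  proof (rule wpolyfun_cong)
    fix a :: "'a list" assume "length a = m"
    then show "(\<Sum>\<kappa>\<in>wmonoms k w e. c \<kappa> * (\<Prod>i<k. (F a ! i) ^ Poly_Mapping.lookup \<kappa> i)) = f (F a)"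
      by (subst c) (auto simp: len wmonoms_def eval_monom_superset[of "{..<k}"])
  qed
qed

text \<open>The point is the uniformity: \<open>D\<close> depends on \<open>f\<close> alone, neither
  on the parameter \<open>x\<close> nor on the direction \<open>v\<close>. A fraction describing the
  action near a point of a chart then bounds the degrees of all nearby automorphisms at
  once.\<close>

lemma polyfun_line:
  assumes "polyfun (m + n) (f :: 'k::comm_ring_1 list \<Rightarrow> 'k)"
  obtains D where "\<And>x v. length x = m \<Longrightarrow> length v = n \<Longrightarrow>
    \<exists>r. degree r \<le> D \<and> (\<forall>t. poly r t = f (x @ map ((*) t) v))"
proof -
  have "\<exists>D. \<forall>x v. length x = m \<longrightarrow> length v = n \<longrightarrow>
      (\<exists>r. degree r \<le> D \<and> (\<forall>t. poly r t = f (x @ map ((*) t) v)))"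
    using assms
  proof (induction rule: polyfun_induct)
    case (const c)
    show ?case by (rule exI[of _ 0], intro allI impI exI[of _ "[:c:]"]) auto
  next
    case (nth i)
    show ?case
    proof (rule exI[of _ 1], intro allI impI)
      fix x v :: "'k list" assume "length x = m" "length v = n"
      then show "\<exists>r. degree r \<le> 1 \<and> (\<forall>t. poly r t = (x @ map ((*) t) v) ! i)"
        using nth by (intro exI[of _ "if i < m then [:x ! i:] else [:0, v ! (i - m):]"])
          (auto simp: nth_append)
    qed
  next
    case (add f g)
    then obtain D E where
      D: "\<forall>x v. length x = m \<longrightarrow> length v = n \<longrightarrow>
        (\<exists>r. degree r \<le> D \<and> (\<forall>t. poly r t = f (x @ map ((*) t) v)))" and
      E: "\<forall>x v. length x = m \<longrightarrow> length v = n \<longrightarrow>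
        (\<exists>r. degree r \<le> E \<and> (\<forall>t. poly r t = g (x @ map ((*) t) v)))"
      by blast
    show ?case
    proof (intro exI[of _ "max D E"] allI impI)
      fix x v :: "'k list" assume "length x = m" "length v = n"
      then obtain r s where "degree r \<le> D" "\<forall>t. poly r t = f (x @ map ((*) t) v)"
        "degree s \<le> E" "\<forall>t. poly s t = g (x @ map ((*) t) v)"
        using D E by blast
      then show "\<exists>r. degree r \<le> max D E \<and>
          (\<forall>t. poly r t = f (x @ map ((*) t) v) + g (x @ map ((*) t) v))"
        by (intro exI[of _ "r + s"]) (auto intro: degree_add_le)
    qed
  next
    case (mult f g)
    then obtain D E where
      D: "\<forall>x v. length x = m \<longrightarrow> length v = n \<longrightarrow>
        (\<exists>r. degree r \<le> D \<and> (\<forall>t. poly r t = f (x @ map ((*) t) v)))" and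
      E: "\<forall>x v. length x = m \<longrightarrow> length v = n \<longrightarrow>
        (\<exists>r. degree r \<le> E \<and> (\<forall>t. poly r t = g (x @ map ((*) t) v)))"
      by blast
    show ?case
    proof (intro exI[of _ "D + E"] allI impI)
      fix x v :: "'k list" assume "length x = m" "length v = n"
      then obtain r s where "degree r \<le> D" "\<forall>t. poly r t = f (x @ map ((*) t) v)"
        "degree s \<le> E" "\<forall>t. poly s t = g (x @ map ((*) t) v)"
        using D E by blast
      then show "\<exists>r. degree r \<le> D + E \<and>
          (\<forall>t. poly r t = f (x @ map ((*) t) v) * g (x @ map ((*) t) v))"
        by (intro exI[of _ "r * s"]) (auto intro: degree_mult_le[THEN order_trans] add_mono)
    qed
  next
    case (cong f g)
    then obtain D where D: "\<forall>x v. length x = m \<longrightarrow> length v = n \<longrightarrow>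
        (\<exists>r. degree r \<le> D \<and> (\<forall>t. poly r t = f (x @ map ((*) t) v)))" by blast
    show ?case
    proof (intro exI[of _ D] allI impI)
      fix x v :: "'k list" assume "length x = m" "length v = n"
      then show "\<exists>r. degree r \<le> D \<and> (\<forall>t. poly r t = g (x @ map ((*) t) v))"
        using D cong(2) by (metis length_append length_map)
    qed
  qed
  then show ?thesis using that by blast
qed

section \<open>Noetherian induction\<close>

definition subring_set :: "'a::comm_ring_1 set \<Rightarrow> bool" where
  "subring_set S \<longleftrightarrow> 0 \<in> S \<and> 1 \<in> S \<and> (\<forall>a\<in>S. \<forall>b\<in>S. a - b \<in> S \<and> a * b \<in> S)"

definition ideal_in :: "'a::comm_ring_1 set \<Rightarrow> 'a set \<Rightarrow> bool" where
  "ideal_in S I \<longleftrightarrow> I \<subseteq> S \<and> 0 \<in> I \<and> (\<forall>a\<in>I. \<forall>b\<in>I. a + b \<in> I) \<and> (\<forall>s\<in>S. \<forall>a\<in>I. s * a \<in> I)"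

definition acc_ideals :: "'a::comm_ring_1 set \<Rightarrow> bool" where
  "acc_ideals S \<longleftrightarrow> (\<forall>J :: nat \<Rightarrow> 'a set. (\<forall>n. ideal_in S (J n) \<and> J n \<subseteq> J (Suc n)) \<longrightarrow>
     (\<exists>N. \<forall>n\<ge>N. J n = J N))"

definition adjoin :: "'a::comm_ring_1 set \<Rightarrow> 'a \<Rightarrow> 'a set" where
  "adjoin S x = {\<Sum>i\<le>d. s i * x ^ i | d s. \<forall>i. s i \<in> S}"

text \<open>The length \<open>d\<close> is formal and \<open>s d\<close> may be zero. This makes
  each of these sets an ideal when \<open>I\<close> is one, and lets them grow with \<open>d\<close>
  through multiplication by \<open>x\<close>.\<close>

definition leading_coeffs :: "'a::comm_ring_1 set \<Rightarrow> 'a \<Rightarrow> 'a set \<Rightarrow> nat \<Rightarrow> 'a set" where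
  "leading_coeffs S x I d = {s d | s :: nat \<Rightarrow> 'a. (\<forall>i. s i \<in> S) \<and> (\<Sum>i\<le>d. s i * x ^ i) \<in> I}"

lemma leading_coeffsI:
  "\<forall>i. s i \<in> S \<Longrightarrow> (\<Sum>i\<le>d. s i * x ^ i) \<in> I \<Longrightarrow> s d \<in> leading_coeffs S x I d"
  unfolding leading_coeffs_def by (intro CollectI exI[of _ s] conjI refl)

lemma leading_coeffsE:
  assumes "a \<in> leading_coeffs S x I d"
  obtains s where "\<forall>i. s i \<in> S" "a = s d" "(\<Sum>i\<le>d. s i * x ^ i) \<in> I"
  using assms unfolding leading_coeffs_def by (elim CollectE exE conjE) metis

lemma adjoinI: "\<forall>i. s i \<in> S \<Longrightarrow> (\<Sum>i\<le>d. s i * x ^ i) \<in> adjoin S x"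
  unfolding adjoin_def by (intro CollectI exI[of _ d] exI[of _ s] conjI refl)

lemma adjoinE:
  assumes "a \<in> adjoin S x"
  obtains d s where "a = (\<Sum>i\<le>d. s i * x ^ i)" "\<forall>i. s i \<in> S"
  using assms unfolding adjoin_def by (elim CollectE exE conjE) metis

lemma sum_closed:
  assumes "0 \<in> A" "\<And>a b. a \<in> A \<Longrightarrow> b \<in> A \<Longrightarrow> a + b \<in> A" "\<And>i. i \<in> I \<Longrightarrow> f i \<in> A"
  shows "sum f I \<in> A"
  using assms(3) by (induction I rule: infinite_finite_induct) (auto intro: assms(1,2))

lemma subring_setD:
  assumes "subring_set S"
  shows "0 \<in> S" "1 \<in> S" "a \<in> S \<Longrightarrow> b \<in> S \<Longrightarrow> a - b \<in> S" "a \<in> S \<Longrightarrow> b \<in> S \<Longrightarrow> a * b \<in> S"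
    "a \<in> S \<Longrightarrow> b \<in> S \<Longrightarrow> a + b \<in> S"
proof -
  show *: "0 \<in> S" "1 \<in> S" "a \<in> S \<Longrightarrow> b \<in> S \<Longrightarrow> a - b \<in> S" "a \<in> S \<Longrightarrow> b \<in> S \<Longrightarrow> a * b \<in> S" for a b
    using assms by (auto simp: subring_set_def)
  have "a + b = a - (0 - b)" by simp
  then show "a \<in> S \<Longrightarrow> b \<in> S \<Longrightarrow> a + b \<in> S"
    using * by metis
qed

lemma ideal_inD:
  assumes "ideal_in S I"
  shows "I \<subseteq> S" "0 \<in> I" "a \<in> I \<Longrightarrow> b \<in> I \<Longrightarrow> a + b \<in> I" "s \<in> S \<Longrightarrow> a \<in> I \<Longrightarrow> s * a \<in> I"
  using assms by (auto simp: ideal_in_def)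

lemma subset_adjoin:
  assumes "subring_set S" shows "S \<subseteq> adjoin S x"
  unfolding adjoin_def by clarify (rule exI[of _ 0], rule exI[of _ "\<lambda>_. _"], auto)

lemma adjoin_generator:
  assumes "subring_set S" shows "x \<in> adjoin S x"
  unfolding adjoin_def
  by clarify (rule exI[of _ 1], rule exI[of _ "\<lambda>i. if i = 1 then 1 else 0"],
    use subring_setD[OF assms] in auto)

lemma ideal_in_leading_coeffs:
  assumes S: "subring_set S" and I: "ideal_in (adjoin S x) I"
  shows "ideal_in S (leading_coeffs S x I d)"
  unfolding ideal_in_def
proof (intro conjI ballI)
  show "leading_coeffs S x I d \<subseteq> S" by (auto simp: leading_coeffs_def)
  show "0 \<in> leading_coeffs S x I d"
    unfolding leading_coeffs_def
    by clarify (rule exI[of _ "\<lambda>_. 0"], use subring_setD[OF S] ideal_inD[OF I] in auto)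
next
  fix a b assume "a \<in> leading_coeffs S x I d" "b \<in> leading_coeffs S x I d"
  then obtain s t where st: "\<forall>i. s i \<in> S" "\<forall>i. t i \<in> S" "a = s d" "b = t d"
    "(\<Sum>i\<le>d. s i * x ^ i) \<in> I" "(\<Sum>i\<le>d. t i * x ^ i) \<in> I"
    unfolding leading_coeffs_def by blast
  moreover have "(\<Sum>i\<le>d. (s i + t i) * x ^ i) = (\<Sum>i\<le>d. s i * x ^ i) + (\<Sum>i\<le>d. t i * x ^ i)"
    by (simp add: distrib_right sum.distrib)
  ultimately show "a + b \<in> leading_coeffs S x I d"
    unfolding leading_coeffs_def using subring_setD[OF S] ideal_inD[OF I]
    by clarify (rule exI[of _ "\<lambda>i. s i + t i"], auto)
next
  fix r a assume r: "r \<in> S" and "a \<in> leading_coeffs S x I d"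
  then obtain s where s: "\<forall>i. s i \<in> S" "a = s d" "(\<Sum>i\<le>d. s i * x ^ i) \<in> I"
    unfolding leading_coeffs_def by blast
  have "r * (\<Sum>i\<le>d. s i * x ^ i) \<in> I"
    using s r subset_adjoin[OF S] ideal_inD[OF I] by blast
  then have "(\<Sum>i\<le>d. (r * s i) * x ^ i) \<in> I"
    by (simp add: sum_distrib_left mult.assoc)
  then show "r * a \<in> leading_coeffs S x I d"
    unfolding leading_coeffs_def using s r subring_setD[OF S]
    by clarify (rule exI[of _ "\<lambda>i. r * s i"], auto)
qed

lemma leading_coeffs_Suc:
  assumes S: "subring_set S" and I: "ideal_in (adjoin S x) I"
  shows "leading_coeffs S x I d \<subseteq> leading_coeffs S x I (Suc d)"
proof
  fix a assume "a \<in> leading_coeffs S x I d"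
  then obtain s where s: "\<forall>i. s i \<in> S" "a = s d" "(\<Sum>i\<le>d. s i * x ^ i) \<in> I"
    unfolding leading_coeffs_def by blast
  define t where "t = case_nat 0 s"
  have "x * (\<Sum>i\<le>d. s i * x ^ i) \<in> I"
    using s adjoin_generator[OF S] ideal_inD[OF I] by blast
  also have "x * (\<Sum>i\<le>d. s i * x ^ i) = (\<Sum>i\<le>Suc d. t i * x ^ i)"
    by (simp add: sum.atMost_Suc_shift t_def sum_distrib_left mult_ac del: sum.atMost_Suc)
  finally show "a \<in> leading_coeffs S x I (Suc d)"
    unfolding leading_coeffs_def
    by clarify (rule exI[of _ t], use s subring_setD[OF S] in \<open>auto simp: t_def split: nat.split\<close>)
qed

lemma leading_coeffs_mono:
  "I \<subseteq> J \<Longrightarrow> leading_coeffs S x I d \<subseteq> leading_coeffs S x J d"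
  unfolding leading_coeffs_def by blast

text \<open>Induction on the formal length: an expression in \<open>J\<close> has the same top
  coefficient as some expression in \<open>I\<close> of the same length; their difference lies in
  \<open>J\<close>, is shorter, and so lies in \<open>I\<close>.\<close>

lemma ideal_eq_if_leading_coeffs_eq:
  assumes S: "subring_set S" and I: "ideal_in (adjoin S x) I" and J: "ideal_in (adjoin S x) J"
    and sub: "I \<subseteq> J" and eq: "\<And>d. leading_coeffs S x J d = leading_coeffs S x I d"
  shows "J = I"
proof
  have "(\<Sum>i\<le>d. s i * x ^ i) \<in> I" if "\<forall>i. s i \<in> S" "(\<Sum>i\<le>d. s i * x ^ i) \<in> J" for d s
    using that
  proof (induction d arbitrary: s)
    case 0
    from leading_coeffsI[OF this] have "s 0 \<in> leading_coeffs S x I 0" unfolding eq .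
    then show ?case by (elim leading_coeffsE) simp
  next
    case (Suc d)
    from leading_coeffsI[OF this(2,3)] have "s (Suc d) \<in> leading_coeffs S x I (Suc d)"
      unfolding eq .
    then obtain t where t: "\<forall>i. t i \<in> S" "s (Suc d) = t (Suc d)" "(\<Sum>i\<le>Suc d. t i * x ^ i) \<in> I"
      by (rule leading_coeffsE)
    have "0 - 1 \<in> S" using subring_setD[OF S] by blast
    then have "0 - 1 \<in> adjoin S x" by (rule subsetD[OF subset_adjoin[OF S]])
    then have "-1 \<in> adjoin S x" by simp
    moreover have "(\<Sum>i\<le>Suc d. t i * x ^ i) \<in> J" using t(3) sub by blast
    ultimately have "(\<Sum>i\<le>Suc d. s i * x ^ i) + -1 * (\<Sum>i\<le>Suc d. t i * x ^ i) \<in> J"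
      by (rule ideal_inD(3)[OF J Suc.prems(2) ideal_inD(4)[OF J]])
    also have "(\<Sum>i\<le>Suc d. s i * x ^ i) + -1 * (\<Sum>i\<le>Suc d. t i * x ^ i) =
        (\<Sum>i\<le>d. (s i - t i) * x ^ i)"
      using t(2) by (simp add: left_diff_distrib sum_subtractf)
    finally have diff: "(\<Sum>i\<le>d. (s i - t i) * x ^ i) \<in> J" .
    have "\<forall>i. s i - t i \<in> S" using Suc.prems(1) t(1) subring_setD(3)[OF S] by blast
    from ideal_inD(3)[OF I Suc.IH[OF this diff] t(3)]
    have "(\<Sum>i\<le>d. (s i - t i) * x ^ i) + (\<Sum>i\<le>Suc d. t i * x ^ i) \<in> I" .
    also have "(\<Sum>i\<le>d. (s i - t i) * x ^ i) + (\<Sum>i\<le>Suc d. t i * x ^ i) =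
        (\<Sum>i\<le>Suc d. s i * x ^ i)"
      using t(2) by (simp add: left_diff_distrib sum_subtractf)
    finally show ?case .
  qed
  note * = this
  show "J \<subseteq> I"
  proof
    fix a assume a: "a \<in> J"
    then have "a \<in> adjoin S x" using ideal_inD(1)[OF J] by blast
    then obtain d s where "a = (\<Sum>i\<le>d. s i * x ^ i)" "\<forall>i. s i \<in> S" by (rule adjoinE)
    then show "a \<in> I" using *[of s d] a by simp
  qed
qed (rule sub)

text \<open>Hilbert's basis theorem. The element \<open>x\<close> need not be transcendental over \<open>S\<close>, since
  leading coefficients are taken of expressions and not of elements.\<close>

theorem acc_ideals_adjoin:
  assumes S: "subring_set S" and acc: "acc_ideals S"
  shows "acc_ideals (adjoin S x)"
  unfolding acc_ideals_def
proof (intro allI impI)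
  fix J :: "nat \<Rightarrow> 'a set"
  assume "\<forall>n. ideal_in (adjoin S x) (J n) \<and> J n \<subseteq> J (Suc n)"
  then have J: "\<And>n. ideal_in (adjoin S x) (J n)" "\<And>n. J n \<subseteq> J (Suc n)" by auto
  have acc': "\<exists>N. \<forall>n\<ge>N. L n = L N" if "\<And>n. ideal_in S (L n)" "\<And>n. L n \<subseteq> L (Suc n)" for L
    using acc that unfolding acc_ideals_def by blast
  let ?L = "\<lambda>n d. leading_coeffs S x (J n) d"
  have monoJ: "J n \<subseteq> J n'" if "n \<le> n'" for n n'
    using J(2) that by (rule lift_Suc_mono_le)
  have mono1: "?L n d \<subseteq> ?L n' d" if "n \<le> n'" for n n' d
    using monoJ[OF that] by (rule leading_coeffs_mono)
  have mono2: "?L n d \<subseteq> ?L n d'" if "d \<le> d'" for n d d'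
    using leading_coeffs_Suc[OF S J(1)] that by (rule lift_Suc_mono_le)
  \<comment> \<open>The diagonal handles all large lengths at once: for \<open>d \<ge> N\<close> and
    \<open>n \<ge> N\<close> the ideal \<open>?L n d\<close> lies between \<open>?L N N\<close> and
    a later diagonal entry, which is the same ideal. The finitely many \<open>d < N\<close> are
    treated one by one.\<close>
  have "\<exists>N. \<forall>n\<ge>N. ?L n n = ?L N N"
  proof (rule acc'[of "\<lambda>n. ?L n n"])
    show "ideal_in S (?L n n)" for n by (rule ideal_in_leading_coeffs[OF S J(1)])
    show "?L n n \<subseteq> ?L (Suc n) (Suc n)" for n
      using mono1[of n "Suc n" n] mono2[of n "Suc n" "Suc n"] by auto
  qed
  then obtain N where N: "\<And>n. n \<ge> N \<Longrightarrow> ?L n n = ?L N N" by blast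
  have "\<exists>M. \<forall>n\<ge>M. ?L n d = ?L M d" for d
  proof (rule acc'[of "\<lambda>n. ?L n d"])
    show "ideal_in S (?L n d)" for n by (rule ideal_in_leading_coeffs[OF S J(1)])
    show "?L n d \<subseteq> ?L (Suc n) d" for n by (rule mono1) simp
  qed
  then have "\<exists>M. \<forall>d. \<forall>n\<ge>M d. ?L n d = ?L (M d) d" by (intro choice allI)
  then obtain M where M: "\<And>d n. n \<ge> M d \<Longrightarrow> ?L n d = ?L (M d) d" by blast
  \<comment> \<open>The sum dominates every single \<open>M d\<close> with
    \<open>d < N\<close>.\<close>
  define K where "K = N + (\<Sum>d<N. M d)"
  have K: "?L n d = ?L K d" if "n \<ge> K" for n d
  proof (cases "d < N")
    case True
    then have "M d \<le> (\<Sum>d<N. M d)" by (intro member_le_sum) auto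
    then have "M d \<le> K" by (simp add: K_def)
    then show ?thesis using M[of d n] M[of d K] that by simp
  next
    case False
    have "?L m d = ?L N N" if m: "m \<ge> N" for m
    proof
      show "?L m d \<subseteq> ?L N N"
        using mono1[of m "max m d" d] mono2[of d "max m d" "max m d"] N[of "max m d"] False
        by auto
      show "?L N N \<subseteq> ?L m d"
        using mono1[of N m N] mono2[of N d m] False m by auto
    qed
    then show ?thesis using that by (simp add: K_def)
  qed
  have "J n = J K" if "n \<ge> K" for n
    using monoJ[OF that] K[OF that] by (rule ideal_eq_if_leading_coeffs_eq[OF S J(1) J(1)])
  then show "\<exists>N. \<forall>n\<ge>N. J n = J N" by blast
qed

section \<open>The basis theorem for polynomial rings\<close>

lemma subring_set_poly_ring: "subring_set (poly_ring m :: 'k::comm_ring_1 mpoly set)"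
proof -
  have "a - b \<in> poly_ring m" if "a \<in> poly_ring m" "b \<in> poly_ring m" for a b :: "'k mpoly"
    using that poly_ring_add[of a m "- b"] by (simp add: poly_ring_def in_keys_iff)
  then show ?thesis
    by (auto simp: subring_set_def poly_ring_mult) (auto simp: poly_ring_def)
qed

lemma var_power:
  "(Poly_Mapping.single (Poly_Mapping.single m 1) 1 :: 'k::comm_ring_1 mpoly) ^ d =
     Poly_Mapping.single (Poly_Mapping.single m d) 1"
  by (induction d) (simp_all add: mult_single single_add[symmetric])

lemma poly_ring_Suc:
  "poly_ring (Suc m) = adjoin (poly_ring m)
     (Poly_Mapping.single (Poly_Mapping.single m 1) (1 :: 'k::comm_ring_1))"
  (is "_ = adjoin ?S ?x")
proof
  note S = subring_setD[OF subring_set_poly_ring]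
  have add: "a + b \<in> adjoin ?S ?x" if ab: "a \<in> adjoin ?S ?x" "b \<in> adjoin ?S ?x" for a b
  proof -
    obtain d s where s: "a = (\<Sum>i\<le>d. s i * ?x ^ i)" "\<forall>i. s i \<in> ?S"
      using ab(1) by (rule adjoinE)
    obtain e t where t: "b = (\<Sum>i\<le>e. t i * ?x ^ i)" "\<forall>i. t i \<in> ?S"
      using ab(2) by (rule adjoinE)
    note st = s t
    define u where "u i = (if i \<le> d then s i else 0) + (if i \<le> e then t i else 0)" for i
    have "a = (\<Sum>i\<le>max d e. (if i \<le> d then s i else 0) * ?x ^ i)"
      unfolding st by (intro sum.mono_neutral_cong_left) auto
    moreover have "b = (\<Sum>i\<le>max d e. (if i \<le> e then t i else 0) * ?x ^ i)"
      unfolding st by (intro sum.mono_neutral_cong_left) auto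
    ultimately have eq: "a + b = (\<Sum>i\<le>max d e. u i * ?x ^ i)"
      by (simp add: u_def distrib_right sum.distrib)
    have "\<forall>i. u i \<in> ?S" unfolding u_def using s(2) t(2) by (auto intro: S(1,5))
    then show ?thesis unfolding eq by (rule adjoinI)
  qed
  have zero: "0 \<in> adjoin ?S ?x" by (rule subsetD[OF subset_adjoin[OF subring_set_poly_ring] S(1)])
  have mon: "Poly_Mapping.single \<kappa> c \<in> adjoin ?S ?x" if \<kappa>: "Poly_Mapping.keys \<kappa> \<subseteq> {..<Suc m}"
    for \<kappa> and c :: 'k
  proof -
    define \<kappa>' where "\<kappa>' = Poly_Mapping.update m 0 \<kappa>"
    define d where "d = Poly_Mapping.lookup \<kappa> m"
    have "\<kappa> = \<kappa>' + Poly_Mapping.single m d"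
      by (rule poly_mapping_eqI)
        (auto simp: \<kappa>'_def d_def lookup_add lookup_single lookup_update when_def)
    then have "Poly_Mapping.single \<kappa> c = Poly_Mapping.single \<kappa>' c * ?x ^ d"
      by (simp only: var_power mult_single) simp
    also have "\<dots> = (\<Sum>i\<le>d. (if i = d then Poly_Mapping.single \<kappa>' c else 0) * ?x ^ i)"
      by (simp add: if_distrib[of "\<lambda>y. y * _"] cong: if_cong)
    finally have eq: "Poly_Mapping.single \<kappa> c = \<dots>" .
    have "Poly_Mapping.keys \<kappa>' \<subseteq> {..<m}"
      using \<kappa> by (force simp: \<kappa>'_def keys_update)
    then have "Poly_Mapping.single \<kappa>' c \<in> ?S"
      by (auto simp: poly_ring_def split: if_splits)
    then have "\<forall>i. (if i = d then Poly_Mapping.single \<kappa>' c else 0) \<in> ?S" using S(1) by auto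
    then show ?thesis by (subst eq) (rule adjoinI)
  qed
  have sum: "sum f I \<in> adjoin ?S ?x" if "\<And>i. i \<in> I \<Longrightarrow> f i \<in> adjoin ?S ?x"
    for f and I :: "(nat \<Rightarrow>\<^sub>0 nat) set"
    using zero add that by (rule sum_closed)
  show "poly_ring (Suc m) \<subseteq> adjoin ?S ?x"
  proof
    fix p :: "'k mpoly" assume "p \<in> poly_ring (Suc m)"
    then show "p \<in> adjoin ?S ?x"
      by (subst mpoly_sum_monoms, intro sum mon) (auto simp: poly_ring_def)
  qed
  note S' = subring_setD[OF subring_set_poly_ring[of "Suc m"]]
  have x: "?x \<in> poly_ring (Suc m)" by (auto simp: poly_ring_def)
  have power: "?x ^ d \<in> poly_ring (Suc m)" for d
    by (induction d) (auto intro: S'(2,4) x simp del: One_nat_def)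
  have sub: "?S \<subseteq> poly_ring (Suc m)" by (force simp: poly_ring_def)
  have sum': "sum f I \<in> poly_ring (Suc m)" if "\<And>i. i \<in> I \<Longrightarrow> f i \<in> poly_ring (Suc m)"
    for f :: "nat \<Rightarrow> 'k mpoly" and I
    using S'(1,5) that by (rule sum_closed)
  show "adjoin ?S ?x \<subseteq> poly_ring (Suc m)"
  proof
    fix a assume "a \<in> adjoin ?S ?x"
    then obtain d s where s: "a = (\<Sum>i\<le>d. s i * ?x ^ i)" "\<forall>i. s i \<in> ?S"
      by (rule adjoinE)
    show "a \<in> poly_ring (Suc m)"
      unfolding s(1) by (intro sum' S'(4) power subsetD[OF sub]) (use s(2) in blast)
  qed
qed

text \<open>The constants form a copy of the field, so an ideal is zero or everything: scaling turns
  a nonzero element into any other.\<close>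

lemma acc_ideals_poly_ring_0: "acc_ideals (poly_ring 0 :: 'k::field mpoly set)"
  unfolding acc_ideals_def
proof (intro allI impI)
  fix J :: "nat \<Rightarrow> 'k mpoly set"
  assume "\<forall>n. ideal_in (poly_ring 0) (J n) \<and> J n \<subseteq> J (Suc n)"
  then have J: "\<And>n. ideal_in (poly_ring 0) (J n)" "\<And>n. J n \<subseteq> J (Suc n)" by auto
  have single: "\<exists>c. p = Poly_Mapping.single 0 c" if "p \<in> poly_ring 0" for p :: "'k mpoly"
    using that by (intro exI[of _ "Poly_Mapping.lookup p 0"] poly_mapping_eqI)
      (auto simp: poly_ring_def lookup_single when_def in_keys_iff)
  show "\<exists>N. \<forall>n\<ge>N. J n = J N"
  proof (cases "\<exists>N. J N \<noteq> {0}")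
    case False
    then show ?thesis by auto
  next
    case True
    then obtain N where "J N \<noteq> {0}" by blast
    then obtain p where p: "p \<in> J N" "p \<noteq> 0" using ideal_inD(2)[OF J(1)[of N]] by blast
    then obtain c where c: "p = Poly_Mapping.single 0 c" "c \<noteq> 0"
      using single ideal_inD(1)[OF J(1)] by (metis single_zero subsetD)
    have "J n = poly_ring 0" if "n \<ge> N" for n
    proof
      show "poly_ring 0 \<subseteq> J n"
      proof
        fix q :: "'k mpoly" assume "q \<in> poly_ring 0"
        then obtain d where "q = Poly_Mapping.single 0 d" using single by blast
        then have "q = Poly_Mapping.single 0 (d / c) * p" using c by (simp add: mult_single)
        moreover have "p \<in> J n" using p lift_Suc_mono_le[of J, OF J(2) that] by blast
        moreover have "Poly_Mapping.single 0 (d / c) \<in> poly_ring 0" by (auto simp: poly_ring_def)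
        ultimately show "q \<in> J n" using ideal_inD(4)[OF J(1)] by blast
      qed
    qed (rule ideal_inD(1)[OF J(1)])
    then show ?thesis by blast
  qed
qed

lemma acc_ideals_poly_ring: "acc_ideals (poly_ring m :: 'k::field mpoly set)"
  by (induction m)
     (simp_all only: acc_ideals_poly_ring_0 poly_ring_Suc acc_ideals_adjoin subring_set_poly_ring)

section \<open>Vanishing ideals and quasi-compactness\<close>

definition vanishing_ideal :: "nat \<Rightarrow> 'k::comm_ring_1 list set \<Rightarrow> 'k mpoly set" where
  "vanishing_ideal m A = {p \<in> poly_ring m. \<forall>a\<in>A. eval p a = 0}"

lemma ideal_in_vanishing_ideal: "ideal_in (poly_ring m) (vanishing_ideal m A)"
  using subring_setD[OF subring_set_poly_ring]
  by (auto simp: ideal_in_def vanishing_ideal_def eval_add eval_mult)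

lemma wf_vanishing_ideal:
  "wf {(B, A). vanishing_ideal m A \<subset> vanishing_ideal m (B :: 'k::field list set)}"
  unfolding wf_iff_no_infinite_down_chain
proof
  assume "\<exists>f. \<forall>i. (f (Suc i), f i) \<in>
    {(B, A). vanishing_ideal m A \<subset> vanishing_ideal m (B :: 'k list set)}"
  then obtain f :: "nat \<Rightarrow> 'k list set"
    where f: "\<And>i. vanishing_ideal m (f i) \<subset> vanishing_ideal m (f (Suc i))" by blast
  then have "\<exists>N. \<forall>n\<ge>N. vanishing_ideal m (f n) = vanishing_ideal m (f N)"
    using acc_ideals_poly_ring[unfolded acc_ideals_def, rule_format, of m "\<lambda>i. vanishing_ideal m (f i)"]
      ideal_in_vanishing_ideal by blast
  then show False using f by (metis le_Suc_eq order_refl psubset_eq)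
qed

lemma noetherian_induct [consumes 1, case_names less]:
  assumes "A \<subseteq> affine_space m"
    and "\<And>A :: 'k::field list set. A \<subseteq> affine_space m \<Longrightarrow>
      (\<And>B f a. B \<subseteq> A \<Longrightarrow> polyfun m f \<Longrightarrow> (\<And>b. b \<in> B \<Longrightarrow> f b = 0) \<Longrightarrow> a \<in> A \<Longrightarrow> f a \<noteq> 0 \<Longrightarrow> P B) \<Longrightarrow> P A"
  shows "P A"
  using wf_vanishing_ideal[of m] assms(1)
proof (induction A rule: wf_induct_rule)
  case (less A)
  show ?case
  proof (rule assms(2)[OF less.prems])
    fix B f a assume B: "B \<subseteq> A" "polyfun m f" "\<And>b. b \<in> B \<Longrightarrow> f b = 0" "a \<in> A" "f a \<noteq> 0"
    then obtain p where p: "p \<in> poly_ring m" "\<forall>a\<in>affine_space m. f a = eval p a"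
      by (auto simp: polyfun_def)
    then have "p \<in> vanishing_ideal m B" "p \<notin> vanishing_ideal m A"
      using B less.prems by (force simp: vanishing_ideal_def)+
    moreover have "vanishing_ideal m A \<subseteq> vanishing_ideal m B"
      using B(1) by (auto simp: vanishing_ideal_def)
    ultimately show "P B" using B(1) less.prems by (intro less.IH) auto
  qed
qed

text \<open>Quasi-compactness of an arbitrary subset: a function that is nonzero somewhere on
  \<open>A\<close> leaves only its zero set in \<open>A\<close> to be covered. The set
  \<open>Q\<close> carries any further property wanted of the functions, such as a degree bound
  valid where they do not vanish.\<close>

lemma finite_nonvanishing_cover:
  fixes A :: "'k::field list set"
  assumes "A \<subseteq> affine_space m" "\<And>a. a \<in> A \<Longrightarrow> \<exists>q\<in>Q. polyfun m q \<and> q a \<noteq> 0"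
  obtains Q' where "finite Q'" "Q' \<subseteq> Q" "\<And>q. q \<in> Q' \<Longrightarrow> polyfun m q"
    "\<And>a. a \<in> A \<Longrightarrow> \<exists>q\<in>Q'. q a \<noteq> 0"
proof -
  have "(\<forall>a\<in>A. \<exists>q\<in>Q. polyfun m q \<and> q a \<noteq> 0) \<longrightarrow>
      (\<exists>Q'. finite Q' \<and> Q' \<subseteq> Q \<and> (\<forall>q\<in>Q'. polyfun m q) \<and> (\<forall>a\<in>A. \<exists>q\<in>Q'. q a \<noteq> 0))"
    using assms(1)
  proof (induction A rule: noetherian_induct)
    case (less A)
    show ?case
    proof (cases "A = {}")
      case False
      show ?thesis
      proof
        assume *: "\<forall>a\<in>A. \<exists>q\<in>Q. polyfun m q \<and> q a \<noteq> 0"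
        obtain a where a: "a \<in> A" using False by blast
        with * obtain q where q: "q \<in> Q" "polyfun m q" "q a \<noteq> 0" by blast
        have "\<exists>Q'. finite Q' \<and> Q' \<subseteq> Q \<and> (\<forall>q\<in>Q'. polyfun m q) \<and>
            (\<forall>a\<in>{a \<in> A. q a = 0}. \<exists>q\<in>Q'. q a \<noteq> 0)"
        proof (rule less(2)[THEN mp])
          show "{a \<in> A. q a = 0} \<subseteq> A" "polyfun m q" "a \<in> A" "q a \<noteq> 0" using a q by auto
        qed (use * in auto)
        then obtain Q' where "finite Q'" "Q' \<subseteq> Q" "\<forall>q\<in>Q'. polyfun m q"
          "\<forall>a\<in>{a \<in> A. q a = 0}. \<exists>q\<in>Q'. q a \<noteq> 0" by (elim exE conjE)
        then show "\<exists>Q'. finite Q' \<and> Q' \<subseteq> Q \<and> (\<forall>q\<in>Q'. polyfun m q) \<and> (\<forall>a\<in>A. \<exists>q\<in>Q'. q a \<noteq> 0)"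
          using q by (intro exI[of _ "insert q Q'"] conjI) auto
      qed
    qed auto
  qed
  from mp[OF this] have "\<exists>Q'. finite Q' \<and> Q' \<subseteq> Q \<and> (\<forall>q\<in>Q'. polyfun m q) \<and>
      (\<forall>a\<in>A. \<exists>q\<in>Q'. q a \<noteq> 0)"
    using assms(2) by simp
  then obtain Q' where "finite Q'" "Q' \<subseteq> Q" "\<forall>q\<in>Q'. polyfun m q" "\<forall>a\<in>A. \<exists>q\<in>Q'. q a \<noteq> 0"
    by (elim exE conjE)
  then show ?thesis by (intro that[of Q']) auto
qed

section \<open>Zariski closure and irreducible sets\<close>

definition zcl :: "nat \<Rightarrow> 'k::comm_ring_1 list set \<Rightarrow> 'k list set" where
  "zcl m S = {a. length a = m \<and> (\<forall>f. polyfun m f \<longrightarrow> (\<forall>s\<in>S. f s = 0) \<longrightarrow> f a = 0)}"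

text \<open>Primality of the vanishing ideal of a nonempty set. Stated for all subsets, since
  orbits, images and products have to be irreducible before anything is known about their
  closedness.\<close>

definition irr :: "nat \<Rightarrow> 'k::comm_ring_1 list set \<Rightarrow> bool" where
  "irr m S \<longleftrightarrow> S \<subseteq> affine_space m \<and> S \<noteq> {} \<and> (\<forall>f g. polyfun m f \<longrightarrow> polyfun m g \<longrightarrow>
     (\<forall>s\<in>S. f s * g s = 0) \<longrightarrow> (\<forall>s\<in>S. f s = 0) \<or> (\<forall>s\<in>S. g s = 0))"

lemma zcl_affine_space: "zcl m S \<subseteq> affine_space m"
  by (auto simp: zcl_def)

lemma zclD: "a \<in> zcl m S \<Longrightarrow> polyfun m f \<Longrightarrow> (\<And>s. s \<in> S \<Longrightarrow> f s = 0) \<Longrightarrow> f a = 0"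
  by (auto simp: zcl_def)

lemma zcl_superset: "S \<subseteq> affine_space m \<Longrightarrow> S \<subseteq> zcl m S"
  by (auto simp: zcl_def)

lemma zcl_minimal: "S \<subseteq> zcl m T \<Longrightarrow> zcl m S \<subseteq> zcl m T"
  unfolding zcl_def by blast

lemma zcl_polymap:
  assumes "polymap m k F" "a \<in> zcl m S" "\<And>s. s \<in> S \<Longrightarrow> F s \<in> zcl k T"
  shows "F a \<in> zcl k T"
  unfolding zcl_def
proof (intro CollectI conjI allI impI)
  show "length (F a) = k" using assms by (auto simp: zcl_def polymap_def)
  fix f :: "'a list \<Rightarrow> 'a" assume f: "polyfun k f" "\<forall>s\<in>T. f s = 0"
  show "f (F a) = 0"
    by (rule zclD[OF assms(2) polyfun_compose[OF f(1) assms(1)]])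
       (use assms(3) f zclD in blast)
qed

text \<open>The coordinates of \<open>F\<close> and \<open>G\<close> differ by polynomial functions
  vanishing on \<open>S\<close>. This is how group laws pass from a group to its closure.\<close>

lemma zcl_polymap_eq:
  assumes "polymap m k F" "polymap m k G" "\<And>s. s \<in> S \<Longrightarrow> F s = G s" "a \<in> zcl m S"
  shows "F a = G a"
proof (rule nth_equalityI)
  show "length (F a) = length (G a)" using assms by (auto simp: zcl_def polymap_def)
  fix i assume "i < length (F a)"
  then have "i < k" using assms by (auto simp: zcl_def polymap_def)
  then have "polyfun m (\<lambda>a. F a ! i - G a ! i)"
    using assms by (auto simp: polymap_def intro: polyfun_diff)
  from zclD[OF assms(4) this] show "F a ! i = G a ! i" using assms(3) by simp
qed

lemma irrD:
  assumes "irr m S" "polyfun m f" "polyfun m g" "s \<in> S" "f s \<noteq> 0" "t \<in> S" "g t \<noteq> 0"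
  obtains u where "u \<in> S" "f u \<noteq> 0" "g u \<noteq> 0"
proof -
  have "\<not> (\<forall>s\<in>S. f s * g s = 0)"
    using assms unfolding irr_def by blast
  then obtain u where "u \<in> S" "f u * g u \<noteq> 0" by blast
  moreover from this have "f u \<noteq> 0" "g u \<noteq> 0" by auto
  ultimately show ?thesis using that by blast
qed

lemma not_subset_zclE:
  assumes "S \<subseteq> affine_space m" "\<not> S \<subseteq> zcl m T"
  obtains f s where "polyfun m f" "\<And>t. t \<in> T \<Longrightarrow> f t = 0" "s \<in> S" "f s \<noteq> 0"
proof -
  obtain s where s: "s \<in> S" "s \<notin> zcl m T" using assms by blast
  then have "length s = m" using assms by auto
  with s obtain f where "polyfun m f" "\<forall>t\<in>T. f t = 0" "f s \<noteq> 0" unfolding zcl_def by blast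
  then show ?thesis using that[of f s] s by blast
qed

lemma irr_between:
  assumes "irr m S" "S \<subseteq> T" "T \<subseteq> zcl m S"
  shows "irr m T"
  unfolding irr_def
proof (intro conjI allI impI)
  show "T \<subseteq> affine_space m" using assms zcl_affine_space by blast
  show "T \<noteq> {}" using assms by (auto simp: irr_def)
  fix f g :: "'a list \<Rightarrow> 'a"
  assume fg: "polyfun m f" "polyfun m g" "\<forall>s\<in>T. f s * g s = 0"
  then have "(\<forall>s\<in>S. f s = 0) \<or> (\<forall>s\<in>S. g s = 0)"
    using assms unfolding irr_def by blast
  then show "(\<forall>s\<in>T. f s = 0) \<or> (\<forall>s\<in>T. g s = 0)"
    using fg assms(3) zclD by blast
qed

lemma irr_image:
  assumes "irr m S" "polymap m k F"
  shows "irr k (F ` S)"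
  unfolding irr_def
proof (intro conjI allI impI)
  show "F ` S \<subseteq> affine_space k" using assms by (force simp: irr_def polymap_def)
  show "F ` S \<noteq> {}" using assms by (auto simp: irr_def)
  fix f g :: "'a list \<Rightarrow> 'a"
  assume fg: "polyfun k f" "polyfun k g" "\<forall>s\<in>F ` S. f s * g s = 0"
  then have "(\<forall>s\<in>S. f (F s) = 0) \<or> (\<forall>s\<in>S. g (F s) = 0)"
    using assms polyfun_compose[OF _ assms(2)] unfolding irr_def by blast
  then show "(\<forall>s\<in>F ` S. f s = 0) \<or> (\<forall>s\<in>F ` S. g s = 0)" by blast
qed

lemma polymap_append_left: "length s = m \<Longrightarrow> polymap l (m + l) (\<lambda>t. s @ t)"
  by (rule polymap_append) (auto intro: polymap_const polymap_id)

lemma polymap_append_right: "length t = l \<Longrightarrow> polymap m (m + l) (\<lambda>s. s @ t)"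
  by (rule polymap_append) (auto intro: polymap_const polymap_id)

text \<open>If \<open>f\<close> and \<open>g\<close> are nonzero at \<open>s1 @ t1\<close> and
  \<open>s2 @ t2\<close>, irreducibility of \<open>S\<close> gives one \<open>s\<close> that works
  with both \<open>t1\<close> and \<open>t2\<close>; irreducibility of \<open>T\<close> then merges
  \<open>t1\<close> and \<open>t2\<close>.\<close>

lemma irr_append:
  fixes S T :: "'k::idom list set"
  assumes S: "irr m S" and T: "irr l T"
  shows "irr (m + l) {s @ t | s t. s \<in> S \<and> t \<in> T}"
proof -
  have len: "length s = m" "length t = l" if "s \<in> S" "t \<in> T" for s t
    using that S T by (auto simp: irr_def)
  show ?thesis
    unfolding irr_def
  proof (intro conjI allI impI)
    show "{s @ t | s t. s \<in> S \<and> t \<in> T} \<subseteq> affine_space (m + l)" using len by auto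
    show "{s @ t | s t. s \<in> S \<and> t \<in> T} \<noteq> {}" using S T by (auto simp: irr_def)
    fix f g :: "'k list \<Rightarrow> 'k"
    assume f: "polyfun (m + l) f" and g: "polyfun (m + l) g"
      and fg: "\<forall>u\<in>{s @ t | s t. s \<in> S \<and> t \<in> T}. f u * g u = 0"
    show "(\<forall>u\<in>{s @ t | s t. s \<in> S \<and> t \<in> T}. f u = 0) \<or> (\<forall>u\<in>{s @ t | s t. s \<in> S \<and> t \<in> T}. g u = 0)"
    proof (rule ccontr)
      assume "\<not> ?thesis"
      then obtain s1 t1 s2 t2 where st: "s1 \<in> S" "t1 \<in> T" "f (s1 @ t1) \<noteq> 0"
        "s2 \<in> S" "t2 \<in> T" "g (s2 @ t2) \<noteq> 0" by blast
      obtain s where s: "s \<in> S" "f (s @ t1) \<noteq> 0" "g (s @ t2) \<noteq> 0"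
        using irrD[OF S, of "\<lambda>s. f (s @ t1)" "\<lambda>s. g (s @ t2)" s1 s2] st f g len
          polyfun_compose[OF _ polymap_append_right] by metis
      obtain t where t: "t \<in> T" "f (s @ t) \<noteq> 0" "g (s @ t) \<noteq> 0"
        using irrD[OF T, of "\<lambda>t. f (s @ t)" "\<lambda>t. g (s @ t)" t1 t2] st s f g len
          polyfun_compose[OF _ polymap_append_left] by metis
      show False using fg s t by force
    qed
  qed
qed

lemma irr_finite_nonvanishing:
  fixes S :: "'k::idom list set"
  assumes "irr m S" "finite I" "\<And>i. i \<in> I \<Longrightarrow> polyfun m (g i) \<and> (\<exists>s\<in>S. g i s \<noteq> 0)"
  shows "\<exists>s\<in>S. \<forall>i\<in>I. g i s \<noteq> 0"
  using assms(2,3)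
proof (induction I)
  case empty
  then show ?case using assms(1) by (auto simp: irr_def)
next
  case (insert i I)
  then obtain s t where s: "s \<in> S" "\<forall>i\<in>I. g i s \<noteq> 0" and t: "t \<in> S" "g i t \<noteq> 0" by blast
  have "polyfun m (\<lambda>s. \<Prod>i\<in>I. g i s)" using insert by (auto intro: polyfun_prod)
  moreover have "(\<Prod>i\<in>I. g i s) \<noteq> 0" using s insert by auto
  ultimately obtain u where "u \<in> S" "(\<Prod>i\<in>I. g i u) \<noteq> 0" "g i u \<noteq> 0"
    using irrD[OF assms(1), of "\<lambda>s. \<Prod>i\<in>I. g i s" "g i" s t] s t insert by auto
  then show ?case using insert by auto
qed

text \<open>Otherwise each \<open>B i\<close> has a function vanishing on it but not on all of
  \<open>S\<close>; a point of \<open>S\<close> where none of these finitely many functions vanishes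
  is covered by no \<open>B i\<close>.\<close>

lemma irr_finite_cover:
  fixes S :: "'k::idom list set"
  assumes S: "irr m S" and "finite I" "S \<subseteq> (\<Union>i\<in>I. B i)"
  shows "\<exists>i\<in>I. S \<subseteq> zcl m (B i)"
proof (rule ccontr)
  assume "\<not> ?thesis"
  then have neg: "\<not> S \<subseteq> zcl m (B i)" if "i \<in> I" for i using that by blast
  have "\<forall>i\<in>I. \<exists>g. polyfun m g \<and> (\<forall>b\<in>B i. g b = 0) \<and> (\<exists>s\<in>S. g s \<noteq> 0)"
  proof
    fix i assume "i \<in> I"
    then obtain f s where "polyfun m f" "\<And>t. t \<in> B i \<Longrightarrow> f t = 0" "s \<in> S" "f s \<noteq> 0"
      using S neg not_subset_zclE[of S m "B i"] unfolding irr_def by blast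
    then show "\<exists>g. polyfun m g \<and> (\<forall>b\<in>B i. g b = 0) \<and> (\<exists>s\<in>S. g s \<noteq> 0)" by blast
  qed
  then obtain g where g: "\<And>i. i \<in> I \<Longrightarrow> polyfun m (g i)" "\<And>i b. i \<in> I \<Longrightarrow> b \<in> B i \<Longrightarrow> g i b = 0"
    "\<And>i. i \<in> I \<Longrightarrow> \<exists>s\<in>S. g i s \<noteq> 0" by metis
  then obtain s where "s \<in> S" "\<forall>i\<in>I. g i s \<noteq> 0"
    using irr_finite_nonvanishing[OF S assms(2), of g] by blast
  then show False using assms(3) g(2) by blast
qed

section \<open>Irreducible components\<close>

lemma finite_irr_decomposition:
  fixes A :: "'k::field list set"
  assumes "A \<subseteq> affine_space m"
  shows "\<exists>\<C>. finite \<C> \<and> \<Union>\<C> = A \<and> (\<forall>C\<in>\<C>. irr m C)"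
  using assms
proof (induction A rule: noetherian_induct)
  case (less A)
  show ?case
  proof (cases "A = {} \<or> irr m A")
    case True
    then show ?thesis
    proof
      assume "A = {}" then show ?thesis by (intro exI[of _ "{}"]) auto
    next
      assume "irr m A" then show ?thesis by (intro exI[of _ "{A}"]) auto
    qed
  next
    case False
    then obtain f g s t where fg: "polyfun m f" "polyfun m g" "\<forall>s\<in>A. f s * g s = 0"
      "s \<in> A" "f s \<noteq> 0" "t \<in> A" "g t \<noteq> 0"
      using less(1) unfolding irr_def by blast
    have "\<exists>\<C>. finite \<C> \<and> \<Union>\<C> = {a \<in> A. f a = 0} \<and> (\<forall>C\<in>\<C>. irr m C)"
      by (rule less(2)[of _ f s]) (use fg in auto)
    moreover have "\<exists>\<C>. finite \<C> \<and> \<Union>\<C> = {a \<in> A. g a = 0} \<and> (\<forall>C\<in>\<C>. irr m C)"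
      by (rule less(2)[of _ g t]) (use fg in auto)
    ultimately obtain \<C> \<D> where "finite \<C>" "\<Union>\<C> = {a \<in> A. f a = 0}" "\<forall>C\<in>\<C>. irr m C"
      "finite \<D>" "\<Union>\<D> = {a \<in> A. g a = 0}" "\<forall>C\<in>\<D>. irr m C" by blast
    then show ?thesis using fg(3) by (intro exI[of _ "\<C> \<union> \<D>"]) auto
  qed
qed

text \<open>The pieces of a finite decomposition are replaced by their closures relative to
  \<open>Y\<close>, which are again irreducible, and only the maximal ones are kept. Closures are
  relative since \<open>Y\<close> may fail to be closed.\<close>

lemma irreducible_components:
  fixes Y :: "'k::field list set"
  assumes Y: "Y \<subseteq> affine_space m"
  obtains \<C> where "finite \<C>" "\<Union>\<C> = Y" "\<And>C. C \<in> \<C> \<Longrightarrow> irr m C"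
    "\<And>C. C \<in> \<C> \<Longrightarrow> C = Y \<inter> zcl m C" "\<And>C D. C \<in> \<C> \<Longrightarrow> D \<in> \<C> \<Longrightarrow> C \<subseteq> D \<Longrightarrow> C = D"
proof -
  obtain \<C>0 where C0: "finite \<C>0" "\<Union>\<C>0 = Y" "\<And>C. C \<in> \<C>0 \<Longrightarrow> irr m C"
    using finite_irr_decomposition[OF Y] by blast
  define \<D> where "\<D> = (\<lambda>C. Y \<inter> zcl m C) ` \<C>0"
  define \<C> where "\<C> = {C \<in> \<D>. \<forall>D\<in>\<D>. C \<subseteq> D \<longrightarrow> C = D}"
  have sub: "C \<subseteq> Y \<inter> zcl m C" if "C \<in> \<C>0" for C
    using that C0 zcl_superset[of C m] Y by blast
  have D: "irr m C" "C = Y \<inter> zcl m C" if "C \<in> \<D>" for C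
  proof -
    obtain C' where C': "C' \<in> \<C>0" "C = Y \<inter> zcl m C'" using \<open>C \<in> \<D>\<close> by (auto simp: \<D>_def)
    show "irr m C" using irr_between[OF C0(3)[OF C'(1)] sub[OF C'(1)]] C' by auto
    have "zcl m C \<subseteq> zcl m C'" using C' by (intro zcl_minimal) auto
    moreover have "C \<subseteq> zcl m C" by (rule zcl_superset) (use C' Y in auto)
    ultimately show "C = Y \<inter> zcl m C" using C' by blast
  qed
  have "finite \<D>" using C0 by (simp add: \<D>_def)
  have "\<Union>\<D> = Y" using C0(2) sub unfolding \<D>_def by blast
  have "\<Union>\<C> = Y"
  proof
    show "Y \<subseteq> \<Union>\<C>"
    proof
      fix y assume "y \<in> Y"
      then obtain C where C: "C \<in> \<D>" "y \<in> C" using \<open>\<Union>\<D> = Y\<close> by blast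
      obtain M where "M \<in> \<D>" "C \<subseteq> M" "\<forall>D\<in>\<D>. M \<subseteq> D \<longrightarrow> M = D"
        using finite_has_maximal2[OF \<open>finite \<D>\<close> C(1)] by blast
      then show "y \<in> \<Union>\<C>" using C by (auto simp: \<C>_def)
    qed
  qed (use \<open>\<Union>\<D> = Y\<close> in \<open>auto simp: \<C>_def\<close>)
  show ?thesis
  proof (rule that[of \<C>])
    show "finite \<C>" using \<open>finite \<D>\<close> by (simp add: \<C>_def)
    show "\<Union>\<C> = Y" by fact
    show "irr m C" "C = Y \<inter> zcl m C" if "C \<in> \<C>" for C
      using that D[of C] by (simp_all add: \<C>_def)
    show "C = C'" if "C \<in> \<C>" "C' \<in> \<C>" "C \<subseteq> C'" for C C'
      using that by (simp add: \<C>_def)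
  qed
qed

text \<open>On a homogeneous set, the components are permuted transitively, and some point lies on only
  one of them; hence they are disjoint.\<close>

lemma homogeneous_disjoint_components:
  fixes Y :: "'k::field list set"
  assumes Y: "Y \<subseteq> affine_space m"
    and hom: "\<And>x y. x \<in> Y \<Longrightarrow> y \<in> Y \<Longrightarrow> \<exists>\<tau> \<tau>'. polymap m m \<tau> \<and> polymap m m \<tau>' \<and>
      \<tau> ` Y \<subseteq> Y \<and> \<tau>' ` Y \<subseteq> Y \<and> \<tau> x = y \<and> (\<forall>z\<in>Y. \<tau>' (\<tau> z) = z)"
  obtains \<C> where "finite \<C>" "\<Union>\<C> = Y" "\<And>C. C \<in> \<C> \<Longrightarrow> irr m C"
    "\<And>C. C \<in> \<C> \<Longrightarrow> C = Y \<inter> zcl m C" "\<And>C D. C \<in> \<C> \<Longrightarrow> D \<in> \<C> \<Longrightarrow> C \<inter> D \<noteq> {} \<Longrightarrow> C = D"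
proof -
  obtain \<C> where C: "finite \<C>" "\<Union>\<C> = Y" "\<And>C. C \<in> \<C> \<Longrightarrow> irr m C"
    "\<And>C. C \<in> \<C> \<Longrightarrow> C = Y \<inter> zcl m C" "\<And>C D. C \<in> \<C> \<Longrightarrow> D \<in> \<C> \<Longrightarrow> C \<subseteq> D \<Longrightarrow> C = D"
    using irreducible_components[OF Y] by blast
  have comp: "\<exists>C\<in>\<C>. S \<subseteq> C" if "irr m S" "S \<subseteq> Y" for S
  proof -
    have "S \<subseteq> (\<Union>C\<in>\<C>. C)" using that(2) C(2) by simp
    from irr_finite_cover[OF that(1) C(1) this] obtain C where "C \<in> \<C>" "S \<subseteq> zcl m C" by blast
    then have "S \<subseteq> C" using C(4)[of C] that(2) by blast
    then show ?thesis using \<open>C \<in> \<C>\<close> by blast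
  qed
  have "C1 = C2" if C12: "C1 \<in> \<C>" "C2 \<in> \<C>" "y \<in> C1" "y \<in> C2" for C1 C2 y
  proof -
    \<comment> \<open>An irreducible set covered by finitely many components lies in one of them,
      which here would contradict maximality. The point \<open>p\<close> obtained from this lies on
      \<open>C1\<close> only.\<close>
    have "\<not> C1 \<subseteq> (\<Union>C\<in>\<C> - {C1}. C)"
    proof
      assume "C1 \<subseteq> (\<Union>C\<in>\<C> - {C1}. C)"
      then obtain C' where C': "C' \<in> \<C> - {C1}" "C1 \<subseteq> zcl m C'"
        using irr_finite_cover[OF C(3)[OF C12(1)], of "\<C> - {C1}" "\<lambda>C. C"] C(1) by blast
      then have "C1 \<subseteq> C'" using C(2) C(4)[of C'] C12(1) by blast
      then show False using C(5)[OF C12(1), of C'] C' by blast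
    qed
    then obtain p where p: "p \<in> C1" "\<And>C. C \<in> \<C> \<Longrightarrow> p \<in> C \<Longrightarrow> C = C1" by blast
    have "y \<in> Y" using C12 C(2) by blast
    have "p \<in> Y" using p(1) C12 C(2) by blast
    from hom[OF \<open>y \<in> Y\<close> this] obtain \<tau> \<tau>' where \<tau>: "polymap m m \<tau>" "polymap m m \<tau>'" "\<tau> ` Y \<subseteq> Y" "\<tau>' ` Y \<subseteq> Y" "\<tau> y = p"
      "\<forall>z\<in>Y. \<tau>' (\<tau> z) = z" by blast
    have "\<tau> ` D \<subseteq> C1" if D: "D \<in> \<C>" "y \<in> D" for D
    proof -
      have "\<exists>C\<in>\<C>. \<tau> ` D \<subseteq> C"
        using D C(2) \<tau>(3) by (intro comp irr_image[OF C(3) \<tau>(1)]) auto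
      then show ?thesis using p(2) \<tau>(5) D(2) by blast
    qed
    note * = this
    \<comment> \<open>Every component through \<open>y\<close> is carried into \<open>C1\<close> by
      \<open>\<tau>\<close> and hence lies in the image of \<open>C1\<close> under
      \<open>\<tau>'\<close>. That image is irreducible, so it lies in a single component, which by
      maximality equals \<open>C1\<close> as well as \<open>C2\<close>.\<close>
    have "D \<subseteq> \<tau>' ` C1" if D: "D \<in> \<C>" "y \<in> D" for D
    proof
      fix z assume "z \<in> D"
      then have "\<tau> z \<in> C1" "z \<in> Y" using *[OF D] D(1) C(2) by auto
      then show "z \<in> \<tau>' ` C1" using \<tau>(6) by (intro image_eqI[of _ _ "\<tau> z"]) auto
    qed
    then have "C1 \<subseteq> \<tau>' ` C1" "C2 \<subseteq> \<tau>' ` C1" using C12 by auto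
    moreover obtain C3 where "C3 \<in> \<C>" "\<tau>' ` C1 \<subseteq> C3"
      using comp[OF irr_image[OF C(3) \<tau>(2)], of C1] C12 C(2) \<tau>(4) by blast
    ultimately show "C1 = C2" using C(5) C12 by (metis order_trans)
  qed
  then have disj: "C1 = C2" if "C1 \<in> \<C>" "C2 \<in> \<C>" "C1 \<inter> C2 \<noteq> {}" for C1 C2
    using that by blast
  show ?thesis by (rule that[OF C(1-4) disj])
qed

subsection \<open>Chains of irreducible sets\<close>

text \<open>A homogeneous system with more unknowns than equations, by Gaussian elimination: the
  equation \<open>\<kappa>\<close> is used to eliminate an unknown \<open>\<beta>\<close> with
  nonzero coefficient.\<close>

lemma exists_linear_relation:
  fixes c :: "'a \<Rightarrow> 'b \<Rightarrow> 'k::field"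
  assumes "finite K" "finite A" "card K < card A"
  shows "\<exists>x. (\<exists>\<alpha>\<in>A. x \<alpha> \<noteq> 0) \<and> (\<forall>\<kappa>\<in>K. (\<Sum>\<alpha>\<in>A. x \<alpha> * c \<alpha> \<kappa>) = 0)"
  using assms
proof (induction K arbitrary: A c)
  case empty
  then have "A \<noteq> {}" by auto
  then show ?case by (intro exI[of _ "\<lambda>_. 1"]) auto
next
  case (insert \<kappa> K)
  show ?case
  proof (cases "\<forall>\<alpha>\<in>A. c \<alpha> \<kappa> = 0")
    case True
    obtain x where "\<exists>\<alpha>\<in>A. x \<alpha> \<noteq> 0" "\<forall>\<kappa>\<in>K. (\<Sum>\<alpha>\<in>A. x \<alpha> * c \<alpha> \<kappa>) = 0"
      using insert.IH[of A c] insert.prems insert.hyps by auto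
    then show ?thesis using True by (intro exI[of _ x]) auto
  next
    case False
    then obtain \<beta> where \<beta>: "\<beta> \<in> A" "c \<beta> \<kappa> \<noteq> 0" by blast
    let ?c = "\<lambda>\<alpha> \<mu>. c \<alpha> \<mu> - c \<alpha> \<kappa> / c \<beta> \<kappa> * c \<beta> \<mu>"
    have "card K < card (A - {\<beta>})"
      using insert.prems insert.hyps \<beta> by (simp add: card_Diff_singleton)
    with insert.prems insert.IH[of "A - {\<beta>}" ?c]
    obtain x where x: "\<exists>\<alpha>\<in>A - {\<beta>}. x \<alpha> \<noteq> 0" "\<forall>\<mu>\<in>K. (\<Sum>\<alpha>\<in>A - {\<beta>}. x \<alpha> * ?c \<alpha> \<mu>) = 0"
      by blast
    \<comment> \<open>The value at \<open>\<beta>\<close> is what the eliminated equation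
      \<open>\<kappa>\<close> prescribes.\<close>
    define y where "y = x(\<beta> := - (\<Sum>\<alpha>\<in>A - {\<beta>}. x \<alpha> * c \<alpha> \<kappa>) / c \<beta> \<kappa>)"
    have y: "(\<Sum>\<alpha>\<in>A. y \<alpha> * c \<alpha> \<mu>) = y \<beta> * c \<beta> \<mu> + (\<Sum>\<alpha>\<in>A - {\<beta>}. x \<alpha> * c \<alpha> \<mu>)" for \<mu>
      using insert.prems \<beta> by (subst sum.remove[of _ \<beta>]) (auto simp: y_def intro!: sum.cong)
    have "(\<Sum>\<alpha>\<in>A. y \<alpha> * c \<alpha> \<mu>) = 0" if "\<mu> \<in> insert \<kappa> K" for \<mu>
    proof (cases "\<mu> = \<kappa>")
      case True
      then show ?thesis using \<beta> by (simp add: y) (simp add: y_def)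
    next
      case False
      then have "(\<Sum>\<alpha>\<in>A - {\<beta>}. x \<alpha> * ?c \<alpha> \<mu>) = 0" using x that by auto
      moreover have "(\<Sum>\<alpha>\<in>A - {\<beta>}. x \<alpha> * ?c \<alpha> \<mu>) =
          (\<Sum>\<alpha>\<in>A - {\<beta>}. x \<alpha> * c \<alpha> \<mu>) - (\<Sum>\<alpha>\<in>A - {\<beta>}. x \<alpha> * c \<alpha> \<kappa>) / c \<beta> \<kappa> * c \<beta> \<mu>"
        unfolding sum_divide_distrib sum_distrib_right sum_subtractf[symmetric]
        by (intro sum.cong refl) (simp add: right_diff_distrib)
      ultimately show ?thesis by (simp add: y) (simp add: y_def)
    qed
    moreover have "\<exists>\<alpha>\<in>A. y \<alpha> \<noteq> 0" using x(1) by (auto simp: y_def)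
    ultimately show ?thesis by blast
  qed
qed

text \<open>The functions \<open>f 0, \<dots>, f (N - 1)\<close> are algebraically independent on \<open>S N\<close>: a relation is divided by
  the highest possible power of \<open>f (N - 1)\<close> and then restricted to \<open>S (N - 1)\<close>.\<close>

lemma chain_algebraically_independent:
  fixes S :: "nat \<Rightarrow> 'k::idom list set"
  assumes irr: "\<And>j. irr m (S j)" and inc: "\<And>j. S j \<subseteq> S (Suc j)"
    and f: "\<And>j. polyfun m (f j)" "\<And>j s. s \<in> S j \<Longrightarrow> f j s = 0" "\<And>j. \<exists>s\<in>S (Suc j). f j s \<noteq> 0"
    and A: "finite A" "A \<noteq> {}" "A \<subseteq> extensional {..<N}" "\<And>\<alpha>. \<alpha> \<in> A \<Longrightarrow> x \<alpha> \<noteq> 0"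
  shows "\<exists>s\<in>S N. (\<Sum>\<alpha>\<in>A. x \<alpha> * (\<Prod>j<N. f j s ^ \<alpha> j)) \<noteq> 0"
  using A
proof (induction N arbitrary: A x)
  case 0
  then have "A \<subseteq> {\<lambda>_. undefined}" by simp
  with 0 have "A = {\<lambda>_. undefined}" by blast
  moreover have "S 0 \<noteq> {}" using irr by (auto simp: irr_def)
  ultimately show ?case using 0 by auto
next
  case (Suc N)
  \<comment> \<open>The largest power of \<open>f N\<close> that divides all terms; \<open>g\<close>
    is the quotient, and \<open>B\<close> collects the terms that keep no factor \<open>f N\<close>
    after the division. Only these survive on \<open>S N\<close>, where \<open>f N\<close>
    vanishes.\<close>
  define a where "a = Min ((\<lambda>\<alpha>. \<alpha> N) ` A)"
  define B where "B = {\<alpha> \<in> A. \<alpha> N = a}"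
  \<comment> \<open>Extensionality over \<open>{..<N}\<close> asks for \<open>undefined\<close> at
    the entry \<open>N\<close>. That entry equals \<open>a\<close> on all of \<open>B\<close>, so
    erasing it loses nothing.\<close>
  define B' where "B' = (\<lambda>\<alpha>. \<alpha>(N := undefined)) ` B"
  define g where "g s = (\<Sum>\<alpha>\<in>A. x \<alpha> * (\<Prod>j<N. f j s ^ \<alpha> j) * f N s ^ (\<alpha> N - a))" for s
  have a: "a \<le> \<alpha> N" if "\<alpha> \<in> A" for \<alpha> using Suc.prems(1) that by (simp add: a_def)
  have "a \<in> (\<lambda>\<alpha>. \<alpha> N) ` A" unfolding a_def using Suc.prems by (intro Min_in) auto
  then have "B \<noteq> {}" by (auto simp: B_def)
  have fin: "finite B" using Suc.prems(1) by (simp add: B_def)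
  have fg: "(\<Sum>\<alpha>\<in>A. x \<alpha> * (\<Prod>j<Suc N. f j s ^ \<alpha> j)) = f N s ^ a * g s" for s
    unfolding g_def sum_distrib_left
    by (intro sum.cong refl) (use a in \<open>simp add: mult_ac power_add[symmetric]\<close>)
  have pg: "polyfun m g" unfolding g_def by (intro polyfun_intros f)
  have inj: "inj_on (\<lambda>\<alpha>. \<alpha>(N := undefined)) B"
  proof (rule inj_onI)
    fix \<alpha> \<beta> :: "nat \<Rightarrow> nat"
    assume *: "\<alpha> \<in> B" "\<beta> \<in> B" "\<alpha>(N := undefined) = \<beta>(N := undefined)"
    show "\<alpha> = \<beta>"
    proof
      fix i
      from *(3) have "(\<alpha>(N := undefined)) i = (\<beta>(N := undefined)) i" by (rule fun_cong)
      then show "\<alpha> i = \<beta> i" using *(1,2) by (cases "i = N") (simp_all add: B_def)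
    qed
  qed
  have "\<exists>s\<in>S N. (\<Sum>\<alpha>\<in>B'. x (\<alpha>(N := a)) * (\<Prod>j<N. f j s ^ \<alpha> j)) \<noteq> 0"
  proof (rule Suc.IH)
    show "finite B'" "B' \<noteq> {}" using fin \<open>B \<noteq> {}\<close> by (auto simp: B'_def)
    show "B' \<subseteq> extensional {..<N}"
      using Suc.prems(3) by (auto simp: B'_def B_def extensional_def)
    fix \<beta> assume "\<beta> \<in> B'"
    then obtain \<alpha> where "\<alpha> \<in> B" "\<beta> = \<alpha>(N := undefined)" by (auto simp: B'_def)
    moreover from this have "\<beta>(N := a) = \<alpha>" by (auto simp: B_def)
    ultimately show "x (\<beta>(N := a)) \<noteq> 0" using Suc.prems(4) by (auto simp: B_def)
  qed
  then obtain s where s: "s \<in> S N" "(\<Sum>\<alpha>\<in>B'. x (\<alpha>(N := a)) * (\<Prod>j<N. f j s ^ \<alpha> j)) \<noteq> 0" by blast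
  have "(\<Sum>\<alpha>\<in>B'. x (\<alpha>(N := a)) * (\<Prod>j<N. f j s ^ \<alpha> j)) =
      (\<Sum>\<alpha>\<in>B. x \<alpha> * (\<Prod>j<N. f j s ^ \<alpha> j))"
    unfolding B'_def sum.reindex[OF inj] by (intro sum.cong) (auto simp: B_def)
  also have "\<dots> = g s"
    unfolding g_def
  proof (rule sum.mono_neutral_cong_left)
    show "\<forall>\<alpha>\<in>A - B. x \<alpha> * (\<Prod>j<N. f j s ^ \<alpha> j) * f N s ^ (\<alpha> N - a) = 0"
    proof
      fix \<alpha> assume "\<alpha> \<in> A - B"
      then have "a < \<alpha> N" using a[of \<alpha>] by (auto simp: B_def order_less_le)
      then show "x \<alpha> * (\<Prod>j<N. f j s ^ \<alpha> j) * f N s ^ (\<alpha> N - a) = 0"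
        using f(2)[OF s(1)] by simp
    qed
  qed (use Suc.prems(1) in \<open>auto simp: B_def\<close>)
  finally have gs: "g s \<noteq> 0" using s by simp
  have s': "s \<in> S (Suc N)" using s inc by blast
  \<comment> \<open>On \<open>S (Suc N)\<close> the quotient \<open>g\<close> is nonzero at
    \<open>s\<close> and \<open>f N\<close> is nonzero at \<open>t\<close>; irreducibility merges
    the two points.\<close>
  obtain t where t: "t \<in> S (Suc N)" "f N t \<noteq> 0" using f(3) by blast
  obtain u where "u \<in> S (Suc N)" "g u \<noteq> 0" "f N u \<noteq> 0"
    by (rule irrD[OF irr pg f(1) s' gs t]) blast
  moreover from this have "f N u ^ a * g u \<noteq> 0" by simp
  ultimately show ?case unfolding fg[symmetric] by blast
qed

text \<open>Functions that separate successive members of the chain are algebraically independent,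
  but \<open>m + 1\<close> polynomials in \<open>m\<close> variables never are: with exponents up to
  a large \<open>D\<close>, their monomials outnumber the monomials in the variables that can occur
  in them.\<close>

theorem no_infinite_irr_chain:
  fixes S :: "nat \<Rightarrow> 'k::field list set"
  assumes irr: "\<And>j. irr m (S j)" and inc: "\<And>j. S j \<subseteq> S (Suc j)"
    and strict: "\<And>j. \<not> S (Suc j) \<subseteq> zcl m (S j)"
  shows False
proof -
  have "\<exists>f. polyfun m f \<and> (\<forall>s\<in>S j. f s = 0) \<and> (\<exists>s\<in>S (Suc j). f s \<noteq> 0)" for j
  proof -
    obtain f s where "polyfun m f" "\<And>t. t \<in> S j \<Longrightarrow> f t = 0" "s \<in> S (Suc j)" "f s \<noteq> 0"
      using not_subset_zclE[OF _ strict[of j]] irr[of "Suc j"] unfolding irr_def by blast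
    then show ?thesis by blast
  qed
  then obtain f where f: "\<And>j. polyfun m (f j)" "\<And>j s. s \<in> S j \<Longrightarrow> f j s = 0"
    "\<And>j. \<exists>s\<in>S (Suc j). f j s \<noteq> 0" by metis
  define w where "w = (\<lambda>_::nat. 1::nat)"
  have "\<exists>e. wpolyfun m w e (f j)" for j using polyfun_imp_wpolyfun[OF f(1)] by metis
  then obtain e' where e': "\<And>j. wpolyfun m w (e' j) (f j)" by metis
  define N where "N = Suc m"
  \<comment> \<open>The \<open>Suc\<close> keeps \<open>e\<close>, and with it \<open>c\<close>,
    positive.\<close>
  define e where "e = Suc (\<Sum>j<N. e' j)"
  have e: "wpolyfun m w e (f j)" if "j < N" for j
  proof (rule wpolyfun_mono[OF e'])
    have "e' j \<le> (\<Sum>j<N. e' j)" using that by (intro member_le_sum) auto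
    then show "e' j \<le> e" by (simp add: e_def)
  qed
  \<comment> \<open>A product of powers with exponents at most \<open>D\<close> has degree at most
    \<open>D * c\<close>. The choice \<open>D = c ^ m\<close> gives \<open>(D * c + 1) ^ m \<le> ((D
    + 1) * c) ^ m = (D + 1) ^ m * D < (D + 1) ^ N\<close>.\<close>
  define c where "c = N * e"
  define D where "D = c ^ m"
  define A where "A = ({..<N} \<rightarrow>\<^sub>E {..D})"
  define K where "K = wmonoms m w (D * c)"
  have A: "finite A" "card A = (D + 1) ^ N"
    unfolding A_def by (auto intro: finite_PiE simp: card_PiE)
  have K: "finite K" "card K \<le> (D * c + 1) ^ m"
    unfolding K_def using finite_wmonoms[of m w "D * c"] by (auto simp: w_def)
  have "c \<ge> 1" by (simp add: c_def N_def e_def)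
  have "card K \<le> ((D + 1) * c) ^ m"
    using K(2) \<open>c \<ge> 1\<close> by (elim order_trans) (intro power_mono, auto)
  also have "\<dots> = (D + 1) ^ m * D"
    by (simp only: power_mult_distrib D_def)
  also have "\<dots> < (D + 1) ^ N"
    by (simp add: N_def)
  finally have "card K < card A" using A by simp
  have "wpolyfun m w (D * c) (\<lambda>s. \<Prod>j<N. f j s ^ \<alpha> j)" if "\<alpha> \<in> A" for \<alpha>
  proof (rule wpolyfun_mono)
    show "wpolyfun m w (\<Sum>j<N. \<alpha> j * e) (\<lambda>s. \<Prod>j<N. f j s ^ \<alpha> j)"
      by (intro wpolyfun_prod wpolyfun_power e) auto
    have "(\<Sum>j<N. \<alpha> j * e) \<le> (\<Sum>j<N. D * e)"
      using that by (intro sum_mono mult_mono) (auto simp: A_def)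
    then show "(\<Sum>j<N. \<alpha> j * e) \<le> D * c" by (simp add: c_def mult_ac)
  qed
  note * = this
  have "\<exists>b. \<forall>a. length a = m \<longrightarrow> (\<Prod>j<N. f j a ^ \<alpha> j) = (\<Sum>k\<in>K. b k * eval_monom k a)"
    if \<alpha>: "\<alpha> \<in> A" for \<alpha>
  proof -
    obtain b where "\<And>a. length a = m \<Longrightarrow>
        (\<Prod>j<N. f j a ^ \<alpha> j) = (\<Sum>k\<in>wmonoms m w (D * c). b k * eval_monom k a)"
      by (rule wpolyfunE[OF *[OF \<alpha>]]) (auto simp: w_def)
    then show ?thesis unfolding K_def by blast
  qed
  then have "\<forall>\<alpha>\<in>A. \<exists>b. \<forall>a. length a = m \<longrightarrow>
      (\<Prod>j<N. f j a ^ \<alpha> j) = (\<Sum>k\<in>K. b k * eval_monom k a)" by blast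
  from bchoice[OF this] obtain b where b: "\<And>\<alpha> a. \<alpha> \<in> A \<Longrightarrow> length a = m \<Longrightarrow>
      (\<Prod>j<N. f j a ^ \<alpha> j) = (\<Sum>k\<in>K. b \<alpha> k * eval_monom k a)" by blast
  obtain x where x: "\<exists>\<alpha>\<in>A. x \<alpha> \<noteq> 0" "\<forall>k\<in>K. (\<Sum>\<alpha>\<in>A. x \<alpha> * b \<alpha> k) = 0"
    using exists_linear_relation[OF K(1) A(1) \<open>card K < card A\<close>, of b] by blast
  define A' where "A' = {\<alpha> \<in> A. x \<alpha> \<noteq> 0}"
  have "\<exists>s\<in>S N. (\<Sum>\<alpha>\<in>A'. x \<alpha> * (\<Prod>j<N. f j s ^ \<alpha> j)) \<noteq> 0"
    using irr inc f
  proof (rule chain_algebraically_independent)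
    show "finite A'" "A' \<noteq> {}" "\<And>\<alpha>. \<alpha> \<in> A' \<Longrightarrow> x \<alpha> \<noteq> 0" using x A by (auto simp: A'_def)
    show "A' \<subseteq> extensional {..<N}" by (auto simp: A'_def A_def PiE_def)
  qed
  then obtain s where s: "s \<in> S N" "(\<Sum>\<alpha>\<in>A'. x \<alpha> * (\<Prod>j<N. f j s ^ \<alpha> j)) \<noteq> 0" by blast
  have len: "length s = m" using s(1) irr[of N] by (auto simp: irr_def)
  have "(\<Sum>\<alpha>\<in>A'. x \<alpha> * (\<Prod>j<N. f j s ^ \<alpha> j)) = (\<Sum>\<alpha>\<in>A. x \<alpha> * (\<Prod>j<N. f j s ^ \<alpha> j))"
    unfolding A'_def by (intro sum.mono_neutral_left A) auto
  also have "\<dots> = (\<Sum>\<alpha>\<in>A. \<Sum>k\<in>K. x \<alpha> * b \<alpha> k * eval_monom k s)"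
    by (intro sum.cong refl) (simp add: b len sum_distrib_left mult.assoc)
  also have "\<dots> = (\<Sum>k\<in>K. (\<Sum>\<alpha>\<in>A. x \<alpha> * b \<alpha> k) * eval_monom k s)"
    by (subst sum.swap) (simp add: sum_distrib_right)
  also have "\<dots> = 0" using x(2) by simp
  finally show False using s(2) by simp
qed

section \<open>Constructible sets\<close>

text \<open>The Boolean algebra generated by the zero sets. The rules that follow are phrased for
  comprehensions, so that constructibility is read off from the logical form of a condition.\<close>

inductive constr :: "nat \<Rightarrow> 'k::comm_ring_1 list set \<Rightarrow> bool" for m where
  zero: "polyfun m f \<Longrightarrow> constr m {a. length a = m \<and> f a = 0}"
| compl: "constr m S \<Longrightarrow> constr m (affine_space m - S)"
| Int: "constr m S \<Longrightarrow> constr m T \<Longrightarrow> constr m (S \<inter> T)"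

lemma constr_affine_space: "constr m S \<Longrightarrow> S \<subseteq> affine_space m"
  by (induction rule: constr.induct) auto

lemma constr_neg:
  "constr m {a. length a = m \<and> P a} \<Longrightarrow> constr m {a. length a = m \<and> \<not> P a}"
  by (drule constr.compl) (rule back_subst[of "constr m"], assumption, auto)

lemma constr_conj:
  "constr m {a. length a = m \<and> P a} \<Longrightarrow> constr m {a. length a = m \<and> Q a} \<Longrightarrow>
     constr m {a. length a = m \<and> P a \<and> Q a}"
  by (drule (1) constr.Int) (rule back_subst[of "constr m"], assumption, auto)

lemma constr_disj:
  assumes "constr m {a. length a = m \<and> P a}" "constr m {a. length a = m \<and> Q a}"
  shows "constr m {a. length a = m \<and> (P a \<or> Q a)}"
  using constr_neg[OF constr_conj[OF constr_neg[OF assms(1)] constr_neg[OF assms(2)]]] by simp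

lemma constr_eq: "polyfun m f \<Longrightarrow> polyfun m g \<Longrightarrow> constr m {a. length a = m \<and> f a = g a}"
  using constr.zero[OF polyfun_diff[of m f g]] by simp

lemma constr_True: "constr m {a. length a = m \<and> True}"
  using constr_eq[OF polyfun_const[of m 0] polyfun_const[of m 0]] by simp

lemma constr_ball:
  "finite I \<Longrightarrow> (\<And>i. i \<in> I \<Longrightarrow> constr m {a. length a = m \<and> P i a}) \<Longrightarrow>
     constr m {a. length a = m \<and> (\<forall>i\<in>I. P i a)}"
proof (induction I rule: finite_induct)
  case empty
  then show ?case using constr_True[of m] by simp
next
  case (insert i I)
  then show ?case using constr_conj[of m "P i" "\<lambda>a. \<forall>i\<in>I. P i a"] by simp
qed

lemma constr_bex:
  assumes "finite I" "\<And>i. i \<in> I \<Longrightarrow> constr m {a. length a = m \<and> P i a}"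
  shows "constr m {a. length a = m \<and> (\<exists>i\<in>I. P i a)}"
  using constr_neg[OF constr_ball[of I m "\<lambda>i a. \<not> P i a", OF assms(1) constr_neg[OF assms(2)]]]
  by simp

lemma constr_vimage:
  assumes "constr k S" "polymap m k F"
  shows "constr m {a. length a = m \<and> F a \<in> S}"
  using assms(1)
proof induction
  case (zero f)
  then show ?case
    using constr.zero[OF polyfun_compose[OF zero assms(2)]] polymap_length[OF assms(2)]
    by (auto elim!: back_subst[of "constr m"])
next
  case (compl S)
  from constr_neg[OF compl.IH] show ?case
    using polymap_length[OF assms(2)] by (auto elim!: back_subst[of "constr m"])
next
  case (Int S T)
  from constr_conj[OF Int.IH] show ?case by simp
qed

lemma constr_Collect_mem: "constr m S \<Longrightarrow> constr m {a. length a = m \<and> a \<in> S}"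
  using constr_vimage[OF _ polymap_id] .

text \<open>The closure is given by possibly infinitely many equations; quasi-compactness of its
  complement selects finitely many.\<close>

lemma constr_zcl: "constr m (zcl m (S :: 'k::field list set))"
proof -
  obtain Q where Q: "finite Q" "Q \<subseteq> {f. polyfun m f \<and> (\<forall>s\<in>S. f s = 0)}"
    "\<And>q. q \<in> Q \<Longrightarrow> polyfun m q" "\<And>a. a \<in> affine_space m - zcl m S \<Longrightarrow> \<exists>q\<in>Q. q a \<noteq> 0"
    by (rule finite_nonvanishing_cover[of "affine_space m - zcl m S" m
          "{f. polyfun m f \<and> (\<forall>s\<in>S. f s = 0)}"]) (auto simp: zcl_def)
  have "zcl m S = {a. length a = m \<and> (\<forall>q\<in>Q. q a = 0)}"
    using Q(2,4) by (auto simp: zcl_def)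
  moreover have "constr m {a. length a = m \<and> (\<forall>q\<in>Q. q a = 0)}"
    by (intro constr_ball Q(1) constr_eq Q(3) polyfun_const)
  ultimately show ?thesis by simp
qed

section \<open>Normal form of constructible sets\<close>

definition loc_closed :: "nat \<Rightarrow> ('k::comm_ring_1 list \<Rightarrow> 'k) set \<Rightarrow> ('k list \<Rightarrow> 'k) \<Rightarrow> 'k list set" where
  "loc_closed m F q = {a. length a = m \<and> (\<forall>f\<in>F. f a = 0) \<and> q a \<noteq> 0}"

text \<open>A single inequation is enough: over an integral domain several of them multiply into
  one, so the family is closed under intersection.\<close>

definition loc_closed_sets :: "nat \<Rightarrow> 'k::comm_ring_1 list set set" where
  "loc_closed_sets m = {loc_closed m F q | F q. finite F \<and> (\<forall>f\<in>F. polyfun m f) \<and> polyfun m q}"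

definition finite_union_of :: "'a set set \<Rightarrow> 'a set \<Rightarrow> bool" where
  "finite_union_of \<A> S \<longleftrightarrow> (\<exists>\<B>. finite \<B> \<and> \<B> \<subseteq> \<A> \<and> S = \<Union>\<B>)"

lemma finite_union_of_Un:
  "finite_union_of \<A> S \<Longrightarrow> finite_union_of \<A> T \<Longrightarrow> finite_union_of \<A> (S \<union> T)"
  unfolding finite_union_of_def
proof (elim exE conjE)
  fix \<B> \<C> assume "finite \<B>" "\<B> \<subseteq> \<A>" "S = \<Union>\<B>" "finite \<C>" "\<C> \<subseteq> \<A>" "T = \<Union>\<C>"
  then show "\<exists>\<B>. finite \<B> \<and> \<B> \<subseteq> \<A> \<and> S \<union> T = \<Union>\<B>"
    by (intro exI[of _ "\<B> \<union> \<C>"]) auto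
qed

lemma finite_union_of_Int:
  assumes "finite_union_of \<A> S" "finite_union_of \<A> T" "\<And>A B. A \<in> \<A> \<Longrightarrow> B \<in> \<A> \<Longrightarrow> A \<inter> B \<in> \<A>"
  shows "finite_union_of \<A> (S \<inter> T)"
proof -
  obtain \<B> \<C> where "finite \<B>" "\<B> \<subseteq> \<A>" "S = \<Union>\<B>" "finite \<C>" "\<C> \<subseteq> \<A>" "T = \<Union>\<C>"
    using assms(1,2) unfolding finite_union_of_def by blast
  then show ?thesis
    unfolding finite_union_of_def
    by (intro exI[of _ "(\<lambda>(B, C). B \<inter> C) ` (\<B> \<times> \<C>)"] conjI) (use assms(3) in auto)
qed

lemma finite_union_of_single: "A \<in> \<A> \<Longrightarrow> finite_union_of \<A> A"
  unfolding finite_union_of_def by (intro exI[of _ "{A}"]) auto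

lemma finite_union_of_UN:
  "finite I \<Longrightarrow> (\<And>i. i \<in> I \<Longrightarrow> finite_union_of \<A> (S i)) \<Longrightarrow> finite_union_of \<A> (\<Union>i\<in>I. S i)"
proof (induction I rule: finite_induct)
  case empty
  then show ?case unfolding finite_union_of_def by (intro exI[of _ "{}"]) auto
next
  case (insert i I)
  then show ?case by (auto intro!: finite_union_of_Un)
qed

lemma loc_closed_sets_Int:
  assumes "A \<in> loc_closed_sets m" "B \<in> loc_closed_sets m"
  shows "A \<inter> (B :: 'k::idom list set) \<in> loc_closed_sets m"
proof -
  obtain F q G r where "A = loc_closed m F q" "B = loc_closed m G r" "finite F" "finite G"
    "\<forall>f\<in>F. polyfun m f" "\<forall>f\<in>G. polyfun m f" "polyfun m q" "polyfun m r"
    using assms unfolding loc_closed_sets_def by blast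
  then show ?thesis
    unfolding loc_closed_sets_def
    by (intro CollectI exI[of _ "F \<union> G"] exI[of _ "\<lambda>a. q a * r a"])
       (auto simp: loc_closed_def intro: polyfun_mult)
qed

lemma loc_closed_sets_zero:
  "polyfun m f \<Longrightarrow> {a. length a = m \<and> f a = 0} \<in> loc_closed_sets m"
  unfolding loc_closed_sets_def
  by (intro CollectI exI[of _ "{f}"] exI[of _ "\<lambda>_. 1"])
     (auto simp: loc_closed_def intro: polyfun_const)

lemma loc_closed_sets_nonzero:
  "polyfun m f \<Longrightarrow> {a. length a = m \<and> f a \<noteq> 0} \<in> loc_closed_sets m"
  unfolding loc_closed_sets_def
  by (intro CollectI exI[of _ "{}"] exI[of _ f]) (auto simp: loc_closed_def)

lemma finite_union_compl:
  fixes S :: "'k::idom list set"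
  assumes "finite_union_of (loc_closed_sets m) S"
  shows "finite_union_of (loc_closed_sets m) (affine_space m - S)"
proof -
  have basic: "finite_union_of (loc_closed_sets m) (affine_space m - B)"
    if B: "B \<in> loc_closed_sets m" for B :: "'k list set"
  proof -
    obtain F q where B: "B = loc_closed m F q" "finite F" "\<forall>f\<in>F. polyfun m f" "polyfun m q"
      using B unfolding loc_closed_sets_def by blast
    have "affine_space m - B =
        (\<Union>f\<in>F. {a. length a = m \<and> f a \<noteq> 0}) \<union> {a. length a = m \<and> q a = 0}"
      by (auto simp: B(1) loc_closed_def)
    also have "finite_union_of (loc_closed_sets m) \<dots>"
      using B by (intro finite_union_of_Un finite_union_of_UN finite_union_of_single
          loc_closed_sets_nonzero loc_closed_sets_zero) auto
    finally show ?thesis .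
  qed
  obtain \<B> where \<B>: "finite \<B>" "\<B> \<subseteq> loc_closed_sets m" "S = \<Union>\<B>"
    using assms unfolding finite_union_of_def by blast
  have "finite_union_of (loc_closed_sets m) (affine_space m - \<Union>\<B>)"
    using \<B>(1,2)
  proof (induction \<B> rule: finite_induct)
    case empty
    have "affine_space m = {a :: 'k list. length a = m \<and> 0 = (0 :: 'k)}" by auto
    then show ?case
      using finite_union_of_single[OF loc_closed_sets_zero[OF polyfun_const[of m "0 :: 'k"]]] by simp
  next
    case (insert B \<B>)
    have "affine_space m - \<Union>(insert B \<B>) = (affine_space m - B) \<inter> (affine_space m - \<Union>\<B>)" by auto
    then show ?case
      using insert basic by (auto intro!: finite_union_of_Int loc_closed_sets_Int)
  qed
  then show ?thesis using \<B> by simp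
qed

lemma constr_normal_form:
  "constr m (S :: 'k::idom list set) \<Longrightarrow> finite_union_of (loc_closed_sets m) S"
proof (induction rule: constr.induct)
  case (zero f)
  then show ?case by (intro finite_union_of_single loc_closed_sets_zero)
next
  case (compl S)
  then show ?case by (intro finite_union_compl)
next
  case (Int S T)
  then show ?case by (intro finite_union_of_Int loc_closed_sets_Int)
qed

text \<open>One of the locally closed pieces \<open>B\<close> is dense in \<open>D\<close>. Its
  equations persist on the closure, so there only its inequation is left to decide membership; the
  function in this inequation is the \<open>f\<close> sought.\<close>

theorem irr_constr_contains_open:
  fixes D :: "'k::field list set"
  assumes irr: "irr m D" and "constr m D"
  obtains f d where "polyfun m f" "d \<in> D" "f d \<noteq> 0" "\<And>z. z \<in> zcl m D \<Longrightarrow> f z \<noteq> 0 \<Longrightarrow> z \<in> D"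
proof -
  obtain \<B> where B: "finite \<B>" "\<B> \<subseteq> loc_closed_sets m" "D = \<Union>\<B>"
    using constr_normal_form[OF assms(2)] unfolding finite_union_of_def by blast
  have "D \<subseteq> (\<Union>B\<in>\<B>. B)" using B by simp
  from irr_finite_cover[OF irr B(1) this] obtain B where B': "B \<in> \<B>" "D \<subseteq> zcl m B" by blast
  obtain F q where Fq: "B = loc_closed m F q" "\<forall>f\<in>F. polyfun m f" "polyfun m q"
    using B B' unfolding loc_closed_sets_def by blast
  have "B \<noteq> {}"
  proof
    assume "B = {}"
    moreover obtain d where "d \<in> D" using irr by (auto simp: irr_def)
    ultimately show False using B'(2) zclD[of d m B "\<lambda>_. 1"] polyfun_const[of m 1] by auto
  qed
  then obtain d where d: "d \<in> B" by blast
  have "z \<in> D" if z: "z \<in> zcl m D" "q z \<noteq> 0" for z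
  proof -
    have "z \<in> zcl m B" using z(1) zcl_minimal[OF B'(2)] by blast
    moreover have "length z = m" using z(1) by (simp add: zcl_def)
    moreover have "f z = 0" if "f \<in> F" for f
      using zclD[OF \<open>z \<in> zcl m B\<close>, of f] Fq that by (auto simp: loc_closed_def)
    ultimately have "z \<in> B" using z(2) Fq by (simp add: loc_closed_def)
    then show ?thesis using B B' by blast
  qed
  moreover have "d \<in> D" "q d \<noteq> 0" using d B B' Fq by (auto simp: loc_closed_def)
  ultimately show ?thesis using that[of q d] Fq(3) by blast
qed

subsection \<open>Elimination of an existential quantifier\<close>

text \<open>Euclid's argument: if the field were finite, one plus the product of all
  \<open>[:- a, 1:]\<close> would be a nonconstant polynomial without roots.\<close>

lemma infinite_UNIV_alg_closed: "infinite (UNIV :: 'k::alg_closed_field set)"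
proof
  assume fin: "finite (UNIV :: 'k set)"
  define p where "p = (\<Prod>a\<in>(UNIV :: 'k set). [:- a, 1:]) + 1"
  have "degree (\<Prod>a\<in>(UNIV :: 'k set). [:- a, 1:]) = card (UNIV :: 'k set)"
    by (subst degree_prod_eq_sum_degree) auto
  moreover have "card (UNIV :: 'k set) > 0" using fin by (simp add: card_gt_0_iff)
  ultimately have "degree p > 0" unfolding p_def by (subst degree_add_eq_left) auto
  then obtain x where "poly p x = 0" using alg_closed_imp_poly_has_root by blast
  moreover have "poly (\<Prod>a\<in>(UNIV :: 'k set). [:- a, 1:]) x = 0"
    using fin by (simp add: poly_prod)
  ultimately show False by (simp add: p_def)
qed

lemma poly_nonzero_exists:
  fixes p :: "'k::alg_closed_field poly"
  shows "(\<exists>t. poly p t \<noteq> 0) \<longleftrightarrow> p \<noteq> 0"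
proof -
  have "{t. poly p t = 0} \<noteq> UNIV" if "p \<noteq> 0"
    using poly_roots_finite[OF that] infinite_UNIV_alg_closed[where 'k = 'k] by metis
  then show ?thesis by auto
qed

text \<open>Over an algebraically closed field \<open>p\<close> is, up to a unit, a product of
  \<open>d\<close> linear factors; each of them divides \<open>q\<close>, so their product divides
  \<open>q ^ d\<close>.\<close>

lemma dvd_power_degree:
  fixes p :: "'k::alg_closed_field poly"
  assumes "p \<noteq> 0" "degree p = d" "\<And>t. poly p t = 0 \<Longrightarrow> poly q t = 0"
  shows "p dvd q ^ d"
  using assms
proof (induction d arbitrary: p)
  case 0
  then show ?case by (simp add: is_unit_iff_degree)
next
  case (Suc d)
  then obtain t where t: "poly p t = 0" using alg_closed_imp_poly_has_root[of p] by auto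
  then obtain r where r: "p = [:- t, 1:] * r" by (auto simp: poly_eq_0_iff_dvd)
  then have "r \<noteq> 0" using Suc.prems by auto
  moreover from this have "degree r = d"
    using Suc.prems(2) unfolding r by (subst (asm) degree_mult_eq) auto
  moreover have "poly q s = 0" if "poly r s = 0" for s
    using Suc.prems(3)[of s] that r by simp
  ultimately have "r dvd q ^ d" by (rule Suc.IH)
  moreover have "[:- t, 1:] dvd q" using Suc.prems(3)[OF t] by (simp add: poly_eq_0_iff_dvd)
  ultimately show ?case unfolding r power_Suc by (rule mult_dvd_mono[rotated])
qed

text \<open>Replaces a quantifier over \<open>t\<close> by divisibility, which can be tested on
  coefficients that depend polynomially on parameters.\<close>

lemma exists_root_nonroot_iff:
  fixes p :: "'k::alg_closed_field poly"
  assumes "p \<noteq> 0" "degree p = d"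
  shows "(\<exists>t. poly p t = 0 \<and> poly q t \<noteq> 0) \<longleftrightarrow> \<not> p dvd q ^ d"
proof
  assume "\<exists>t. poly p t = 0 \<and> poly q t \<noteq> 0"
  then obtain t where t: "poly p t = 0" "poly q t \<noteq> 0" by blast
  show "\<not> p dvd q ^ d"
  proof
    assume "p dvd q ^ d"
    then obtain r where "q ^ d = p * r" by (rule dvdE)
    then have "poly q t ^ d = poly p t * poly r t" by (metis poly_mult poly_power)
    then show False using t by simp
  qed
next
  assume "\<not> p dvd q ^ d"
  then show "\<exists>t. poly p t = 0 \<and> poly q t \<noteq> 0" using dvd_power_degree[OF assms] by blast
qed

text \<open>Univariate polynomials over the ring of polynomial functions, specialised at a parameter
  \<open>a\<close>. The number \<open>d\<close> is a formal degree: the coefficient at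
  \<open>d\<close> may vanish for some parameters, and case distinctions on this drive the
  elimination.\<close>

definition poly_family :: "nat \<Rightarrow> nat \<Rightarrow> ('k::comm_ring_1 list \<Rightarrow> 'k poly) \<Rightarrow> bool" where
  "poly_family m d P \<longleftrightarrow>
     (\<forall>a. length a = m \<longrightarrow> degree (P a) \<le> d) \<and> (\<forall>j. polyfun m (\<lambda>a. coeff (P a) j))"

lemma poly_familyD:
  assumes "poly_family m d P"
  shows "length a = m \<Longrightarrow> degree (P a) \<le> d" "polyfun m (\<lambda>a. coeff (P a) j)"
  using assms by (auto simp: poly_family_def)

lemma poly_family_mult:
  assumes "poly_family m d P" "poly_family m e Q"
  shows "poly_family m (d + e) (\<lambda>a. P a * Q a)"
  unfolding poly_family_def
proof (intro conjI allI impI)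
  fix a :: "'a list" assume "length a = m"
  from add_mono[OF poly_familyD(1)[OF assms(1) this] poly_familyD(1)[OF assms(2) this]]
  show "degree (P a * Q a) \<le> d + e" by (rule order_trans[OF degree_mult_le])
next
  fix j show "polyfun m (\<lambda>a. coeff (P a * Q a) j)"
    unfolding coeff_mult
    by (intro polyfun_intros poly_familyD(2)[OF assms(1)] poly_familyD(2)[OF assms(2)])
qed

lemma poly_family_power: "poly_family m d P \<Longrightarrow> poly_family m (k * d) (\<lambda>a. P a ^ k)"
proof (induction k)
  case 0
  show ?case by (auto simp: poly_family_def coeff_1 intro: polyfun_const)
next
  case (Suc k)
  then show ?case using poly_family_mult[of m d P "k * d" "\<lambda>a. P a ^ k"] by simp
qed

lemma polyfun_Suc_poly_family:
  assumes "polyfun (Suc m) (f :: 'k::comm_ring_1 list \<Rightarrow> 'k)"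
  shows "\<exists>d P. poly_family m d P \<and> (\<forall>a t. length a = m \<longrightarrow> f (a @ [t]) = poly (P a) t)"
  using assms
proof (induction rule: polyfun_induct)
  case (const c)
  show ?case
    by (rule exI[of _ 0], rule exI[of _ "\<lambda>_. [:c:]"]) (auto simp: poly_family_def intro: polyfun_const)
next
  case (nth i)
  show ?case
  proof (cases "i < m")
    case True
    have "polyfun m (\<lambda>a. coeff [:a ! i:] j)" for j
      using polyfun_nth[OF True] polyfun_const[of m 0] by (cases j) auto
    then show ?thesis using True
      by (intro exI[of _ "0::nat"] exI[of _ "\<lambda>a. [:a ! i:]"]) (auto simp: poly_family_def nth_append)
  next
    case False
    then show ?thesis using nth
      by (intro exI[of _ "1::nat"] exI[of _ "\<lambda>a. [:0, 1:]"])
         (auto simp: poly_family_def nth_append intro: polyfun_const)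
  qed
next
  case (add f g)
  then obtain d P e Q where PQ: "poly_family m d P" "\<forall>a t. length a = m \<longrightarrow> f (a @ [t]) = poly (P a) t"
    "poly_family m e Q" "\<forall>a t. length a = m \<longrightarrow> g (a @ [t]) = poly (Q a) t" by blast
  have "poly_family m (max d e) (\<lambda>a. P a + Q a)"
    using PQ(1,3) unfolding poly_family_def
    by (auto intro!: degree_add_le polyfun_add intro: order_trans)
  then show ?case using PQ(2,4) by (intro exI[of _ "max d e"] exI[of _ "\<lambda>a. P a + Q a"]) auto
next
  case (mult f g)
  then obtain d P e Q where PQ: "poly_family m d P" "\<forall>a t. length a = m \<longrightarrow> f (a @ [t]) = poly (P a) t"
    "poly_family m e Q" "\<forall>a t. length a = m \<longrightarrow> g (a @ [t]) = poly (Q a) t" by blast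
  then show ?case
    by (intro exI[of _ "d + e"] exI[of _ "\<lambda>a. P a * Q a"]) (auto intro: poly_family_mult)
next
  case (cong f g)
  then obtain d P where "poly_family m d P" "\<forall>a t. length a = m \<longrightarrow> f (a @ [t]) = poly (P a) t"
    by blast
  then show ?case using cong(2) by (intro exI[of _ d] exI[of _ P]) auto
qed

text \<open>One step of pseudo-division for formal degrees \<open>d \<le> e\<close>. Crosswise
  multiplication with the top coefficients cancels degree \<open>e\<close> without dividing by a
  coefficient that might vanish, so the result is again a family.\<close>

definition reduce :: "nat \<Rightarrow> ('k::comm_ring_1 list \<Rightarrow> 'k poly) \<Rightarrow> nat \<Rightarrow> ('k list \<Rightarrow> 'k poly) \<Rightarrow>
    'k list \<Rightarrow> 'k poly" where
  "reduce d P e Q a = smult (coeff (P a) d) (Q a) - smult (coeff (Q a) e) (monom 1 (e - d) * P a)"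

lemma degree_le_pred:
  assumes "degree p \<le> Suc d" "coeff p (Suc d) = 0"
  shows "degree p \<le> d"
proof (rule degree_le, intro allI impI)
  fix i assume "d < i"
  then show "coeff p i = 0"
    using assms coeff_eq_0[of p i] by (cases "i = Suc d") auto
qed

lemma poly_family_reduce:
  assumes "poly_family m d P" "poly_family m (Suc e) Q" "d \<le> Suc e"
  shows "poly_family m e (reduce d P (Suc e) Q)"
  unfolding poly_family_def
proof (intro conjI allI impI)
  fix a :: "'a list" assume a: "length a = m"
  show "degree (reduce d P (Suc e) Q a) \<le> e"
  proof (rule degree_le_pred)
    have "degree (smult (coeff (P a) d) (Q a)) \<le> Suc e"
      using degree_smult_le[of _ "Q a"] poly_familyD(1)[OF assms(2) a] by (rule order_trans)
    moreover have "degree (smult (coeff (Q a) (Suc e)) (monom 1 (Suc e - d) * P a)) \<le> Suc e"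
    proof -
      have "degree (monom (1::'a) (Suc e - d) * P a) \<le> (Suc e - d) + d"
        using degree_mult_le[of "monom (1::'a) (Suc e - d)" "P a"]
          degree_monom_le[of "1::'a" "Suc e - d"] poly_familyD(1)[OF assms(1) a] by linarith
      then show ?thesis
        using degree_smult_le[of "coeff (Q a) (Suc e)" "monom 1 (Suc e - d) * P a"] assms(3) by linarith
    qed
    ultimately show "degree (reduce d P (Suc e) Q a) \<le> Suc e"
      unfolding reduce_def by (rule degree_diff_le)
    show "coeff (reduce d P (Suc e) Q a) (Suc e) = 0"
      using assms(3) by (simp add: reduce_def coeff_monom_mult)
  qed
next
  fix j
  note coeff = poly_familyD(2)[OF assms(1)] poly_familyD(2)[OF assms(2)]
  show "polyfun m (\<lambda>a. coeff (reduce d P (Suc e) Q a) j)"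
  proof (cases "Suc e - d \<le> j")
    case True
    then have "(\<lambda>a. coeff (reduce d P (Suc e) Q a) j) = (\<lambda>a. coeff (P a) d * coeff (Q a) j -
        coeff (Q a) (Suc e) * coeff (P a) (j - (Suc e - d)))"
      by (simp add: reduce_def coeff_monom_mult)
    then show ?thesis by (simp only: polyfun_diff polyfun_mult coeff)
  next
    case False
    then have "(\<lambda>a. coeff (reduce d P (Suc e) Q a) j) = (\<lambda>a. coeff (P a) d * coeff (Q a) j)"
      by (simp add: reduce_def coeff_monom_mult)
    then show ?thesis by (simp only: polyfun_mult coeff)
  qed
qed

text \<open>At parameters where the coefficient at \<open>d\<close> vanishes this changes nothing,
  yet the result has a smaller formal degree at all parameters.\<close>

definition drop_top :: "nat \<Rightarrow> ('k::comm_ring_1 list \<Rightarrow> 'k poly) \<Rightarrow> 'k list \<Rightarrow> 'k poly" where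
  "drop_top d P a = P a - monom (coeff (P a) d) d"

lemma poly_family_drop_top:
  assumes "poly_family m (Suc d) P"
  shows "poly_family m d (drop_top (Suc d) P)"
  unfolding poly_family_def
proof (intro conjI allI impI)
  fix a :: "'a list" assume a: "length a = m"
  show "degree (drop_top (Suc d) P a) \<le> d"
  proof (rule degree_le_pred)
    show "degree (drop_top (Suc d) P a) \<le> Suc d"
      unfolding drop_top_def by (rule degree_diff_le[OF poly_familyD(1)[OF assms a] degree_monom_le])
  qed (simp add: drop_top_def)
next
  fix j show "polyfun m (\<lambda>a. coeff (drop_top (Suc d) P a) j)"
    by (cases "j = Suc d")
       (auto simp: drop_top_def intro!: polyfun_intros poly_familyD(2)[OF assms])
qed

lemma drop_top_eq: "coeff (P a) d = 0 \<Longrightarrow> drop_top d P a = P a"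
  by (simp add: drop_top_def)

lemma poly_eq_0_iff_coeffs: "degree p \<le> d \<Longrightarrow> p = 0 \<longleftrightarrow> (\<forall>j\<in>{..d}. coeff p j = 0)"
  by (metis atMost_iff coeff_0 leading_coeff_0_iff)

lemma constr_poly_family_eq_0:
  assumes "poly_family m d P"
  shows "constr m {a. length a = m \<and> P a = 0}"
proof -
  have "constr m {a. length a = m \<and> (\<forall>j\<in>{..d}. coeff (P a) j = 0)}"
    by (intro constr_ball constr_eq poly_familyD(2)[OF assms] polyfun_const) auto
  also have "{a. length a = m \<and> (\<forall>j\<in>{..d}. coeff (P a) j = 0)} = {a. length a = m \<and> P a = 0}"
    using poly_eq_0_iff_coeffs[OF poly_familyD(1)[OF assms]] by blast
  finally show ?thesis .
qed

lemma constr_coeff_neq_0: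
  "poly_family m d P \<Longrightarrow> constr m {a. length a = m \<and> coeff (P a) j \<noteq> 0}"
  by (intro constr_neg constr_eq polyfun_const poly_familyD(2))

lemma constr_coeff_eq_0:
  "poly_family m d P \<Longrightarrow> constr m {a. length a = m \<and> coeff (P a) j = 0}"
  by (intro constr_eq polyfun_const poly_familyD(2))

lemma constr_cong:
  "constr m {a. length a = m \<and> P a} \<Longrightarrow> (\<And>a. length a = m \<Longrightarrow> P a = Q a) \<Longrightarrow>
     constr m {a. length a = m \<and> Q a}"
  by (simp cong: conj_cong)

text \<open>Pseudo-division by induction on the formal degree of \<open>Q\<close>. Where the
  coefficient of \<open>P\<close> at \<open>d\<close> is nonzero it is a unit, so \<open>P\<close>
  divides \<open>Q\<close> exactly if it divides the reduced polynomial. Once the formal degree of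
  \<open>Q\<close> is below \<open>d\<close>, divisibility means \<open>Q a = 0\<close>.\<close>

lemma constr_dvd:
  fixes P Q :: "'k::field list \<Rightarrow> 'k poly"
  assumes P: "poly_family m d P" and Q: "poly_family m e Q"
  shows "constr m {a. length a = m \<and> coeff (P a) d \<noteq> 0 \<and> P a dvd Q a}"
  using Q
proof (induction e arbitrary: Q)
  case 0
  show ?case
  proof (cases "d = 0")
    case True
    show ?thesis
    proof (rule constr_cong[OF constr_coeff_neq_0[OF P, of d]])
      fix a :: "'k list" assume "length a = m"
      then have "degree (P a) = 0" using poly_familyD(1)[OF P] True by auto
      then show "coeff (P a) d \<noteq> 0 \<longleftrightarrow> coeff (P a) d \<noteq> 0 \<and> P a dvd Q a"
        using True by (metis is_unit_iff_degree leading_coeff_0_iff unit_imp_dvd)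
    qed
  next
    case False
    show ?thesis
    proof (rule constr_cong[OF constr_conj[OF constr_coeff_neq_0[OF P, of d] constr_poly_family_eq_0[OF 0]]])
      fix a :: "'k list" assume "length a = m"
      then have "degree (Q a) = 0" using poly_familyD(1)[OF 0] by simp
      moreover have "degree (P a) > 0" if "coeff (P a) d \<noteq> 0" using le_degree[OF that] False by simp
      ultimately show "coeff (P a) d \<noteq> 0 \<and> Q a = 0 \<longleftrightarrow> coeff (P a) d \<noteq> 0 \<and> P a dvd Q a"
        using dvd_imp_degree_le[of "P a" "Q a"] by fastforce
    qed
  qed
next
  case (Suc e)
  show ?case
  proof (cases "d \<le> Suc e")
    case True
    show ?thesis
    proof (rule constr_cong[OF Suc.IH[OF poly_family_reduce[OF P Suc.prems True]]])
      fix a :: "'k list"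
      have "P a dvd smult (coeff (Q a) (Suc e)) (monom 1 (Suc e - d) * P a)"
        by (intro dvd_smult) simp
      then have "P a dvd reduce d P (Suc e) Q a \<longleftrightarrow> P a dvd smult (coeff (P a) d) (Q a)"
        unfolding reduce_def by (rule dvd_diff_left_iff)
      then show "coeff (P a) d \<noteq> 0 \<and> P a dvd reduce d P (Suc e) Q a \<longleftrightarrow>
          coeff (P a) d \<noteq> 0 \<and> P a dvd Q a"
        by (auto simp: dvd_smult_iff)
    qed
  next
    case False
    show ?thesis
    proof (rule constr_cong[OF constr_conj[OF constr_coeff_neq_0[OF P, of d] constr_poly_family_eq_0[OF Suc.prems]]])
      fix a :: "'k list" assume "length a = m"
      then have "degree (Q a) \<le> Suc e" by (rule poly_familyD(1)[OF Suc.prems])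
      moreover have "degree (P a) > Suc e" if "coeff (P a) d \<noteq> 0"
        using le_degree[OF that] False by simp
      ultimately show "coeff (P a) d \<noteq> 0 \<and> Q a = 0 \<longleftrightarrow> coeff (P a) d \<noteq> 0 \<and> P a dvd Q a"
        using dvd_imp_degree_le[of "P a" "Q a"] by fastforce
    qed
  qed
qed

text \<open>Either the coefficient at the formal degree vanishes and \<open>drop_top\<close> lowers
  that degree, or the true degree is \<open>Suc d\<close> and the divisibility criterion applies. A
  constant \<open>P\<close> has a root only if it is zero; then \<open>Q a \<noteq> 0\<close> is
  what remains, as the field is infinite.\<close>

lemma constr_exists_root_nonroot:
  fixes P Q :: "'k::alg_closed_field list \<Rightarrow> 'k poly"
  assumes "poly_family m d P" and Q: "poly_family m e Q"
  shows "constr m {a. length a = m \<and> (\<exists>t. poly (P a) t = 0 \<and> poly (Q a) t \<noteq> 0)}"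
  using assms(1)
proof (induction d arbitrary: P)
  case 0
  show ?case
  proof (rule constr_cong[OF constr_conj[OF constr_coeff_eq_0[OF 0, of 0]
        constr_neg[OF constr_poly_family_eq_0[OF Q]]]])
    fix a :: "'k list" assume "length a = m"
    then have "degree (P a) = 0" using poly_familyD(1)[OF 0] by simp
    then obtain c where "P a = [:c:]" by (rule degree_eq_zeroE)
    then show "coeff (P a) 0 = 0 \<and> Q a \<noteq> 0 \<longleftrightarrow> (\<exists>t. poly (P a) t = 0 \<and> poly (Q a) t \<noteq> 0)"
      using poly_nonzero_exists[of "Q a"] by auto
  qed
next
  case (Suc d)
  let ?c = "\<lambda>a. coeff (P a) (Suc d)"
  have "constr m {a. length a = m \<and> (?c a = 0 \<and>
        (\<exists>t. poly (drop_top (Suc d) P a) t = 0 \<and> poly (Q a) t \<noteq> 0) \<or>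
      ?c a \<noteq> 0 \<and> \<not> (?c a \<noteq> 0 \<and> P a dvd Q a ^ Suc d))}"
    by (intro constr_disj constr_conj constr_coeff_eq_0[OF Suc.prems] constr_coeff_neq_0[OF Suc.prems]
        Suc.IH poly_family_drop_top Suc.prems constr_neg[OF constr_dvd[OF Suc.prems poly_family_power[OF Q]]])
  then show ?case
  proof (rule constr_cong)
    fix a :: "'k list" assume a: "length a = m"
    show "(?c a = 0 \<and> (\<exists>t. poly (drop_top (Suc d) P a) t = 0 \<and> poly (Q a) t \<noteq> 0) \<or>
      ?c a \<noteq> 0 \<and> \<not> (?c a \<noteq> 0 \<and> P a dvd Q a ^ Suc d)) \<longleftrightarrow>
      (\<exists>t. poly (P a) t = 0 \<and> poly (Q a) t \<noteq> 0)"
    proof (cases "?c a = 0")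
      case True
      then show ?thesis by (simp add: drop_top_eq)
    next
      case False
      then have "P a \<noteq> 0" "degree (P a) = Suc d"
        using poly_familyD(1)[OF Suc.prems a] le_degree[OF False] by auto
      then show ?thesis using exists_root_nonroot_iff[of "P a" "Suc d" "Q a"] False by simp
    qed
  qed
qed

text \<open>Euclid's algorithm with parameters, until at most one polynomial is left. The measure
  adds one to each formal degree, so that removing a constant polynomial decreases it too.\<close>

lemma constr_exists_common_root:
  fixes Q :: "'k::alg_closed_field list \<Rightarrow> 'k poly"
  assumes "\<And>d P. (d, P) \<in> set Ps \<Longrightarrow> poly_family m d P" and Q: "poly_family m e Q"
  shows "constr m {a. length a = m \<and> (\<exists>t. (\<forall>(d, P)\<in>set Ps. poly (P a) t = 0) \<and> poly (Q a) t \<noteq> 0)}"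
  using assms(1)
proof (induction "sum_list (map (Suc \<circ> fst) Ps)" arbitrary: Ps rule: less_induct)
  case (less Ps)
  let ?E = "\<lambda>Ps a. \<exists>t. (\<forall>(d, P)\<in>set Ps. poly (P a) t = 0) \<and> poly (Q a) t \<noteq> 0"
  consider "Ps = []" | d P where "Ps = [(d, P)]"
    | d P e R Rs where "Ps = (d, P) # (e, R) # Rs"
    by (metis neq_Nil_conv surj_pair)
  then show ?case
  proof cases
    case 1
    then show ?thesis
      using constr_exists_root_nonroot[of m 0 "\<lambda>_. 0", OF _ Q]
      by (simp add: poly_family_def polyfun_const)
  next
    case 2
    then show ?thesis using constr_exists_root_nonroot[OF less.prems Q] by simp
  next
    case 3
    \<comment> \<open>Only the set of \<open>Ps\<close> matters for the condition and the measure is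
      symmetric, so the two front entries may be swapped to have \<open>d \<le> e\<close>.\<close>
    have "\<exists>d P e R Rs. set Ps = set ((d, P) # (e, R) # Rs) \<and> d \<le> e \<and>
        sum_list (map (Suc \<circ> fst) Ps) = Suc d + Suc e + sum_list (map (Suc \<circ> fst) Rs)"
    proof (cases "d \<le> e")
      case True
      show ?thesis unfolding 3
        by (rule exI[of _ d], rule exI[of _ P], rule exI[of _ e], rule exI[of _ R], rule exI[of _ Rs])
           (use True in auto)
    next
      case False
      show ?thesis unfolding 3
        by (rule exI[of _ e], rule exI[of _ R], rule exI[of _ d], rule exI[of _ P], rule exI[of _ Rs])
           (use False in auto)
    qed
    then obtain d P e R Rs where Ps: "set Ps = set ((d, P) # (e, R) # Rs)" "d \<le> e"
      "sum_list (map (Suc \<circ> fst) Ps) = Suc d + Suc e + sum_list (map (Suc \<circ> fst) Rs)" by blast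
    have fam: "poly_family m d P" "poly_family m e R" "\<And>d P. (d, P) \<in> set Rs \<Longrightarrow> poly_family m d P"
      using less.prems Ps(1) by auto
    let ?c = "\<lambda>a. coeff (P a) d"
    show ?thesis
    proof (cases d)
      case 0
      have "constr m {a. length a = m \<and> ?E ((e, R) # Rs) a}"
        by (rule less.hyps) (use Ps less.prems in auto)
      from constr_conj[OF constr_coeff_eq_0[OF fam(1), of d] this] show ?thesis
      proof (rule constr_cong)
        fix a :: "'k list" assume "length a = m"
        then have "degree (P a) = 0" using poly_familyD(1)[OF fam(1)] 0 by simp
        then obtain c where "P a = [:c:]" by (rule degree_eq_zeroE)
        then show "coeff (P a) d = 0 \<and> ?E ((e, R) # Rs) a \<longleftrightarrow> ?E Ps a"
          unfolding Ps(1) using 0 by auto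
      qed
    next
      case (Suc d')
      obtain e' where e': "e = Suc e'" using Suc Ps(2) by (cases e) auto
      let ?P = "drop_top d P" and ?R = "reduce d P e R"
      have "constr m {a. length a = m \<and> ?E ((d', ?P) # (e, R) # Rs) a}"
        by (rule less.hyps) (use Ps Suc fam poly_family_drop_top[of m d' P] in auto)
      moreover have "constr m {a. length a = m \<and> ?E ((d, P) # (e', ?R) # Rs) a}"
        by (rule less.hyps) (use Ps e' fam poly_family_reduce[of m d P e' R] in auto)
      ultimately have "constr m {a. length a = m \<and>
          (?c a = 0 \<and> ?E ((d', ?P) # (e, R) # Rs) a \<or> ?c a \<noteq> 0 \<and> ?E ((d, P) # (e', ?R) # Rs) a)}"
        by (intro constr_disj constr_conj constr_coeff_eq_0[OF fam(1)] constr_coeff_neq_0[OF fam(1)])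
      then show ?thesis
      proof (rule constr_cong)
        fix a :: "'k list"
        \<comment> \<open>At a root of \<open>P\<close> the reduced polynomial takes the value of
          \<open>R\<close> times a nonzero constant, so the replacement keeps the common
          roots.\<close>
        have "poly (?R a) t = 0 \<longleftrightarrow> poly (R a) t = 0" if "?c a \<noteq> 0" "poly (P a) t = 0" for t
          using that by (simp add: reduce_def)
        then show "(?c a = 0 \<and> ?E ((d', ?P) # (e, R) # Rs) a \<or>
            ?c a \<noteq> 0 \<and> ?E ((d, P) # (e', ?R) # Rs) a) \<longleftrightarrow> ?E Ps a"
          unfolding Ps(1) by (cases "?c a = 0") (auto simp: drop_top_eq)
      qed
    qed
  qed
qed

section \<open>Chevalley's theorem for projections and polynomial images\<close>

lemma constr_exists_last:
  fixes S :: "'k::alg_closed_field list set"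
  assumes "constr (Suc m) S"
  shows "constr m {a. length a = m \<and> (\<exists>t. a @ [t] \<in> S)}"
proof -
  obtain \<B> where B: "finite \<B>" "\<B> \<subseteq> loc_closed_sets (Suc m)" "S = \<Union>\<B>"
    using constr_normal_form[OF assms] unfolding finite_union_of_def by blast
  have "constr m {a. length a = m \<and> (\<exists>t. a @ [t] \<in> B)}" if "B \<in> loc_closed_sets (Suc m)" for B :: "'k list set"
  proof -
    obtain F q where Fq: "B = loc_closed (Suc m) F q" "finite F" "\<forall>f\<in>F. polyfun (Suc m) f"
      "polyfun (Suc m) q"
      using \<open>B \<in> loc_closed_sets (Suc m)\<close> unfolding loc_closed_sets_def by blast
    have "\<forall>f\<in>F. \<exists>dP. poly_family m (fst dP) (snd dP) \<and>
        (\<forall>a t. length a = m \<longrightarrow> f (a @ [t]) = poly (snd dP a) t)"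
      using Fq(3) polyfun_Suc_poly_family by fastforce
    from bchoice[OF this] obtain g where g: "\<And>f. f \<in> F \<Longrightarrow> poly_family m (fst (g f)) (snd (g f))"
      "\<And>f a t. f \<in> F \<Longrightarrow> length a = m \<Longrightarrow> f (a @ [t]) = poly (snd (g f) a) t" by blast
    obtain e Q where Q: "poly_family m e Q" "\<And>a t. length a = m \<Longrightarrow> q (a @ [t]) = poly (Q a) t"
      using polyfun_Suc_poly_family[OF Fq(4)] by blast
    obtain fs where fs: "set fs = F" using finite_list[OF Fq(2)] by blast
    have "constr m {a. length a = m \<and>
        (\<exists>t. (\<forall>(d, P)\<in>set (map g fs). poly (P a) t = 0) \<and> poly (Q a) t \<noteq> 0)}"
    proof (rule constr_exists_common_root[OF _ Q(1)])
      fix d P assume "(d, P) \<in> set (map g fs)"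
      then obtain f where "f \<in> F" "g f = (d, P)" using fs by auto
      then show "poly_family m d P" using g(1)[of f] by simp
    qed
    then show ?thesis
      by (rule constr_cong) (auto simp: Fq(1) loc_closed_def fs g(2) Q(2) case_prod_beta)
  qed
  then have "constr m {a. length a = m \<and> (\<exists>B\<in>\<B>. \<exists>t. a @ [t] \<in> B)}"
    using B(2) by (intro constr_bex B(1)) blast
  then show ?thesis by (rule constr_cong) (auto simp: B(3))
qed

theorem constr_projection:
  fixes T :: "'k::alg_closed_field list set"
  assumes "constr (k + m) T"
  shows "constr k {y. length y = k \<and> (\<exists>x. length x = m \<and> y @ x \<in> T)}"
  using assms
proof (induction m arbitrary: T)
  case 0
  then have "constr k {y. length y = k \<and> y \<in> T}" by (simp add: constr_Collect_mem)
  then show ?case by (rule constr_cong) auto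
next
  case (Suc m)
  then have "constr (k + m) {z. length z = k + m \<and> (\<exists>t. z @ [t] \<in> T)}"
    by (intro constr_exists_last) simp
  from Suc.IH[OF this] show ?case
  proof (rule constr_cong)
    fix y :: "'k list" assume y: "length y = k"
    show "(\<exists>x. length x = m \<and> y @ x \<in> {z. length z = k + m \<and> (\<exists>t. z @ [t] \<in> T)}) \<longleftrightarrow>
        (\<exists>x. length x = Suc m \<and> y @ x \<in> T)"
    proof
      assume "\<exists>x. length x = m \<and> y @ x \<in> {z. length z = k + m \<and> (\<exists>t. z @ [t] \<in> T)}"
      then obtain x t where "length x = m" "(y @ x) @ [t] \<in> T" by auto
      then show "\<exists>x. length x = Suc m \<and> y @ x \<in> T" by (intro exI[of _ "x @ [t]"]) auto
    next
      assume "\<exists>x. length x = Suc m \<and> y @ x \<in> T"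
      then obtain x where x: "length x = Suc m" "y @ x \<in> T" by blast
      then have "x = butlast x @ [last x]" by (intro append_butlast_last_id[symmetric]) auto
      then show "\<exists>x. length x = m \<and> y @ x \<in> {z. length z = k + m \<and> (\<exists>t. z @ [t] \<in> T)}"
        using x y by (intro exI[of _ "butlast x"]) (auto intro!: exI[of _ "last x"])
    qed
  qed
qed

lemma constr_append:
  fixes S T :: "'k::comm_ring_1 list set"
  assumes "constr m S" "constr l T"
  shows "constr (m + l) {s @ t | s t. s \<in> S \<and> t \<in> T}"
proof -
  have "constr (m + l) {z. length z = m + l \<and> take m z \<in> S \<and> drop m z \<in> T}"
    by (intro constr_conj constr_vimage[OF assms(1)] constr_vimage[OF assms(2)]
        polymap_take polymap_drop) simp
  also have "{z. length z = m + l \<and> take m z \<in> S \<and> drop m z \<in> T} = {s @ t | s t. s \<in> S \<and> t \<in> T}"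
    (is "?A = ?B")
  proof
    show "?A \<subseteq> ?B" by (auto intro: append_take_drop_id[symmetric])
    show "?B \<subseteq> ?A" using constr_affine_space[OF assms(1)] constr_affine_space[OF assms(2)] by force
  qed
  finally show ?thesis .
qed

theorem constr_image:
  fixes S :: "'k::alg_closed_field list set"
  assumes "constr m S" "polymap m k F"
  shows "constr k (F ` S)"
proof -
  \<comment> \<open>The graph of \<open>F\<close> over \<open>S\<close>, with the value in front of
    the argument, because projection forgets the last coordinates.\<close>
  have "constr (k + m) {z. length z = k + m \<and> drop k z \<in> S \<and> (\<forall>i\<in>{..<k}. z ! i = F (drop k z) ! i)}"
    using assms(2)
    by (intro constr_conj constr_vimage[OF assms(1)] polymap_drop constr_ball constr_eq
        polyfun_nth polyfun_compose[OF _ polymap_drop]) (auto simp: polymap_def)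
  from constr_projection[OF this]
  have "constr k {y. length y = k \<and> (\<exists>x. length x = m \<and> x \<in> S \<and> (\<forall>i<k. y ! i = F x ! i))}"
    by (rule constr_cong) (auto simp: nth_append)
  also have "{y. length y = k \<and> (\<exists>x. length x = m \<and> x \<in> S \<and> (\<forall>i<k. y ! i = F x ! i))} = F ` S"
    (is "?A = ?B")
  proof
    show "?A \<subseteq> ?B"
    proof
      fix y assume "y \<in> ?A"
      then obtain x where x: "length y = k" "length x = m" "x \<in> S" "\<forall>i<k. y ! i = F x ! i" by blast
      then have "y = F x" using polymap_length[OF assms(2), of x] by (intro nth_equalityI) auto
      then show "y \<in> ?B" using x(3) by blast
    qed
    show "?B \<subseteq> ?A" using polymap_length[OF assms(2)] constr_affine_space[OF assms(1)] by fastforce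
  qed
  finally show ?thesis .
qed

section \<open>Groups with polynomial operations\<close>

lemma polymap_cong:
  assumes "polymap m k F" "\<And>a. length a = m \<Longrightarrow> F a = G a"
  shows "polymap m k G"
  unfolding polymap_def
proof (intro conjI allI impI)
  show "length (G a) = k" if "length a = m" for a
    using assms that by (metis polymap_length)
  show "polyfun m (\<lambda>a. G a ! i)" if "i < k" for i
  proof (rule polyfun_cong)
    show "polyfun m (\<lambda>a. F a ! i)" using assms(1) that by (simp add: polymap_def)
  qed (simp add: assms(2))
qed

text \<open>The operations are polynomial on the whole of \<open>M\<close>-space, whereas the group
  laws are assumed on \<open>H\<close> only; elsewhere \<open>mul\<close> and \<open>iv\<close> are
  mere polynomial maps. This is the setting in which the laws extend to the closure of
  \<open>H\<close>.\<close>

locale polynomial_group =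
  fixes M :: nat and mul :: "'k::alg_closed_field list \<Rightarrow> 'k list \<Rightarrow> 'k list" and iv e H
  assumes H_sub: "H \<subseteq> affine_space M"
    and polymap_mul': "polymap (M + M) M (\<lambda>w. mul (take M w) (drop M w))"
    and polymap_iv: "polymap M M iv"
    and e_mem: "e \<in> H"
    and mul_mem: "x \<in> H \<Longrightarrow> y \<in> H \<Longrightarrow> mul x y \<in> H"
    and iv_mem: "x \<in> H \<Longrightarrow> iv x \<in> H"
    and assoc: "x \<in> H \<Longrightarrow> y \<in> H \<Longrightarrow> z \<in> H \<Longrightarrow> mul (mul x y) z = mul x (mul y z)"
    and e_left: "x \<in> H \<Longrightarrow> mul e x = x"
    and e_right: "x \<in> H \<Longrightarrow> mul x e = x"
    and iv_left: "x \<in> H \<Longrightarrow> mul (iv x) x = e"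
    and iv_right: "x \<in> H \<Longrightarrow> mul x (iv x) = e"
begin

abbreviation Z where "Z \<equiv> zcl M H"

lemma H_length: "x \<in> H \<Longrightarrow> length x = M"
  using H_sub by auto

lemma Z_length: "x \<in> Z \<Longrightarrow> length x = M"
  by (simp add: zcl_def)

lemma H_Z: "x \<in> H \<Longrightarrow> x \<in> Z"
  using zcl_superset[OF H_sub] by blast

lemma polymap_mul:
  assumes "polymap m M F" "polymap m M G"
  shows "polymap m M (\<lambda>a. mul (F a) (G a))"
  by (rule polymap_cong[OF polymap_compose[OF polymap_mul' polymap_append[OF assms]]])
     (simp add: polymap_length[OF assms(1)])

lemma polymap_mul_left: "length y = M \<Longrightarrow> polymap M M (\<lambda>x. mul y x)"
  by (intro polymap_mul polymap_const polymap_id)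

lemma polymap_mul_right: "length y = M \<Longrightarrow> polymap M M (\<lambda>x. mul x y)"
  by (intro polymap_mul polymap_const polymap_id)

lemma iv_Z: "x \<in> Z \<Longrightarrow> iv x \<in> Z"
  by (rule zcl_polymap[OF polymap_iv]) (auto intro: H_Z iv_mem)

text \<open>One argument at a time: right translation by an element of \<open>H\<close> maps the
  closure into itself, and then left translation by an element of the closure does so too.
  \<open>assoc_Z\<close> proceeds alike.\<close>

lemma mul_Z:
  assumes "x \<in> Z" "y \<in> Z"
  shows "mul x y \<in> Z"
proof -
  have *: "mul x y \<in> Z" if "y \<in> H" for y
    by (rule zcl_polymap[OF polymap_mul_right assms(1)]) (auto intro: that H_length H_Z mul_mem)
  show ?thesis
    by (rule zcl_polymap[OF polymap_mul_left[OF Z_length[OF assms(1)]] assms(2)]) (rule *)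
qed

lemma assoc_Z:
  assumes "x \<in> Z" "y \<in> Z" "z \<in> Z"
  shows "mul (mul x y) z = mul x (mul y z)"
proof -
  note pm = polymap_mul polymap_id polymap_const
  have 1: "mul (mul x y) z = mul x (mul y z)" if "y \<in> H" "z \<in> H" for y z
    by (rule zcl_polymap_eq[OF _ _ _ assms(1), of M "\<lambda>x. mul (mul x y) z" "\<lambda>x. mul x (mul y z)"])
       (auto intro!: pm that assoc H_length mul_mem)
  have 2: "mul (mul x y) z = mul x (mul y z)" if "z \<in> H" for z
    by (rule zcl_polymap_eq[OF _ _ _ assms(2), of M "\<lambda>y. mul (mul x y) z" "\<lambda>y. mul x (mul y z)"])
       (auto intro!: pm that 1 Z_length intro: assms H_Z)
  show ?thesis
    by (rule zcl_polymap_eq[OF _ _ _ assms(3), of M "\<lambda>z. mul (mul x y) z" "\<lambda>z. mul x (mul y z)"])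
       (auto intro!: pm 2 Z_length mul_Z assms)
qed

lemma unit_Z:
  assumes "x \<in> Z"
  shows "mul e x = x" "mul x e = x" "mul (iv x) x = e" "mul x (iv x) = e"
proof -
  note pm = polymap_mul polymap_id polymap_const polymap_iv
  show "mul e x = x"
    by (rule zcl_polymap_eq[OF _ _ _ assms, of M "\<lambda>x. mul e x" "\<lambda>x. x"])
       (auto intro!: pm H_length e_mem e_left)
  show "mul x e = x"
    by (rule zcl_polymap_eq[OF _ _ _ assms, of M "\<lambda>x. mul x e" "\<lambda>x. x"])
       (auto intro!: pm H_length e_mem e_right)
  show "mul (iv x) x = e"
    by (rule zcl_polymap_eq[OF _ _ _ assms, of M "\<lambda>x. mul (iv x) x" "\<lambda>x. e"])
       (auto intro!: pm H_length e_mem iv_left)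
  show "mul x (iv x) = e"
    by (rule zcl_polymap_eq[OF _ _ _ assms, of M "\<lambda>x. mul x (iv x)" "\<lambda>x. e"])
       (auto intro!: pm H_length e_mem iv_right)
qed

section \<open>Components of subgroups and products of subsets\<close>

lemma subgroup_disjoint_components:
  assumes Y: "Y \<subseteq> H" "\<And>x y. x \<in> Y \<Longrightarrow> y \<in> Y \<Longrightarrow> mul x y \<in> Y" "\<And>x. x \<in> Y \<Longrightarrow> iv x \<in> Y"
  obtains \<C> where "finite \<C>" "\<Union>\<C> = Y" "\<And>C. C \<in> \<C> \<Longrightarrow> irr M C"
    "\<And>C. C \<in> \<C> \<Longrightarrow> C = Y \<inter> zcl M C" "\<And>C D. C \<in> \<C> \<Longrightarrow> D \<in> \<C> \<Longrightarrow> C \<inter> D \<noteq> {} \<Longrightarrow> C = D"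
proof -
  have "\<exists>\<tau> \<tau>'. polymap M M \<tau> \<and> polymap M M \<tau>' \<and> \<tau> ` Y \<subseteq> Y \<and> \<tau>' ` Y \<subseteq> Y \<and>
      \<tau> x = y \<and> (\<forall>z\<in>Y. \<tau>' (\<tau> z) = z)" if xy: "x \<in> Y" "y \<in> Y" for x y
  proof -
  note h = subsetD[OF Y(1)]
  \<comment> \<open>Left translation by \<open>y x\<^sup>-\<^sup>1\<close> moves \<open>x\<close> to
    \<open>y\<close>, and left translation by \<open>x y\<^sup>-\<^sup>1\<close> undoes it; so a
    subgroup is homogeneous under itself.\<close>
  let ?t = "\<lambda>z. mul (mul y (iv x)) z" and ?t' = "\<lambda>z. mul (mul x (iv y)) z"
  have "mul y (iv x) \<in> Y" by (intro Y(2,3) xy)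
  then have t1: "?t ` Y \<subseteq> Y" by (auto intro: Y(2))
  have "mul x (iv y) \<in> Y" by (intro Y(2,3) xy)
  then have t2: "?t' ` Y \<subseteq> Y" by (auto intro: Y(2))
  have t3: "polymap M M ?t" "polymap M M ?t'"
    by (rule polymap_mul_left, intro H_length mul_mem iv_mem h xy)+
  have t4: "?t x = y"
    using xy by (simp add: assoc h iv_mem iv_left e_right)
  have t5: "?t' (?t z) = z" if "z \<in> Y" for z
  proof -
    have "?t' (?t z) = mul x (mul (mul (iv y) y) (mul (iv x) z))"
      using xy that by (simp add: assoc h iv_mem mul_mem)
    also have "\<dots> = mul (mul x (iv x)) z"
      using xy that by (simp add: assoc h iv_mem mul_mem iv_left e_left)
    finally show ?thesis using xy that by (simp add: h iv_right e_left)
  qed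
  show ?thesis
    by (rule exI[of _ ?t], rule exI[of _ ?t'], intro conjI ballI t1 t2 t3 t4 t5)
  qed
  note hom = this
  have "Y \<subseteq> affine_space M" using Y(1) H_sub by blast
  from homogeneous_disjoint_components[OF this hom]
  show ?thesis using that by blast
qed

text \<open>Written as the image of concatenated pairs under one polynomial map, so that
  \<open>irr_append\<close>, \<open>constr_append\<close> and the results on images apply
  directly.\<close>

definition setmul :: "'k list set \<Rightarrow> 'k list set \<Rightarrow> 'k list set" where
  "setmul S T = (\<lambda>w. mul (take M w) (drop M w)) ` {s @ t | s t. s \<in> S \<and> t \<in> T}"

lemma setmul_eq: "S \<subseteq> affine_space M \<Longrightarrow> setmul S T = {mul s t | s t. s \<in> S \<and> t \<in> T}"
  unfolding setmul_def by (force simp: image_iff)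

text \<open>The unit is included so that multiplying by another such set can only enlarge a set.
  Constructibility is carried along for the end of the argument, where a dense subset has to contain
  an open one.\<close>

definition good :: "'k list set \<Rightarrow> bool" where
  "good S \<longleftrightarrow> constr M S \<and> irr M S \<and> e \<in> S \<and> S \<subseteq> H"

lemma good_setmul:
  assumes "good S" "good T"
  shows "good (setmul S T)" "S \<subseteq> setmul S T"
proof -
  have sub: "S \<subseteq> affine_space M" using assms H_sub by (auto simp: good_def)
  show "good (setmul S T)"
    unfolding good_def
  proof (intro conjI)
    show "constr M (setmul S T)" unfolding setmul_def
      using assms by (intro constr_image[OF _ polymap_mul'] constr_append) (auto simp: good_def)
    show "irr M (setmul S T)" unfolding setmul_def
      using assms by (intro irr_image[OF _ polymap_mul'] irr_append) (auto simp: good_def)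
    have "e = mul e e" using e_left[OF e_mem] by simp
    then show "e \<in> setmul S T" unfolding setmul_eq[OF sub] using assms by (auto simp: good_def)
    show "setmul S T \<subseteq> H" unfolding setmul_eq[OF sub]
      using assms by (auto simp: good_def intro!: mul_mem)
  qed
  show "S \<subseteq> setmul S T"
  proof
    fix s assume "s \<in> S"
    moreover from this have "s = mul s e" using assms e_right by (auto simp: good_def)
    ultimately show "s \<in> setmul S T" unfolding setmul_eq[OF sub] using assms by (auto simp: good_def)
  qed
qed

lemma good_unit: "good {e}"
proof -
  have len: "length e = M" using H_length e_mem by blast
  have "constr M {a. length a = M \<and> (\<forall>i\<in>{..<M}. a ! i = e ! i)}"
    by (intro constr_ball constr_eq polyfun_nth polyfun_const) auto
  also have "{a. length a = M \<and> (\<forall>i\<in>{..<M}. a ! i = e ! i)} = {e}"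
    using len by (auto intro: nth_equalityI)
  finally show ?thesis using e_mem len by (auto simp: good_def irr_def)
qed

text \<open>Otherwise every good set could be multiplied by some \<open>Y\<close> so as to leave its
  own closure, which would produce an infinite chain of irreducible sets.\<close>

lemma exists_saturated:
  assumes "\<And>Y. Y \<in> \<Y> \<Longrightarrow> good Y"
  shows "\<exists>S. good S \<and> (\<forall>Y\<in>\<Y>. setmul S Y \<subseteq> zcl M S)"
proof (rule ccontr)
  assume "\<not> ?thesis"
  then have step: "\<exists>T. good T \<and> S \<subseteq> T \<and> \<not> T \<subseteq> zcl M S" if "good S" for S
    using that good_setmul[OF that] assms by meson
  have "\<exists>f. \<forall>n. good (f n) \<and> (f n \<subseteq> f (Suc n) \<and> \<not> f (Suc n) \<subseteq> zcl M (f n))"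
  proof (rule dependent_nat_choice)
    show "\<exists>S. good S" using good_unit by blast
    show "\<exists>T. good T \<and> (S \<subseteq> T \<and> \<not> T \<subseteq> zcl M S)" if "good S" for S and n :: nat
      using step[OF that] by blast
  qed
  then obtain f where "\<And>n. good (f n)" "\<And>n. f n \<subseteq> f (Suc n)" "\<And>n. \<not> f (Suc n) \<subseteq> zcl M (f n)"
    by blast
  then show False
    using no_infinite_irr_chain[of M f] by (auto simp: good_def)
qed

text \<open>Chevalley's theorem is used for the dense set \<open>S\<close>: for \<open>z\<close> in the closure \<open>Z\<close>, the open sets of
  all \<open>u\<close> in \<open>S\<close> and of all \<open>u\<close> with \<open>z u\<^sup>-\<^sup>1\<close> in \<open>S\<close> meet.\<close>

theorem generated_closed_irr:
  assumes good: "\<And>Y. Y \<in> \<Y> \<Longrightarrow> good Y"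
    and gen: "\<And>S. e \<in> S \<Longrightarrow> (\<And>z Y y. z \<in> S \<Longrightarrow> Y \<in> \<Y> \<Longrightarrow> y \<in> Y \<Longrightarrow> mul z y \<in> S) \<Longrightarrow> H \<subseteq> S"
  shows "irr M H" "Z = H"
proof -
  obtain S where S: "good S" "\<And>Y. Y \<in> \<Y> \<Longrightarrow> setmul S Y \<subseteq> zcl M S"
    using exists_saturated[of \<Y>] good by blast
  have sub: "S \<subseteq> affine_space M" "S \<subseteq> H" "irr M S" "constr M S" "e \<in> S"
    using S(1) H_sub by (auto simp: good_def)
  \<comment> \<open>The closure of \<open>S\<close> contains \<open>e\<close> and is stable under
    right multiplication by elements of each \<open>Y\<close>: such a translation is polynomial and
    maps \<open>S\<close> into the closure by saturation.\<close>
  have HS: "H \<subseteq> zcl M S"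
  proof (rule gen)
    show "e \<in> zcl M S" using zcl_superset[OF sub(1)] sub by blast
    fix z Y y assume z: "z \<in> zcl M S" and Y: "Y \<in> \<Y>" "y \<in> Y"
    have "y \<in> H" using good[OF Y(1)] Y(2) by (auto simp: good_def)
    then show "mul z y \<in> zcl M S"
    proof (intro zcl_polymap[OF polymap_mul_right z])
      fix s assume "s \<in> S"
      then have "mul s y \<in> setmul S Y" unfolding setmul_eq[OF sub(1)] using Y by blast
      then show "mul s y \<in> zcl M S" using S(2)[OF Y(1)] by blast
    qed (rule H_length)
  qed
  show "irr M H" by (rule irr_between[OF sub(3) sub(2) HS])
  have ZS: "Z \<subseteq> zcl M S" by (rule zcl_minimal[OF HS])
  have irrZ: "irr M Z"
    by (rule irr_between[OF sub(3) _ ZS]) (use sub(2) H_Z in blast)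
  obtain f d where f: "polyfun M f" "d \<in> S" "f d \<noteq> 0" "\<And>z. z \<in> zcl M S \<Longrightarrow> f z \<noteq> 0 \<Longrightarrow> z \<in> S"
    using irr_constr_contains_open[OF sub(3,4)] by metis
  have "z \<in> H" if z: "z \<in> Z" for z
  proof -
    let ?g = "\<lambda>u. f (mul z (iv u))"
    have g: "polyfun M ?g"
      by (intro polyfun_compose[OF f(1)] polymap_mul polymap_const polymap_iv Z_length z)
    have d: "d \<in> Z" using f(2) sub(2) H_Z by blast
    \<comment> \<open>The witness that \<open>?g\<close> is not identically zero on
      \<open>Z\<close>: for this \<open>u\<close> the quotient \<open>z u\<^sup>-\<^sup>1\<close> is
      \<open>d\<close>.\<close>
    let ?u = "mul (iv d) z"
    have u: "?u \<in> Z" using d z by (intro mul_Z iv_Z)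
    have "mul d ?u = z" using d z by (simp add: assoc_Z[symmetric] iv_Z unit_Z)
    then have "mul z (iv ?u) = mul (mul d ?u) (iv ?u)" by simp
    also have "\<dots> = d" using d u iv_Z[OF u] by (simp add: assoc_Z unit_Z)
    finally have "?g ?u \<noteq> 0" using f(3) by simp
    then obtain u where u: "u \<in> Z" "f u \<noteq> 0" "?g u \<noteq> 0"
      using irrD[OF irrZ f(1) g d f(3) u] by blast
    have "u \<in> S" using f(4) u ZS by blast
    moreover have "mul z (iv u) \<in> S"
      using f(4) u ZS mul_Z[OF z iv_Z[OF u(1)]] by blast
    ultimately have "mul (mul z (iv u)) u \<in> H" using sub(2) mul_mem by blast
    also have "mul (mul z (iv u)) u = z"
      using z u(1) by (simp add: assoc_Z iv_Z unit_Z)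
    finally show "z \<in> H" .
  qed
  then show "Z = H" using H_Z by blast
qed

end

section \<open>Regular functions\<close>

lemma openin_zariski_nonzero:
  fixes s :: "'k::field list \<Rightarrow> 'k"
  assumes "polyfun m s"
  shows "openin (zariski m) {b. length b = m \<and> s b \<noteq> 0}"
proof -
  obtain p where p: "p \<in> poly_ring m" "\<forall>a\<in>affine_space m. s a = eval p a"
    using assms by (auto simp: polyfun_def)
  then have eq: "affine_space m - {b. length b = m \<and> s b \<noteq> 0} = zero_set m {p}"
    by (auto simp: zero_set_def)
  show ?thesis
    unfolding openin_zariski zariski_open_def
  proof (intro conjI exI[of _ "{p}"])
    show "{b. length b = m \<and> s b \<noteq> 0} \<subseteq> affine_space m" by auto
    show "{p} \<subseteq> poly_ring m" using p(1) by blast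
  qed (rule eq)
qed

lemma zariski_basic_open:
  fixes a :: "'k::field list"
  assumes "openin (zariski m) U" "a \<in> U"
  obtains s where "polyfun m s" "s a \<noteq> 0" "\<And>b. length b = m \<Longrightarrow> s b \<noteq> 0 \<Longrightarrow> b \<in> U"
proof -
  obtain S where S: "U \<subseteq> affine_space m" "S \<subseteq> poly_ring m" "affine_space m - U = zero_set m S"
    using assms(1) unfolding openin_zariski zariski_open_def by blast
  have "a \<notin> zero_set m S" using S(3) assms(2) by blast
  then obtain p where p: "p \<in> S" "eval p a \<noteq> 0"
    using S(1) assms(2) unfolding zero_set_def by blast
  show ?thesis
  proof (rule that[of "eval p"])
    show "polyfun m (eval p)" using p S by (intro polyfun_eval) blast
    fix b :: "'k list" assume b: "length b = m" "eval p b \<noteq> 0"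
    have "b \<notin> zero_set m S" using p(1) b(2) unfolding zero_set_def by blast
    moreover have "b \<in> affine_space m" using b(1) by simp
    ultimately show "b \<in> U" using S(3) by blast
  qed (rule p(2))
qed

lemma local_fractionI:
  assumes "polyfun m p" "polyfun m q" "q a \<noteq> 0" "\<And>b. b \<in> W \<Longrightarrow> q b \<noteq> 0 \<Longrightarrow> f b * q b = p b"
  shows "\<exists>p q. polyfun m p \<and> polyfun m q \<and> q a \<noteq> 0 \<and> (\<forall>b\<in>W. q b \<noteq> 0 \<longrightarrow> f b * q b = p b)"
  by (rule exI[of _ p], rule exI[of _ q]) (use assms in blast)

text \<open>The open set on which a fraction is valid shrinks to a basic one, whose defining
  function is absorbed into numerator and denominator. The cross-multiplied form avoids
  division.\<close>

lemma regular_function_iff: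
  fixes W :: "'k::field list set"
  assumes W: "W \<subseteq> affine_space m"
  shows "regular_function m W f \<longleftrightarrow> (\<forall>a\<in>W. \<exists>p q. polyfun m p \<and> polyfun m q \<and> q a \<noteq> 0 \<and>
    (\<forall>b\<in>W. q b \<noteq> 0 \<longrightarrow> f b * q b = p b))"
proof
  assume f: "regular_function m W f"
  show "\<forall>a\<in>W. \<exists>p q. polyfun m p \<and> polyfun m q \<and> q a \<noteq> 0 \<and>
    (\<forall>b\<in>W. q b \<noteq> 0 \<longrightarrow> f b * q b = p b)"
  proof
    fix a assume a: "a \<in> W"
    from bspec[OF f[unfolded regular_function_def] this]
    obtain U p q where U: "openin (zariski m) U" "a \<in> U" "p \<in> poly_ring m" "q \<in> poly_ring m"
      "\<forall>b\<in>W \<inter> U. eval q b \<noteq> 0 \<and> f b = eval p b / eval q b" by blast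
    obtain s where s: "polyfun m s" "s a \<noteq> 0" "\<And>b. length b = m \<Longrightarrow> s b \<noteq> 0 \<Longrightarrow> b \<in> U"
      using zariski_basic_open[OF U(1,2)] by blast
    have "f b * (eval q b * s b) = eval p b * s b" if b: "b \<in> W" "eval q b * s b \<noteq> 0" for b
    proof -
      have "length b = m" using b W by auto
      then have "b \<in> W \<inter> U" using b s(3) by auto
      then show ?thesis using U(5) by simp
    qed
    moreover have "eval q a * s a \<noteq> 0" using U(5) U(2) a s(2) by simp
    ultimately show "\<exists>p q. polyfun m p \<and> polyfun m q \<and> q a \<noteq> 0 \<and>
        (\<forall>b\<in>W. q b \<noteq> 0 \<longrightarrow> f b * q b = p b)"
      using U(3,4) s(1)
      by (intro local_fractionI[of m "\<lambda>b. eval p b * s b" "\<lambda>b. eval q b * s b"]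
          polyfun_mult polyfun_eval)
  qed
next
  assume *: "\<forall>a\<in>W. \<exists>p q. polyfun m p \<and> polyfun m q \<and> q a \<noteq> 0 \<and>
    (\<forall>b\<in>W. q b \<noteq> 0 \<longrightarrow> f b * q b = p b)"
  show "regular_function m W f"
    unfolding regular_function_def
  proof
    fix a assume a: "a \<in> W"
    with * obtain p q where pq: "polyfun m p" "polyfun m q" "q a \<noteq> 0"
      "\<And>b. b \<in> W \<Longrightarrow> q b \<noteq> 0 \<Longrightarrow> f b * q b = p b" by blast
    obtain p' q' where p': "p' \<in> poly_ring m" "\<forall>a\<in>affine_space m. p a = eval p' a"
      "q' \<in> poly_ring m" "\<forall>a\<in>affine_space m. q a = eval q' a"
      using pq(1,2) by (auto simp: polyfun_def)
    have "eval q' b \<noteq> 0 \<and> f b = eval p' b / eval q' b" if "b \<in> W \<inter> {b. length b = m \<and> q b \<noteq> 0}" for b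
      using that p' pq(4)[of b] by (auto simp: field_simps)
    moreover have "a \<in> {b. length b = m \<and> q b \<noteq> 0}" using a W pq(3) by auto
    ultimately show "\<exists>U p q. openin (zariski m) U \<and> a \<in> U \<and> p \<in> poly_ring m \<and> q \<in> poly_ring m \<and>
        (\<forall>b\<in>W \<inter> U. eval q b \<noteq> 0 \<and> f b = eval p b / eval q b)"
      using openin_zariski_nonzero[OF pq(2)] p'(1,3) by blast
  qed
qed

lemma regular_functionE:
  fixes W :: "'k::field list set"
  assumes "regular_function m W f" "W \<subseteq> affine_space m" "a \<in> W"
  obtains p q where "polyfun m p" "polyfun m q" "q a \<noteq> 0"
    "\<And>b. b \<in> W \<Longrightarrow> q b \<noteq> 0 \<Longrightarrow> f b * q b = p b"
  using assms unfolding regular_function_iff[OF assms(2)] by blast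

lemma regular_functionI:
  fixes W :: "'k::field list set"
  assumes "W \<subseteq> affine_space m"
    "\<And>a. a \<in> W \<Longrightarrow> \<exists>p q. polyfun m p \<and> polyfun m q \<and> q a \<noteq> 0 \<and> (\<forall>b\<in>W. q b \<noteq> 0 \<longrightarrow> f b * q b = p b)"
  shows "regular_function m W f"
  using assms(2) unfolding regular_function_iff[OF assms(1)] by blast

lemma regular_function_cong:
  "regular_function m W f \<Longrightarrow> (\<And>a. a \<in> W \<Longrightarrow> f a = g a) \<Longrightarrow> regular_function m W g"
  unfolding regular_function_def by (metis IntD1)

lemma regular_function_polyfun:
  fixes W :: "'k::field list set"
  assumes "W \<subseteq> affine_space m" "polyfun m f"
  shows "regular_function m W f"
  using assms(2)
  by (intro regular_functionI[OF assms(1)] local_fractionI[of m f "\<lambda>_. 1"] polyfun_const) auto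

lemma regular_function_add_mult:
  fixes W :: "'k::field list set"
  assumes W: "W \<subseteq> affine_space m" and f: "regular_function m W f" and g: "regular_function m W g"
  shows "regular_function m W (\<lambda>a. f a + g a)" "regular_function m W (\<lambda>a. f a * g a)"
proof -
  have *: "\<exists>p q p' q'. polyfun m p \<and> polyfun m q \<and> q a \<noteq> 0 \<and> (\<forall>b\<in>W. q b \<noteq> 0 \<longrightarrow> f b * q b = p b) \<and>
      polyfun m p' \<and> polyfun m q' \<and> q' a \<noteq> 0 \<and> (\<forall>b\<in>W. q' b \<noteq> 0 \<longrightarrow> g b * q' b = p' b)"
    if "a \<in> W" for a
    using regular_functionE[OF f W that] regular_functionE[OF g W that] by metis
  show "regular_function m W (\<lambda>a. f a + g a)"
  proof (rule regular_functionI[OF W])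
    fix a assume "a \<in> W"
    from *[OF this] obtain p q p' q' where
      pq: "polyfun m p" "polyfun m q" "q a \<noteq> 0" "\<forall>b\<in>W. q b \<noteq> 0 \<longrightarrow> f b * q b = p b"
      "polyfun m p'" "polyfun m q'" "q' a \<noteq> 0" "\<forall>b\<in>W. q' b \<noteq> 0 \<longrightarrow> g b * q' b = p' b" by blast
    have "(f b + g b) * (q b * q' b) = p b * q' b + p' b * q b" if "b \<in> W" "q b * q' b \<noteq> 0" for b
    proof -
      have "f b * q b = p b" "g b * q' b = p' b" using pq that by auto
      then show ?thesis by (simp flip: \<open>f b * q b = p b\<close> \<open>g b * q' b = p' b\<close> add: algebra_simps)
    qed
    then show "\<exists>p q. polyfun m p \<and> polyfun m q \<and> q a \<noteq> 0 \<and> (\<forall>b\<in>W. q b \<noteq> 0 \<longrightarrow> (f b + g b) * q b = p b)"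
      using pq(1,2,3,5,6,7)
      by (intro local_fractionI[of m "\<lambda>b. p b * q' b + p' b * q b" "\<lambda>b. q b * q' b"]
          polyfun_add polyfun_mult) auto
  qed
  show "regular_function m W (\<lambda>a. f a * g a)"
  proof (rule regular_functionI[OF W])
    fix a assume "a \<in> W"
    from *[OF this] obtain p q p' q' where
      pq: "polyfun m p" "polyfun m q" "q a \<noteq> 0" "\<forall>b\<in>W. q b \<noteq> 0 \<longrightarrow> f b * q b = p b"
      "polyfun m p'" "polyfun m q'" "q' a \<noteq> 0" "\<forall>b\<in>W. q' b \<noteq> 0 \<longrightarrow> g b * q' b = p' b" by blast
    have "(f b * g b) * (q b * q' b) = p b * p' b" if "b \<in> W" "q b * q' b \<noteq> 0" for b
    proof -
      have "f b * q b = p b" "g b * q' b = p' b" using pq that by auto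
      then show ?thesis by (simp flip: \<open>f b * q b = p b\<close> \<open>g b * q' b = p' b\<close>)
    qed
    then show "\<exists>p q. polyfun m p \<and> polyfun m q \<and> q a \<noteq> 0 \<and> (\<forall>b\<in>W. q b \<noteq> 0 \<longrightarrow> (f b * g b) * q b = p b)"
      using pq(1,2,3,5,6,7)
      by (intro local_fractionI[of m "\<lambda>b. p b * p' b" "\<lambda>b. q b * q' b"] polyfun_mult) auto
  qed
qed

lemma regular_function_polyfun_compose:
  fixes W :: "'k::field list set"
  assumes W: "W \<subseteq> affine_space m" and len: "\<And>a. a \<in> W \<Longrightarrow> length (F a) = k"
    and F: "\<And>i. i < k \<Longrightarrow> regular_function m W (\<lambda>a. F a ! i)" and h: "polyfun k h"
  shows "regular_function m W (\<lambda>a. h (F a))"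
  using h
proof (induction rule: polyfun_induct)
  case (const c)
  show ?case using W by (intro regular_function_polyfun polyfun_const)
next
  case (nth i)
  then show ?case by (rule F)
next
  case (add f g)
  show ?case by (rule regular_function_add_mult(1)[OF W add])
next
  case (mult f g)
  show ?case by (rule regular_function_add_mult(2)[OF W mult])
next
  case (cong f g)
  show ?case by (rule regular_function_cong[OF cong.IH]) (use cong.hyps len in auto)
qed

lemma regular_function_polymap:
  fixes W :: "'k::field list set"
  assumes "W \<subseteq> affine_space m" "V \<subseteq> affine_space k" "regular_function k V f" "polymap m k F"
    "\<And>a. a \<in> W \<Longrightarrow> F a \<in> V"
  shows "regular_function m W (\<lambda>a. f (F a))"
proof (rule regular_functionI[OF assms(1)])
  fix a assume a: "a \<in> W"
  obtain p q where pq: "polyfun k p" "polyfun k q" "q (F a) \<noteq> 0"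
    "\<And>b. b \<in> V \<Longrightarrow> q b \<noteq> 0 \<Longrightarrow> f b * q b = p b"
    using regular_functionE[OF assms(3,2) assms(5)[OF a]] by metis
  then show "\<exists>p q. polyfun m p \<and> polyfun m q \<and> q a \<noteq> 0 \<and> (\<forall>b\<in>W. q b \<noteq> 0 \<longrightarrow> f (F b) * q b = p b)"
    using assms(4,5)
    by (intro local_fractionI[of m "\<lambda>a. p (F a)" "\<lambda>a. q (F a)"])
       (auto intro: polyfun_compose)
qed

lemma regular_function_compose:
  fixes W :: "'k::field list set"
  assumes W: "W \<subseteq> affine_space m" and V: "V \<subseteq> affine_space k" and FV: "\<And>a. a \<in> W \<Longrightarrow> F a \<in> V"
    and F: "\<And>i. i < k \<Longrightarrow> regular_function m W (\<lambda>a. F a ! i)" and f: "regular_function k V f"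
  shows "regular_function m W (\<lambda>a. f (F a))"
proof (rule regular_functionI[OF W])
  fix a assume a: "a \<in> W"
  obtain p q where pq: "polyfun k p" "polyfun k q" "q (F a) \<noteq> 0"
    "\<And>b. b \<in> V \<Longrightarrow> q b \<noteq> 0 \<Longrightarrow> f b * q b = p b"
    using regular_functionE[OF f V FV[OF a]] by metis
  have len: "length (F b) = k" if "b \<in> W" for b using FV[OF that] V by auto
  have rp: "regular_function m W (\<lambda>a. p (F a))"
    by (rule regular_function_polyfun_compose[OF W len F pq(1)])
  obtain p1 p2 where p12: "polyfun m p1" "polyfun m p2" "p2 a \<noteq> 0"
    "\<And>b. b \<in> W \<Longrightarrow> p2 b \<noteq> 0 \<Longrightarrow> p (F b) * p2 b = p1 b"
    using regular_functionE[OF rp W a] by metis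
  have rq: "regular_function m W (\<lambda>a. q (F a))"
    by (rule regular_function_polyfun_compose[OF W len F pq(2)])
  obtain q1 q2 where q12: "polyfun m q1" "polyfun m q2" "q2 a \<noteq> 0"
    "\<And>b. b \<in> W \<Longrightarrow> q2 b \<noteq> 0 \<Longrightarrow> q (F b) * q2 b = q1 b"
    using regular_functionE[OF rq W a] by metis
  \<comment> \<open>The quotient of \<open>p1 / p2\<close> by \<open>q1 / q2\<close>, expanded by
    \<open>q2\<close>: the extra factor ensures that \<open>q2 b\<close> is nonzero wherever the new
    denominator is.\<close>
  have "f (F b) * (p2 b * q1 b * q2 b) = p1 b * q2 b * q2 b"
    if b: "b \<in> W" "p2 b * q1 b * q2 b \<noteq> 0" for b
  proof -
    have 1: "p1 b = p (F b) * p2 b" "q1 b = q (F b) * q2 b" using p12(4) q12(4) b by auto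
    have "q (F b) \<noteq> 0" using b(2) 1(2) by auto
    then have "p (F b) = f (F b) * q (F b)" using pq(4)[OF FV[OF b(1)]] by simp
    then show ?thesis using 1 by (simp add: mult_ac)
  qed
  moreover have "p2 a * q1 a * q2 a \<noteq> 0"
    using p12(3) q12(3) pq(3) q12(4)[OF a q12(3)] by auto
  ultimately show "\<exists>p q. polyfun m p \<and> polyfun m q \<and> q a \<noteq> 0 \<and> (\<forall>b\<in>W. q b \<noteq> 0 \<longrightarrow> f (F b) * q b = p b)"
    using p12(1,2) q12(1,2)
    by (intro local_fractionI[of m "\<lambda>b. p1 b * q2 b * q2 b" "\<lambda>b. p2 b * q1 b * q2 b"] polyfun_mult)
qed

lemma regular_function_local:
  fixes W :: "'k::field list set"
  assumes W: "W \<subseteq> affine_space m"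
    and loc: "\<And>a. a \<in> W \<Longrightarrow> \<exists>V. a \<in> V \<and> openin (subtopology (zariski m) W) V \<and> regular_function m V f"
  shows "regular_function m W f"
proof (rule regular_functionI[OF W])
  fix a assume "a \<in> W"
  then obtain V where V: "a \<in> V" "openin (subtopology (zariski m) W) V" "regular_function m V f"
    using loc by blast
  obtain U where U: "openin (zariski m) U" "V = U \<inter> W"
    using V(2) by (auto simp: openin_subtopology)
  obtain s where s: "polyfun m s" "s a \<noteq> 0" "\<And>b. length b = m \<Longrightarrow> s b \<noteq> 0 \<Longrightarrow> b \<in> U"
    using zariski_basic_open[OF U(1), of a] V(1) U(2) by blast
  have "V \<subseteq> affine_space m" using U(2) W by blast
  from regular_functionE[OF V(3) this V(1)]
  obtain p q where pq: "polyfun m p" "polyfun m q" "q a \<noteq> 0"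
    "\<And>b. b \<in> V \<Longrightarrow> q b \<noteq> 0 \<Longrightarrow> f b * q b = p b" by blast
  have "f b * (q b * s b) = p b * s b" if "b \<in> W" "q b * s b \<noteq> 0" for b
  proof -
    have "b \<in> V" using that s(3)[of b] W U(2) by auto
    then have "f b * q b = p b" using pq(4) that(2) by auto
    then show ?thesis by (simp flip: \<open>f b * q b = p b\<close>)
  qed
  then show "\<exists>p q. polyfun m p \<and> polyfun m q \<and> q a \<noteq> 0 \<and> (\<forall>b\<in>W. q b \<noteq> 0 \<longrightarrow> f b * q b = p b)"
    using pq(1-3) s(1,2)
    by (intro local_fractionI[of m "\<lambda>b. p b * s b" "\<lambda>b. q b * s b"] polyfun_mult) auto
qed

lemma openin_regular_nonzero:
  fixes W :: "'k::field list set"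
  assumes W: "W \<subseteq> affine_space m" and f: "regular_function m W f"
  shows "openin (subtopology (zariski m) W) {a \<in> W. f a \<noteq> 0}"
proof (subst openin_subopen, intro ballI)
  fix a assume "a \<in> {a \<in> W. f a \<noteq> 0}"
  then have a: "a \<in> W" "f a \<noteq> 0" by auto
  obtain p q where pq: "polyfun m p" "polyfun m q" "q a \<noteq> 0"
    "\<And>b. b \<in> W \<Longrightarrow> q b \<noteq> 0 \<Longrightarrow> f b * q b = p b"
    using regular_functionE[OF f W a(1)] by metis
  let ?U = "{b. length b = m \<and> p b * q b \<noteq> 0}"
  have "openin (subtopology (zariski m) W) (?U \<inter> W)"
    using openin_zariski_nonzero[OF polyfun_mult[OF pq(1,2)]] by (auto simp: openin_subtopology)
  moreover have "p a \<noteq> 0" using pq(4)[OF a(1) pq(3)] pq(3) a(2) by auto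
  then have "a \<in> ?U \<inter> W" using a pq(3) W by auto
  moreover have "f b \<noteq> 0" if "b \<in> ?U \<inter> W" for b using pq(4)[of b] that by auto
  then have "?U \<inter> W \<subseteq> {a \<in> W. f a \<noteq> 0}" by blast
  ultimately show "\<exists>T. openin (subtopology (zariski m) W) T \<and> a \<in> T \<and> T \<subseteq> {a \<in> W. f a \<noteq> 0}"
    by blast
qed

text \<open>Near each point the graph of a regular map is given by equations \<open>q\<^sub>i y\<^sub>i = p\<^sub>i\<close>, so its image is a
  projection of a constructible set.\<close>

theorem constr_regular_image:
  fixes W :: "'k::alg_closed_field list set"
  assumes W: "constr m W" and len: "\<And>a. a \<in> W \<Longrightarrow> length (G a) = k"
    and G: "\<And>i. i < k \<Longrightarrow> regular_function m W (\<lambda>a. G a ! i)"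
  shows "constr k (G ` W)"
proof -
  have Wm: "W \<subseteq> affine_space m" by (rule constr_affine_space[OF W])
  have "\<exists>q\<in>{q. constr k (G ` {b \<in> W. q b \<noteq> 0})}. polyfun m q \<and> q a \<noteq> 0" if a: "a \<in> W" for a
  proof -
    have "\<forall>i\<in>{..<k}. \<exists>pq. polyfun m (fst pq) \<and> polyfun m (snd pq) \<and> snd pq a \<noteq> 0 \<and>
        (\<forall>b\<in>W. snd pq b \<noteq> 0 \<longrightarrow> G b ! i * snd pq b = fst pq b)"
    proof
      fix i assume "i \<in> {..<k}"
      then obtain p q where "polyfun m p" "polyfun m q" "q a \<noteq> 0"
        "\<And>b. b \<in> W \<Longrightarrow> q b \<noteq> 0 \<Longrightarrow> G b ! i * q b = p b"
        using regular_functionE[OF G Wm a] by (metis lessThan_iff)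
      then show "\<exists>pq. polyfun m (fst pq) \<and> polyfun m (snd pq) \<and> snd pq a \<noteq> 0 \<and>
        (\<forall>b\<in>W. snd pq b \<noteq> 0 \<longrightarrow> G b ! i * snd pq b = fst pq b)"
        by (intro exI[of _ "(p, q)"]) simp
    qed
    from bchoice[OF this] obtain r where r: "\<And>i. i < k \<Longrightarrow> polyfun m (fst (r i))"
      "\<And>i. i < k \<Longrightarrow> polyfun m (snd (r i))" "\<And>i. i < k \<Longrightarrow> snd (r i) a \<noteq> 0"
      "\<And>i b. i < k \<Longrightarrow> b \<in> W \<Longrightarrow> snd (r i) b \<noteq> 0 \<Longrightarrow> G b ! i * snd (r i) b = fst (r i) b"
      by (auto simp: lessThan_iff)
    \<comment> \<open>One nonvanishing condition for all \<open>k\<close> coordinates; under it the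
      equations determine \<open>G b\<close>.\<close>
    define q where "q b = (\<Prod>i<k. snd (r i) b)" for b
    have q: "polyfun m q" "q a \<noteq> 0" unfolding q_def using r(2,3) by (auto intro!: polyfun_prod)
    have nz: "snd (r i) b \<noteq> 0" if "q b \<noteq> 0" "i < k" for i b using that by (auto simp: q_def)
    have "constr (k + m) {z. length z = k + m \<and> drop k z \<in> W \<and> q (drop k z) \<noteq> 0 \<and>
        (\<forall>i\<in>{..<k}. z ! i * snd (r i) (drop k z) = fst (r i) (drop k z))}"
      by (intro constr_conj constr_vimage[OF W] polymap_drop constr_neg constr_ball constr_eq
          polyfun_mult polyfun_nth polyfun_const polyfun_compose[OF _ polymap_drop] q(1) r(1,2)) auto
    from constr_projection[OF this]
    have "constr k {y. length y = k \<and> (\<exists>x. length x = m \<and> x \<in> W \<and> q x \<noteq> 0 \<and>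
        (\<forall>i<k. y ! i * snd (r i) x = fst (r i) x))}"
      by (rule constr_cong) (auto simp: nth_append)
    also have "{y. length y = k \<and> (\<exists>x. length x = m \<and> x \<in> W \<and> q x \<noteq> 0 \<and>
        (\<forall>i<k. y ! i * snd (r i) x = fst (r i) x))} = G ` {b \<in> W. q b \<noteq> 0}" (is "?A = ?B")
    proof
      show "?A \<subseteq> ?B"
      proof
        fix y assume "y \<in> ?A"
        then obtain x where x: "length y = k" "x \<in> W" "q x \<noteq> 0"
          "\<And>i. i < k \<Longrightarrow> y ! i * snd (r i) x = fst (r i) x" by blast
        have "y ! i = G x ! i" if "i < k" for i
          using x(4)[OF that] r(4)[OF that x(2)] nz[OF x(3) that] by (metis mult_right_cancel)
        then have "y = G x" using x(1) len[OF x(2)] by (intro nth_equalityI) auto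
        then show "y \<in> ?B" using x by blast
      qed
      show "?B \<subseteq> ?A"
      proof clarify
        fix b assume b: "b \<in> W" "q b \<noteq> 0"
        have "\<forall>i<k. G b ! i * snd (r i) b = fst (r i) b" using r(4) b nz by blast
        then show "length (G b) = k \<and> (\<exists>x. length x = m \<and> x \<in> W \<and> q x \<noteq> 0 \<and>
            (\<forall>i<k. G b ! i * snd (r i) x = fst (r i) x))"
          using b len Wm by (intro conjI exI[of _ b]) auto
      qed
    qed
    finally show ?thesis using q by blast
  qed
  note cover = this
  have "\<exists>Q :: ('k list \<Rightarrow> 'k) set. finite Q \<and> Q \<subseteq> {q. constr k (G ` {b \<in> W. q b \<noteq> 0})} \<and>
      (\<forall>a\<in>W. \<exists>q\<in>Q. q a \<noteq> 0)"
  proof (rule finite_nonvanishing_cover[OF Wm])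
    show "\<exists>q\<in>{q. constr k (G ` {b \<in> W. q b \<noteq> 0})}. polyfun m q \<and> q a \<noteq> 0" if "a \<in> W" for a
      by (rule cover[OF that])
    fix Q :: "('k list \<Rightarrow> 'k) set"
    assume Q: "finite Q" "Q \<subseteq> {q. constr k (G ` {b \<in> W. q b \<noteq> 0})}"
      "\<And>a. a \<in> W \<Longrightarrow> \<exists>q\<in>Q. q a \<noteq> 0"
    show "\<exists>Q :: ('k list \<Rightarrow> 'k) set. finite Q \<and> Q \<subseteq> {q. constr k (G ` {b \<in> W. q b \<noteq> 0})} \<and>
        (\<forall>a\<in>W. \<exists>q\<in>Q. q a \<noteq> 0)"
      by (rule exI[of _ Q], intro conjI Q(1,2) ballI, rule Q(3))
  qed
  then obtain Q :: "('k list \<Rightarrow> 'k) set" where Q: "finite Q"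
    "Q \<subseteq> {q. constr k (G ` {b \<in> W. q b \<noteq> 0})}" "\<forall>a\<in>W. \<exists>q\<in>Q. q a \<noteq> 0"
    by (elim exE conjE)
  have "constr k {y. length y = k \<and> (\<exists>q\<in>Q. y \<in> G ` {b \<in> W. q b \<noteq> 0})}"
    using Q(2) by (intro constr_bex[OF Q(1)] constr_Collect_mem) blast
  also have "{y. length y = k \<and> (\<exists>q\<in>Q. y \<in> G ` {b \<in> W. q b \<noteq> 0})} = G ` W"
    using Q(3) len by blast
  finally show ?thesis .
qed

section \<open>Regular functions on varieties\<close>

definition regular_on :: "('x, 'k::field) variety \<Rightarrow> ('x \<Rightarrow> 'k) \<Rightarrow> bool" where
  "regular_on X f \<longleftrightarrow>
     (\<forall>c\<in>charts X. regular_function (chart_dim c) (chart_image c) (\<lambda>a. f (chart_inv c a)))"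

lemma is_varietyD:
  assumes "is_variety X"
  shows "finite (charts X)" "(\<Union>c\<in>charts X. chart_dom c) = points X"
    "c \<in> charts X \<Longrightarrow> inj_on (chart_coord c) (chart_dom c)"
    "c \<in> charts X \<Longrightarrow> closedin (zariski (chart_dim c)) (chart_image c)"
  using assms unfolding is_variety_def by auto

lemma chart_image_affine: "is_variety X \<Longrightarrow> c \<in> charts X \<Longrightarrow> chart_image c \<subseteq> affine_space (chart_dim c)"
  using closedin_subset[OF is_varietyD(4)] by force

lemma chart_inv_coord:
  "is_variety X \<Longrightarrow> c \<in> charts X \<Longrightarrow> x \<in> chart_dom c \<Longrightarrow> chart_inv c (chart_coord c x) = x"
  by (rule inv_into_f_f[OF is_varietyD(3)])

lemma closedin_zariski_zcl:
  fixes W :: "'k::field list set"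
  assumes "closedin (zariski m) W"
  shows "zcl m W = W"
proof -
  obtain S where S: "S \<subseteq> poly_ring m" "W = zero_set m S"
    using assms unfolding closedin_zariski by blast
  have "zcl m W \<subseteq> W"
  proof
    fix a assume a: "a \<in> zcl m W"
    have "eval p a = 0" if "p \<in> S" for p
      by (rule zclD[OF a polyfun_eval]) (use that S in \<open>auto simp: zero_set_def\<close>)
    then show "a \<in> W" using a S(2) by (auto simp: zcl_def zero_set_def)
  qed
  moreover have "W \<subseteq> zcl m W" by (rule zcl_superset) (use S(2) in \<open>auto simp: zero_set_def\<close>)
  ultimately show ?thesis by blast
qed

lemma closedin_zcl:
  fixes S :: "'k::field list set"
  assumes S: "S \<subseteq> affine_space m"
  shows "closedin (zariski m) (zcl m S)"
proof -
  have "zcl m S = zero_set m (vanishing_ideal m S)"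
  proof
    show "zcl m S \<subseteq> zero_set m (vanishing_ideal m S)"
      using zclD[OF _ polyfun_eval] by (fastforce simp: zero_set_def vanishing_ideal_def zcl_affine_space[THEN subsetD, simplified])
    show "zero_set m (vanishing_ideal m S) \<subseteq> zcl m S"
    proof
      fix a assume a: "a \<in> zero_set m (vanishing_ideal m S)"
      show "a \<in> zcl m S"
        unfolding zcl_def
      proof (intro CollectI conjI allI impI)
        show "length a = m" using a by (simp add: zero_set_def)
        fix f :: "'k list \<Rightarrow> 'k" assume f: "polyfun m f" "\<forall>s\<in>S. f s = 0"
        then obtain p where p: "p \<in> poly_ring m" "\<forall>a\<in>affine_space m. f a = eval p a"
          by (auto simp: polyfun_def)
        have "eval p s = 0" if "s \<in> S" for s using p(2) f(2) S that by (metis subsetD)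
        then have "p \<in> vanishing_ideal m S" using p(1) by (simp add: vanishing_ideal_def)
        with a p(2) show "f a = 0" by (auto simp: zero_set_def)
      qed
    qed
  qed
  moreover have "vanishing_ideal m S \<subseteq> poly_ring m" by (auto simp: vanishing_ideal_def)
  ultimately show ?thesis unfolding closedin_zariski by blast
qed

lemma variety_open_nonzero:
  assumes X: "is_variety X" and f: "regular_on X f"
  shows "variety_open X {x \<in> points X. f x \<noteq> 0}"
  unfolding variety_open_def
proof (intro conjI ballI)
  fix c assume c: "c \<in> charts X"
  have "chart_dom c \<subseteq> points X" using is_varietyD(2)[OF X] c by blast
  then have "chart_coord c ` ({x \<in> points X. f x \<noteq> 0} \<inter> chart_dom c) =
      {a \<in> chart_image c. f (chart_inv c a) \<noteq> 0}"
    using chart_inv_coord[OF X c] by force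
  then show "openin (chart_topology c) (chart_coord c ` ({x \<in> points X. f x \<noteq> 0} \<inter> chart_dom c))"
    using openin_regular_nonzero[OF chart_image_affine[OF X c]] f c by (simp add: regular_on_def)
qed auto

lemma topspace_variety:
  assumes "is_variety X"
  shows "topspace (variety_topology X) = points X"
proof -
  have "variety_open X (points X)"
    unfolding variety_open_def
  proof (intro conjI ballI)
    fix c assume c: "c \<in> charts X"
    then have "points X \<inter> chart_dom c = chart_dom c" using is_varietyD(2)[OF assms] by blast
    then show "openin (chart_topology c) (chart_coord c ` (points X \<inter> chart_dom c))"
      using chart_image_affine[OF assms c] by (simp add: openin_subtopology_refl)
  qed simp
  then show ?thesis
    unfolding topspace_def openin_variety_topology[OF assms] by (auto simp: variety_open_def)
qed

lemma regular_on_polyfun: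
  assumes X: "is_variety X" and F: "\<And>i. i < k \<Longrightarrow> regular_on X (\<lambda>x. F x ! i)"
    and len: "\<And>x. x \<in> points X \<Longrightarrow> length (F x) = k" and h: "polyfun k h"
  shows "regular_on X (\<lambda>x. h (F x))"
  unfolding regular_on_def
proof
  fix c assume c: "c \<in> charts X"
  show "regular_function (chart_dim c) (chart_image c) (\<lambda>a. h (F (chart_inv c a)))"
  proof (rule regular_function_polyfun_compose[OF chart_image_affine[OF X c] _ _ h])
    show "length (F (chart_inv c a)) = k" if "a \<in> chart_image c" for a
      using that chart_inv_coord[OF X c] is_varietyD(2)[OF X] c by (force intro: len)
    show "regular_function (chart_dim c) (chart_image c) (\<lambda>a. F (chart_inv c a) ! i)" if "i < k" for i
      using F[OF that] c by (simp add: regular_on_def)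
  qed
qed

text \<open>Regularity is local, and by the definition of a morphism the preimages of the charts of
  \<open>Y\<close> form an open cover of each chart of \<open>X\<close>.\<close>

lemma regular_on_morphism:
  assumes X: "is_variety X" and Y: "is_variety Y" and \<phi>: "variety_morphism X Y \<phi>"
    and f: "regular_on Y f"
  shows "regular_on X (\<lambda>x. f (\<phi> x))"
  unfolding regular_on_def
proof
  fix c assume c: "c \<in> charts X"
  show "regular_function (chart_dim c) (chart_image c) (\<lambda>a. f (\<phi> (chart_inv c a)))"
  proof (rule regular_function_local[OF chart_image_affine[OF X c]])
    fix a assume "a \<in> chart_image c"
    then obtain x where x: "x \<in> chart_dom c" "a = chart_coord c x" by blast
    then have "x \<in> points X" using is_varietyD(2)[OF X] c by blast
    then have "\<phi> x \<in> points Y" using \<phi> by (auto simp: variety_morphism_def)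
    then obtain d where d: "d \<in> charts Y" "\<phi> x \<in> chart_dom d" using is_varietyD(2)[OF Y] by blast
    let ?V = "chart_coord c ` (chart_dom c \<inter> \<phi> -` chart_dom d)"
    have V: "openin (chart_topology c) ?V"
      "regular_map (chart_dim c) ?V (chart_dim d) (chart_coord d \<circ> \<phi> \<circ> chart_inv c)"
      using \<phi> c d by (auto simp: variety_morphism_def)
    have VA: "?V \<subseteq> affine_space (chart_dim c)" using chart_image_affine[OF X c] by blast
    have "regular_function (chart_dim c) ?V
        (\<lambda>b. f (chart_inv d ((chart_coord d \<circ> \<phi> \<circ> chart_inv c) b)))"
    proof (rule regular_function_compose[OF VA chart_image_affine[OF Y d(1)]])
      show "(chart_coord d \<circ> \<phi> \<circ> chart_inv c) b \<in> chart_image d" if "b \<in> ?V" for b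
        using that chart_inv_coord[OF X c] by auto
      show "regular_function (chart_dim c) ?V (\<lambda>b. (chart_coord d \<circ> \<phi> \<circ> chart_inv c) b ! i)"
        if "i < chart_dim d" for i
        using V(2) that by (simp add: regular_map_def)
      show "regular_function (chart_dim d) (chart_image d) (\<lambda>a. f (chart_inv d a))"
        using f d(1) by (simp add: regular_on_def)
    qed
    then have "regular_function (chart_dim c) ?V (\<lambda>a. f (\<phi> (chart_inv c a)))"
      by (rule regular_function_cong) (auto simp: chart_inv_coord[OF X c] chart_inv_coord[OF Y d(1)])
    moreover have "a \<in> ?V" using x d(2) by blast
    ultimately show "\<exists>V. a \<in> V \<and> openin (chart_topology c) V \<and>
        regular_function (chart_dim c) V (\<lambda>a. f (\<phi> (chart_inv c a)))"
      using V(1) by (intro exI[of _ ?V] conjI)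
  qed
qed

text \<open>Chevalley's theorem for an abstract variety: chart images are closed, hence
  constructible, and the finite atlas makes the image a finite union.\<close>

lemma constr_regular_on_image:
  fixes X :: "('x, 'k::alg_closed_field) variety"
  assumes X: "is_variety X" and F: "\<And>i. i < k \<Longrightarrow> regular_on X (\<lambda>x. F x ! i)"
    and len: "\<And>x. x \<in> points X \<Longrightarrow> length (F x) = k"
  shows "constr k (F ` points X)"
proof -
  have dom: "chart_dom c \<subseteq> points X" if "c \<in> charts X" for c
    using is_varietyD(2)[OF X] that by blast
  have "constr k {y. length y = k \<and> y \<in> (\<lambda>a. F (chart_inv c a)) ` chart_image c}"
    if c: "c \<in> charts X" for c
  proof (intro constr_Collect_mem constr_regular_image)
    show "constr (chart_dim c) (chart_image c)"
      using constr_zcl[of "chart_dim c" "chart_image c"] closedin_zariski_zcl[OF is_varietyD(4)[OF X c]]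
      by simp
    show "length (F (chart_inv c a)) = k" if "a \<in> chart_image c" for a
      using that chart_inv_coord[OF X c] dom[OF c] by (force intro: len)
    show "regular_function (chart_dim c) (chart_image c) (\<lambda>a. F (chart_inv c a) ! i)" if "i < k" for i
      using F[OF that] c by (simp add: regular_on_def)
  qed
  then have "constr k {y. length y = k \<and> (\<exists>c\<in>charts X. y \<in> (\<lambda>a. F (chart_inv c a)) ` chart_image c)}"
    by (intro constr_bex is_varietyD(1)[OF X])
  also have "{y. length y = k \<and> (\<exists>c\<in>charts X. y \<in> (\<lambda>a. F (chart_inv c a)) ` chart_image c)} = F ` points X"
  proof -
    have "(\<lambda>a. F (chart_inv c a)) ` chart_image c = F ` chart_dom c" if "c \<in> charts X" for c
      using chart_inv_coord[OF X that] by (force simp: image_iff)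
    then have "{y. length y = k \<and> (\<exists>c\<in>charts X. y \<in> (\<lambda>a. F (chart_inv c a)) ` chart_image c)} =
        {y. length y = k \<and> (\<exists>c\<in>charts X. y \<in> F ` chart_dom c)}" by auto
    also have "\<dots> = F ` (\<Union>c\<in>charts X. chart_dom c)" using len dom by blast
    finally show ?thesis using is_varietyD(2)[OF X] by simp
  qed
  finally show ?thesis .
qed

text \<open>The preimages of the components are open and closed.\<close>

lemma connected_image_irr:
  fixes X :: "('x, 'k::alg_closed_field) variety"
  assumes X: "is_variety X" and conn: "connected_space (variety_topology X)" and ne: "points X \<noteq> {}"
    and F: "\<And>i. i < k \<Longrightarrow> regular_on X (\<lambda>x. F x ! i)"
    and len: "\<And>x. x \<in> points X \<Longrightarrow> length (F x) = k"
    and C: "finite \<C>" "\<Union>\<C> = F ` points X" "\<And>C. C \<in> \<C> \<Longrightarrow> irr k C"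
    "\<And>C. C \<in> \<C> \<Longrightarrow> C = F ` points X \<inter> zcl k C" "\<And>C D. C \<in> \<C> \<Longrightarrow> D \<in> \<C> \<Longrightarrow> C \<inter> D \<noteq> {} \<Longrightarrow> C = D"
  shows "irr k (F ` points X)"
proof -
  note top = openin_variety_topology[OF X] topspace_variety[OF X]
  have open_compl: "openin (variety_topology X) {x \<in> points X. F x \<notin> C}" if "C \<in> \<C>" for C
  proof -
    let ?fs = "{f. polyfun k f \<and> (\<forall>c\<in>C. f c = 0)}"
    have "F x \<notin> C \<longleftrightarrow> (\<exists>f\<in>?fs. f (F x) \<noteq> 0)" if "x \<in> points X" for x
    proof -
      have "F x \<notin> C \<longleftrightarrow> F x \<notin> zcl k C" using C(4)[OF \<open>C \<in> \<C>\<close>] that by blast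
      then show ?thesis using len[OF that] by (auto simp: zcl_def)
    qed
    then have "{x \<in> points X. F x \<notin> C} = (\<Union>f\<in>?fs. {x \<in> points X. f (F x) \<noteq> 0})" by blast
    also have "openin (variety_topology X) \<dots>"
      using variety_open_nonzero[OF X regular_on_polyfun[OF X F len]]
      by (intro openin_Union) (auto simp: top(1))
    finally show ?thesis .
  qed
  obtain x where x: "x \<in> points X" using ne by blast
  then obtain C where C': "C \<in> \<C>" "F x \<in> C" using C(2) by blast
  let ?T = "{x \<in> points X. F x \<in> C}"
  have "points X - ?T = {x \<in> points X. F x \<notin> C}" by blast
  then have "closedin (variety_topology X) ?T"
    unfolding closedin_def top(2) using open_compl[OF C'(1)] by auto
  moreover have "openin (variety_topology X) ?T"
  proof -
    \<comment> \<open>Since the components are disjoint and cover the image, lying in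
      \<open>C\<close> means avoiding the finitely many others.\<close>
    have "?T = points X \<inter> (\<Inter>D\<in>\<C> - {C}. {x \<in> points X. F x \<notin> D})"
      using C(2,5) C'(1) by blast
    also have "openin (variety_topology X) \<dots>"
    proof (cases "\<C> - {C} = {}")
      case True
      show ?thesis unfolding True using openin_topspace[of "variety_topology X"] by (simp add: top(2))
    next
      case False
      then show ?thesis
        using open_compl C(1) openin_topspace[of "variety_topology X"]
        by (intro openin_Int openin_Inter) (auto simp: top(2))
    qed
    finally show ?thesis .
  qed
  ultimately have "?T = points X"
    using conn x C'(2) unfolding connected_space_clopen_in top(2) by blast
  then have "F ` points X \<subseteq> C" by blast
  then have "F ` points X = C" using C(2) C'(1) by blast
  then show ?thesis using C(3)[OF C'(1)] by simp
qed

section \<open>Groups of polynomial automorphisms\<close>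

lemma coordinate_tuple_iff: "(\<exists>fs. coordinate_tuple n F fs) \<longleftrightarrow> polymap n n F"
proof
  assume "\<exists>fs. coordinate_tuple n F fs"
  then obtain fs where fs: "length fs = n" "set fs \<subseteq> poly_ring n"
    "\<And>a. length a = n \<Longrightarrow> F a = map (\<lambda>f. eval f a) fs"
    by (auto simp: coordinate_tuple_def)
  show "polymap n n F"
    unfolding polymap_def
  proof (intro conjI allI impI)
    show "length (F a) = n" if "length a = n" for a using fs that by simp
    fix i assume i: "i < n"
    then have "fs ! i \<in> poly_ring n" using fs(1,2) by auto
    then show "polyfun n (\<lambda>a. F a ! i)"
      using fs(1,3) i by (intro polyfun_cong[OF polyfun_eval]) auto
  qed
next
  assume F: "polymap n n F"
  then have "\<forall>i\<in>{..<n}. \<exists>p. p \<in> poly_ring n \<and> (\<forall>a\<in>affine_space n. F a ! i = eval p a)"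
    by (auto simp: polymap_def polyfun_def)
  from bchoice[OF this] obtain p where "\<forall>i\<in>{..<n}. p i \<in> poly_ring n \<and>
      (\<forall>a\<in>affine_space n. F a ! i = eval (p i) a)" by blast
  then have p: "\<And>i. i < n \<Longrightarrow> p i \<in> poly_ring n"
    "\<And>i a. i < n \<Longrightarrow> length a = n \<Longrightarrow> F a ! i = eval (p i) a" by auto
  have "coordinate_tuple n F (map p [0..<n])"
    unfolding coordinate_tuple_def
    using p polymap_length[OF F] by (auto intro!: nth_equalityI)
  then show "\<exists>fs. coordinate_tuple n F fs" by blast
qed

lemma carrier_Aut_affine:
  "carrier (Aut_affine n) =
     {F \<in> Bij (affine_space n). polymap n n F \<and> polymap n n (inv_into (affine_space n) F)}"
  by (simp add: Aut_affine_def coordinate_tuple_iff)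

lemma mult_Aut_affine:
  "F \<in> carrier (Aut_affine n) \<Longrightarrow> G \<in> carrier (Aut_affine n) \<Longrightarrow>
     F \<otimes>\<^bsub>Aut_affine n\<^esub> G = compose (affine_space n) F G"
  unfolding carrier_Aut_affine by (simp add: Aut_affine_def BijGroup_def)

lemma one_Aut_affine: "\<one>\<^bsub>Aut_affine n\<^esub> = (\<lambda>a\<in>affine_space n. a)"
  by (simp add: Aut_affine_def BijGroup_def)

lemma group_Aut_affine: "group (Aut_affine n :: ('k::field list \<Rightarrow> 'k list) monoid)"
proof -
  let ?S = "affine_space n :: 'k list set"
  let ?C = "carrier (Aut_affine n :: ('k list \<Rightarrow> 'k list) monoid)"
  have "subgroup ?C (BijGroup ?S)"
  proof (rule group.subgroupI[OF group_BijGroup])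
    show "?C \<subseteq> carrier (BijGroup ?S)" by (auto simp: carrier_Aut_affine BijGroup_def)
    have "(\<lambda>a\<in>?S. a) \<in> ?C"
    proof -
      have "polymap n n (\<lambda>a\<in>?S. a)" by (rule polymap_cong[OF polymap_id]) simp
      moreover have "polymap n n (inv_into ?S (\<lambda>a\<in>?S. a))"
      proof (rule polymap_cong[OF polymap_id])
        fix a :: "'k list" assume "length a = n"
        then show "a = inv_into ?S (\<lambda>a\<in>?S. a) a"
          using inv_into_f_f[of "\<lambda>a\<in>?S. a" ?S a] by (simp add: inj_on_def)
      qed
      ultimately show ?thesis using id_Bij by (simp add: carrier_Aut_affine)
    qed
    then show "?C \<noteq> {}" by blast
    fix F assume F: "F \<in> ?C"
    then have FB: "F \<in> Bij ?S" by (simp add: carrier_Aut_affine)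
    let ?I = "\<lambda>x\<in>?S. inv_into ?S F x"
    have "polymap n n ?I"
    proof (rule polymap_cong)
      show "polymap n n (inv_into ?S F)" using F by (simp add: carrier_Aut_affine)
    qed simp
    moreover have "polymap n n (inv_into ?S ?I)"
    proof (rule polymap_cong)
      show "polymap n n F" using F by (simp add: carrier_Aut_affine)
      fix a :: "'k list" assume a: "length a = n"
      have b: "bij_betw F ?S ?S" using FB by (simp add: Bij_def)
      have "F a \<in> ?S" using bij_betwE[OF b] a by simp
      moreover have "?I (F a) = a"
        using inv_into_f_f[OF bij_betw_imp_inj_on[OF b], of a] a \<open>F a \<in> ?S\<close> by simp
      moreover have "inj_on ?I ?S"
        using restrict_inv_into_Bij[OF FB] by (auto simp: Bij_def bij_betw_def)
      ultimately show "F a = inv_into ?S ?I a" using inv_into_f_f[of ?I ?S "F a"] by simp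
    qed
    ultimately have "?I \<in> ?C" using restrict_inv_into_Bij[OF FB] by (simp add: carrier_Aut_affine)
    then show "inv\<^bsub>BijGroup ?S\<^esub> F \<in> ?C" by (simp add: inv_BijGroup[OF FB])
    fix G assume G: "G \<in> ?C"
    then have GB: "G \<in> Bij ?S" by (simp add: carrier_Aut_affine)
    have pF: "polymap n n F" "polymap n n (inv_into ?S F)"
      and pG: "polymap n n G" "polymap n n (inv_into ?S G)"
      using F G by (simp_all add: carrier_Aut_affine)
    have bF: "bij_betw F ?S ?S" and bG: "bij_betw G ?S ?S" using FB GB by (auto simp: Bij_def)
    have "polymap n n (compose ?S F G)"
    proof (rule polymap_cong)
      show "polymap n n (\<lambda>a. F (G a))"
        by (rule polymap_compose[OF pF(1) pG(1)])
    qed (simp add: compose_def)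
    moreover have "polymap n n (inv_into ?S (compose ?S F G))"
    proof (rule polymap_cong)
      show "polymap n n (\<lambda>a. inv_into ?S G (inv_into ?S F a))"
        by (rule polymap_compose[OF pG(2) pF(2)])
      fix a :: "'k list" assume a: "length a = n"
      define c where "c = inv_into ?S G (inv_into ?S F a)"
      have "a \<in> F ` ?S" using a bij_betw_imp_surj_on[OF bF] by simp
      then have 1: "inv_into ?S F a \<in> ?S" "F (inv_into ?S F a) = a"
        by (rule inv_into_into, rule f_inv_into_f)
      have "inv_into ?S F a \<in> G ` ?S" using 1(1) bij_betw_imp_surj_on[OF bG] by simp
      then have 2: "c \<in> ?S" "G c = inv_into ?S F a"
        unfolding c_def by (rule inv_into_into, rule f_inv_into_f)
      have "compose ?S F G c = a" using 1 2 by (simp add: compose_def)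
      moreover have "inj_on (compose ?S F G) ?S"
        using compose_Bij[OF FB GB] by (auto simp: Bij_def bij_betw_def)
      ultimately have "c = inv_into ?S (compose ?S F G) a"
        using inv_into_f_f[of "compose ?S F G" ?S c] 2(1) by simp
      then show "inv_into ?S G (inv_into ?S F a) = inv_into ?S (compose ?S F G) a"
        by (simp only: c_def)
    qed
    ultimately show "F \<otimes>\<^bsub>BijGroup ?S\<^esub> G \<in> ?C"
      using compose_Bij[OF FB GB] FB GB by (simp add: carrier_Aut_affine BijGroup_def)
  qed
  from subgroup.subgroup_is_group[OF this group_BijGroup]
  have "group (BijGroup ?S\<lparr>carrier := ?C\<rparr>)" .
  then show ?thesis by (simp add: Aut_affine_def)
qed

lemma Aut_affine_length: "F \<in> carrier (Aut_affine n) \<Longrightarrow> length a = n \<Longrightarrow> length (F a) = n"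
  by (auto simp: carrier_Aut_affine polymap_def)

lemma Aut_affine_mult_apply:
  "F \<in> carrier (Aut_affine n) \<Longrightarrow> G \<in> carrier (Aut_affine n) \<Longrightarrow> length a = n \<Longrightarrow>
     (F \<otimes>\<^bsub>Aut_affine n\<^esub> G) a = F (G a)"
  by (simp add: mult_Aut_affine compose_def)

lemma Aut_affine_one_apply: "length a = n \<Longrightarrow> \<one>\<^bsub>Aut_affine n\<^esub> a = a"
  by (simp add: one_Aut_affine)

lemma Aut_affine_eqI:
  assumes "F \<in> carrier (Aut_affine n)" "G \<in> carrier (Aut_affine n)"
    "\<And>a. length a = n \<Longrightarrow> F a = G a"
  shows "F = G"
  by (rule extensionalityI[of _ "affine_space n"])
     (use assms in \<open>auto simp: carrier_Aut_affine Bij_def\<close>)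

lemma Aut_affine_inv_apply:
  fixes F :: "'k::field list \<Rightarrow> 'k list"
  assumes "F \<in> carrier (Aut_affine n)" "length a = n"
  shows "(inv\<^bsub>Aut_affine n\<^esub> F) (F a) = a" "F ((inv\<^bsub>Aut_affine n\<^esub> F) a) = a"
proof -
  interpret group "Aut_affine n :: ('k list \<Rightarrow> 'k list) monoid" by (rule group_Aut_affine)
  show "(inv\<^bsub>Aut_affine n\<^esub> F) (F a) = a"
    using Aut_affine_mult_apply[OF inv_closed[OF assms(1)] assms] l_inv[OF assms(1)]
      Aut_affine_one_apply[OF assms(2)] by simp
  show "F ((inv\<^bsub>Aut_affine n\<^esub> F) a) = a"
    using Aut_affine_mult_apply[OF assms(1) inv_closed[OF assms(1)] assms(2)] r_inv[OF assms(1)]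
      Aut_affine_one_apply[OF assms(2)] by simp
qed

section \<open>The action and the inversion in charts\<close>

lemma algebraic_structureD:
  fixes H :: "('k::field list \<Rightarrow> 'k list) set"
  assumes "algebraic_structure n H X"
  shows "is_variety X" "points X = H"
    "variety_morphism (product_variety X (affine_space_variety n)) (affine_space_variety n) (\<lambda>(F, a). F a)"
    "variety_morphism X X (\<lambda>g. inv\<^bsub>Aut_affine n\<lparr>carrier := H\<rparr>\<^esub> g)"
  using assms unfolding algebraic_structure_def algebraic_group_def by auto

lemma chart_inv_product_chart:
  assumes "inj_on (chart_coord c) (chart_dom c)" "inj_on (chart_coord d) (chart_dom d)"
    "\<And>x. x \<in> chart_dom c \<Longrightarrow> length (chart_coord c x) = chart_dim c"
    "x \<in> chart_dom c" "y \<in> chart_dom d"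
  shows "chart_inv (product_chart c d) (chart_coord c x @ chart_coord d y) = (x, y)"
proof -
  have "inj_on (chart_coord (product_chart c d)) (chart_dom (product_chart c d))"
    using assms(1-3) by (auto simp: inj_on_def product_chart_def)
  from inv_into_f_f[OF this, of "(x, y)"] assms(4,5) show ?thesis by (simp add: product_chart_def)
qed

text \<open>The morphism condition for the action, read in the product of a chart with the one chart
  of affine space. As the target has a single chart, the preimage of that chart is the whole
  product.\<close>

lemma action_regular:
  fixes H :: "('k::field list \<Rightarrow> 'k list) set"
  assumes alg: "algebraic_structure n H X" and H: "H \<subseteq> carrier (Aut_affine n)"
    and c: "c \<in> charts X" and i: "i < n"
  shows "regular_function (chart_dim c + n) {u @ a | u a. u \<in> chart_image c \<and> length a = n}
    (\<lambda>w. chart_inv c (take (chart_dim c) w) (drop (chart_dim c) w) ! i)"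
proof -
  note X = algebraic_structureD[OF alg]
  define ac :: "('k list, 'k) chart" where
    "ac = \<lparr>chart_dom = affine_space n, chart_dim = n, chart_coord = (\<lambda>a. a)\<rparr>"
  let ?pc = "product_chart c ac" and ?f = "\<lambda>(F, a). F a :: 'k list"
  have dom: "chart_dom c \<subseteq> H" using is_varietyD(2)[OF X(1)] c X(2) by blast
  have "?pc \<in> charts (product_variety X (affine_space_variety n))"
    using c by (auto simp: product_variety_def affine_space_variety_def ac_def)
  moreover have "ac \<in> charts (affine_space_variety n)" by (simp add: affine_space_variety_def ac_def)
  ultimately have reg: "regular_map (chart_dim ?pc) (chart_coord ?pc ` (chart_dom ?pc \<inter> ?f -` chart_dom ac))
      (chart_dim ac) (chart_coord ac \<circ> ?f \<circ> chart_inv ?pc)"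
    using X(3) unfolding variety_morphism_def by blast
  have "chart_dom ?pc \<inter> ?f -` chart_dom ac = chart_dom c \<times> affine_space n"
    using dom H Aut_affine_length by (fastforce simp: product_chart_def ac_def)
  moreover have "chart_coord ?pc ` (chart_dom c \<times> affine_space n) =
      {u @ a | u a. u \<in> chart_image c \<and> length a = n}"
    by (force simp: product_chart_def ac_def image_iff)
  moreover have "chart_dim ?pc = chart_dim c + n" "chart_dim ac = n"
    by (simp_all add: product_chart_def ac_def)
  ultimately have "regular_function (chart_dim c + n) {u @ a | u a. u \<in> chart_image c \<and> length a = n}
      (\<lambda>w. (chart_coord ac \<circ> ?f \<circ> chart_inv ?pc) w ! i)"
    using reg i unfolding regular_map_def by simp
  then show ?thesis
  proof (rule regular_function_cong)
    fix w assume "w \<in> {u @ a | u a. u \<in> chart_image c \<and> length a = n}"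
    then obtain x a where x: "x \<in> chart_dom c" "length a = n" "w = chart_coord c x @ a" by blast
    have len: "length (chart_coord c y) = chart_dim c" if "y \<in> chart_dom c" for y
      using chart_image_affine[OF X(1) c] that by auto
    have "chart_inv ?pc w = (x, a)"
      using chart_inv_product_chart[OF is_varietyD(3)[OF X(1) c], of ac x a] x len
      by (simp add: ac_def)
    then show "(chart_coord ac \<circ> ?f \<circ> chart_inv ?pc) w ! i =
        chart_inv c (take (chart_dim c) w) (drop (chart_dim c) w) ! i"
      using x len chart_inv_coord[OF X(1) c] by (simp add: ac_def)
  qed
qed

lemma regular_on_cong:
  assumes "is_variety X" "regular_on X f" "\<And>x. x \<in> points X \<Longrightarrow> f x = g x"
  shows "regular_on X g"
  unfolding regular_on_def
proof
  fix c assume c: "c \<in> charts X"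
  then have "chart_dom c \<subseteq> points X" using is_varietyD(2)[OF assms(1)] by blast
  then have "f (chart_inv c a) = g (chart_inv c a)" if "a \<in> chart_image c" for a
    using that assms(3) inv_into_into[of a "chart_coord c" "chart_dom c"] by blast
  then show "regular_function (chart_dim c) (chart_image c) (\<lambda>a. g (chart_inv c a))"
    using assms(2) c by (auto simp: regular_on_def intro: regular_function_cong)
qed

lemma regular_on_apply:
  fixes H :: "('k::field list \<Rightarrow> 'k list) set"
  assumes alg: "algebraic_structure n H X" and H: "H \<subseteq> carrier (Aut_affine n)"
    and i: "i < n" and a: "length a = n"
  shows "regular_on X (\<lambda>F. F a ! i)"
  unfolding regular_on_def
proof
  fix c assume c: "c \<in> charts X"
  note CA = chart_image_affine[OF algebraic_structureD(1)[OF alg] c]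
  let ?W = "{u @ a | u a. u \<in> chart_image c \<and> length a = n}"
  have "regular_function (chart_dim c) (chart_image c)
      (\<lambda>u. chart_inv c (take (chart_dim c) (u @ a)) (drop (chart_dim c) (u @ a)) ! i)"
  proof (rule regular_function_polymap[OF CA _ action_regular[OF alg H c i]])
    show "?W \<subseteq> affine_space (chart_dim c + n)" using CA by auto
    show "polymap (chart_dim c) (chart_dim c + n) (\<lambda>u. u @ a)" by (rule polymap_append_right[OF a])
    show "u @ a \<in> ?W" if "u \<in> chart_image c" for u using that a by blast
  qed
  then show "regular_function (chart_dim c) (chart_image c) (\<lambda>u. chart_inv c u a ! i)"
    by (rule regular_function_cong) (use CA in auto)
qed

text \<open>Here the group structure of the variety enters: inversion is a morphism, so the values
  of the inverse are regular as well. This puts the second half of the code on a par with the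
  first.\<close>

lemma regular_on_inv_apply:
  fixes H :: "('k::field list \<Rightarrow> 'k list) set"
  assumes alg: "algebraic_structure n H X" and H: "subgroup H (Aut_affine n)"
    and i: "i < n" and a: "length a = n"
  shows "regular_on X (\<lambda>F. (inv\<^bsub>Aut_affine n\<^esub> F) a ! i)"
proof -
  note X = algebraic_structureD[OF alg]
  have "regular_on X (\<lambda>F. F a ! i)"
    by (rule regular_on_apply[OF alg subgroup.subset[OF H] i a])
  from regular_on_morphism[OF X(1) X(1) X(4) this] show ?thesis
    by (rule regular_on_cong[OF X(1)])
       (simp add: X(2) group.m_inv_consistent[OF group_Aut_affine H])
qed

subsection \<open>Bounded degrees\<close>

text \<open>The total degree of a polynomial function, measured on lines through the origin.
  Univariate restrictions admit cancelling a common factor, which is how a degree bound is obtained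
  from a fraction.\<close>

definition line_degree_le :: "nat \<Rightarrow> nat \<Rightarrow> ('k::comm_ring_1 list \<Rightarrow> 'k) \<Rightarrow> bool" where
  "line_degree_le n D f \<longleftrightarrow> (\<forall>v. length v = n \<longrightarrow>
     (\<exists>r. degree r \<le> D \<and> (\<forall>t. poly r t = f (map ((*) t) v))))"

lemma line_degree_le_mono: "line_degree_le n D f \<Longrightarrow> D \<le> E \<Longrightarrow> line_degree_le n E f"
  unfolding line_degree_le_def by (metis order_trans)

lemma poly_eqI_alg_closed:
  fixes p q :: "'k::alg_closed_field poly"
  assumes "\<And>t. poly p t = poly q t"
  shows "p = q"
  using poly_nonzero_exists[of "p - q"] assms by auto

lemma map_mult_0: "map ((*) (0::'k::mult_zero)) v = replicate (length v) 0"
  by (induction v) auto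

text \<open>Near a point, the action is a quotient \<open>p / q\<close>; on lines through the origin this bounds the
  degree of an automorphism by that of \<open>p\<close>.\<close>

lemma action_locally_bounded:
  fixes H :: "('k::alg_closed_field list \<Rightarrow> 'k list) set"
  assumes alg: "algebraic_structure n H X" and H: "H \<subseteq> carrier (Aut_affine n)"
    and c: "c \<in> charts X" and i: "i < n" and u: "u \<in> chart_image c"
  shows "\<exists>s D. polyfun (chart_dim c) s \<and> s u \<noteq> 0 \<and>
    (\<forall>u'\<in>chart_image c. s u' \<noteq> 0 \<longrightarrow> line_degree_le n D (\<lambda>a. chart_inv c u' a ! i))"
proof -
  let ?m = "chart_dim c"
  define W where "W = {u @ a | u a. u \<in> chart_image c \<and> length a = n}"
  have W: "u @ a \<in> W" if "u \<in> chart_image c" "length a = n" for u a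
    using that unfolding W_def by blast
  note X = algebraic_structureD[OF alg]
  note CA = chart_image_affine[OF X(1) c]
  define z :: "'k list" where "z = replicate n 0"
  have WA: "W \<subseteq> affine_space (?m + n)" using CA by (auto simp: W_def)
  have zW: "u @ z \<in> W" using u by (intro W) (auto simp: z_def)
  define f where "f w = chart_inv c (take ?m w) (drop ?m w) ! i" for w
  have "regular_function (?m + n) W f"
    using action_regular[OF alg H c i] unfolding W_def f_def .
  from regular_functionE[OF this WA zW]
  obtain p q where pq: "polyfun (?m + n) p" "polyfun (?m + n) q" "q (u @ z) \<noteq> 0"
    "\<And>w. w \<in> W \<Longrightarrow> q w \<noteq> 0 \<Longrightarrow> f w * q w = p w" by metis
  obtain D where D: "\<And>x v. length x = ?m \<Longrightarrow> length v = n \<Longrightarrow>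
      \<exists>r. degree r \<le> D \<and> (\<forall>t. poly r t = p (x @ map ((*) t) v))"
    using polyfun_line[OF pq(1)] by blast
  obtain E where E: "\<And>x v. length x = ?m \<Longrightarrow> length v = n \<Longrightarrow>
      \<exists>r. degree r \<le> E \<and> (\<forall>t. poly r t = q (x @ map ((*) t) v))"
    using polyfun_line[OF pq(2)] by blast
  have "line_degree_le n D (\<lambda>a. chart_inv c u' a ! i)" if u': "u' \<in> chart_image c" "q (u' @ z) \<noteq> 0" for u'
    unfolding line_degree_le_def
  proof (intro allI impI)
    fix v :: "'k list" assume v: "length v = n"
    have len: "length u' = ?m" using CA u'(1) by auto
    have "chart_inv c u' \<in> H"
      using is_varietyD(2)[OF X(1)] c X(2) inv_into_into[OF u'(1)] by blast
    then have "polymap n n (chart_inv c u')" using H by (auto simp: carrier_Aut_affine)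
    \<comment> \<open>The parameter part is empty. The degree obtained here depends on
      \<open>u'\<close>; only the existence of the polynomial \<open>R\<close> is taken from
      it.\<close>
    then have "polyfun (0 + n) (\<lambda>a. chart_inv c u' a ! i)" using i by (simp add: polymap_def)
    then obtain D' where "\<And>x v. length x = 0 \<Longrightarrow> length v = n \<Longrightarrow>
      \<exists>r. degree r \<le> D' \<and> (\<forall>t. poly r t = chart_inv c u' (x @ map ((*) t) v) ! i)"
      by (rule polyfun_line) blast
    from this[of "[]", OF _ v] obtain R where R: "\<And>t. poly R t = chart_inv c u' (map ((*) t) v) ! i"
      by auto
    obtain P where P: "degree P \<le> D" "\<And>t. poly P t = p (u' @ map ((*) t) v)"
      using D[OF len v] by blast
    obtain Q where Q: "\<And>t. poly Q t = q (u' @ map ((*) t) v)"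
      using E[OF len v] by blast
    have "poly Q 0 \<noteq> 0" using Q[of 0] u'(2) v by (simp add: map_mult_0 z_def)
    then have "Q \<noteq> 0" by auto
    \<comment> \<open>The second factor \<open>Q\<close> makes both sides vanish at the zeros of
      \<open>Q\<close>, where the fraction gives no information; it is cancelled afterwards.\<close>
    have "(R * Q) * Q = P * Q"
    proof (rule poly_eqI_alg_closed)
      fix t
      show "poly ((R * Q) * Q) t = poly (P * Q) t"
      proof (cases "poly Q t = 0")
        case False
        let ?w = "u' @ map ((*) t) v"
        have "?w \<in> W" using u'(1) v by (intro W) auto
        then have "chart_inv c u' (map ((*) t) v) ! i * q ?w = p ?w"
          using pq(4)[of ?w] False Q[of t] len by (simp add: f_def)
        then show ?thesis by (simp add: R P(2) Q)
      qed simp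
    qed
    then have "R * Q = P" using \<open>Q \<noteq> 0\<close> by simp
    then have "degree R \<le> D"
      using P(1) \<open>Q \<noteq> 0\<close> by (cases "R = 0") (auto simp: degree_mult_eq)
    then show "\<exists>r. degree r \<le> D \<and> (\<forall>t. poly r t = chart_inv c u' (map ((*) t) v) ! i)"
      using R by blast
  qed
  moreover have "polyfun ?m (\<lambda>u. q (u @ z))"
    by (rule polyfun_compose[OF pq(2) polymap_append_right]) (simp add: z_def)
  ultimately show ?thesis using pq(3) by (intro exI[of _ "\<lambda>u. q (u @ z)"] exI[of _ D]) blast
qed

lemma finite_common_bound:
  assumes "finite A" "\<And>x. x \<in> A \<Longrightarrow> \<exists>D::nat. P x D" "\<And>x D E. P x D \<Longrightarrow> D \<le> E \<Longrightarrow> P x E"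
  shows "\<exists>D. \<forall>x\<in>A. P x D"
proof -
  obtain d where d: "\<And>x. x \<in> A \<Longrightarrow> P x (d x)" using assms(2) by metis
  have "P x (sum d A)" if "x \<in> A" for x
    by (rule assms(3)[OF d[OF that]]) (use that assms(1) in \<open>auto intro: member_le_sum\<close>)
  then show ?thesis by blast
qed

text \<open>Each local bound holds where some function is nonzero; finitely many such functions
  suffice on a chart, and the atlas is finite.\<close>

lemma algebraic_subgroup_bounded:
  fixes H :: "('k::alg_closed_field list \<Rightarrow> 'k list) set"
  assumes alg: "algebraic_structure n H X" and H: "H \<subseteq> carrier (Aut_affine n)"
  shows "\<exists>D. \<forall>F\<in>H. \<forall>i<n. line_degree_le n D (\<lambda>a. F a ! i)"
proof -
  note X = algebraic_structureD[OF alg]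
  have chart: "\<exists>D. \<forall>u\<in>chart_image c. line_degree_le n D (\<lambda>a. chart_inv c u a ! i)"
    if c: "c \<in> charts X" and i: "i < n" for c i
  proof -
    define Q where "Q = {s. \<exists>D. \<forall>u\<in>chart_image c. s u \<noteq> (0::'k) \<longrightarrow>
        line_degree_le n D (\<lambda>a. chart_inv c u a ! i)}"
    have "\<exists>s\<in>Q. polyfun (chart_dim c) s \<and> s u \<noteq> 0" if "u \<in> chart_image c" for u
      using action_locally_bounded[OF alg H c i that] unfolding Q_def by blast
    then obtain Q' where Q': "finite Q'" "Q' \<subseteq> Q" "\<And>u. u \<in> chart_image c \<Longrightarrow> \<exists>q\<in>Q'. q u \<noteq> 0"
      using finite_nonvanishing_cover[OF chart_image_affine[OF X(1) c], of Q] by metis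
    have "\<exists>D. \<forall>s\<in>Q'. \<forall>u\<in>chart_image c. s u \<noteq> 0 \<longrightarrow> line_degree_le n D (\<lambda>a. chart_inv c u a ! i)"
    proof (rule finite_common_bound[OF Q'(1)])
      show "\<exists>D. \<forall>u\<in>chart_image c. s u \<noteq> 0 \<longrightarrow> line_degree_le n D (\<lambda>a. chart_inv c u a ! i)"
        if "s \<in> Q'" for s
        using that Q'(2) unfolding Q_def by blast
    qed (blast intro: line_degree_le_mono)
    then show ?thesis using Q'(3) by metis
  qed
  have "\<exists>D. \<forall>ci\<in>charts X \<times> {..<n}. \<forall>u\<in>chart_image (fst ci).
      line_degree_le n D (\<lambda>a. chart_inv (fst ci) u a ! snd ci)"
  proof (rule finite_common_bound)
    show "finite (charts X \<times> {..<n})" using is_varietyD(1)[OF X(1)] by simp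
    show "\<exists>D. \<forall>u\<in>chart_image (fst ci). line_degree_le n D (\<lambda>a. chart_inv (fst ci) u a ! snd ci)"
      if "ci \<in> charts X \<times> {..<n}" for ci
      using chart[of "fst ci" "snd ci"] that by (auto simp: mem_Times_iff)
  qed (blast intro: line_degree_le_mono)
  then obtain D where D: "\<And>c i u. c \<in> charts X \<Longrightarrow> i < n \<Longrightarrow> u \<in> chart_image c \<Longrightarrow>
      line_degree_le n D (\<lambda>a. chart_inv c u a ! i)" by auto
  have "line_degree_le n D (\<lambda>a. F a ! i)" if F: "F \<in> H" and i: "i < n" for F i
  proof -
    obtain c where c: "c \<in> charts X" "F \<in> chart_dom c" using F is_varietyD(2)[OF X(1)] X(2) by blast
    from D[OF c(1) i imageI[OF c(2)]] show ?thesis by (simp add: chart_inv_coord[OF X(1) c])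
  qed
  then show ?thesis by blast
qed

section \<open>From degrees on lines to weighted degrees\<close>

lemma eval_monom_scale:
  assumes "Poly_Mapping.keys \<kappa> \<subseteq> {..<n}" "length v = n"
  shows "eval_monom \<kappa> (map ((*) t) v) =
    t ^ (\<Sum>j<n. Poly_Mapping.lookup \<kappa> j) * eval_monom \<kappa> (v :: 'k::comm_ring_1 list)"
proof -
  have "eval_monom \<kappa> (map ((*) t) v) = (\<Prod>j<n. (map ((*) t) v ! j) ^ Poly_Mapping.lookup \<kappa> j)"
    using assms by (intro eval_monom_superset) auto
  also have "\<dots> = (\<Prod>j<n. t ^ Poly_Mapping.lookup \<kappa> j * (v ! j) ^ Poly_Mapping.lookup \<kappa> j)"
    by (intro prod.cong refl) (simp add: assms(2) power_mult_distrib)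
  also have "\<dots> = t ^ (\<Sum>j<n. Poly_Mapping.lookup \<kappa> j) * eval_monom \<kappa> v"
    using assms eval_monom_superset[of "{..<n}" \<kappa> v] by (simp add: prod.distrib power_sum)
  finally show ?thesis .
qed

text \<open>On the line through \<open>v\<close> the monomials of total degree \<open>j\<close> make
  up the coefficient of \<open>t ^ j\<close>. These coefficients vanish for \<open>j > D\<close>,
  and \<open>t = 1\<close> gives the claim. Dropping monomials keeps the triangular shape of a
  component intact.\<close>

lemma eval_truncate_degree:
  fixes f :: "'k::alg_closed_field mpoly"
  assumes f: "f \<in> poly_ring n" and D: "line_degree_le n D (eval f)"
  defines "K \<equiv> {\<kappa> \<in> Poly_Mapping.keys f. (\<Sum>j<n. Poly_Mapping.lookup \<kappa> j) \<le> D}"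
  assumes v: "length v = n"
  shows "eval f v = eval (\<Sum>\<kappa>\<in>K. Poly_Mapping.single \<kappa> (Poly_Mapping.lookup f \<kappa>)) v"
proof -
  let ?d = "\<lambda>\<kappa>. \<Sum>j<n. Poly_Mapping.lookup \<kappa> j"
  let ?c = "\<lambda>\<kappa>. Poly_Mapping.lookup f \<kappa> * eval_monom \<kappa> v"
  obtain r where r: "degree r \<le> D" "\<And>t. poly r t = eval f (map ((*) t) v)"
    using D v unfolding line_degree_le_def by blast
  have "r = (\<Sum>\<kappa>\<in>Poly_Mapping.keys f. monom (?c \<kappa>) (?d \<kappa>))"
  proof (rule poly_eqI_alg_closed)
    fix t
    have "poly r t = (\<Sum>\<kappa>\<in>Poly_Mapping.keys f. Poly_Mapping.lookup f \<kappa> * eval_monom \<kappa> (map ((*) t) v))"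
      by (simp add: r(2) eval_def)
    also have "\<dots> = (\<Sum>\<kappa>\<in>Poly_Mapping.keys f. ?c \<kappa> * t ^ ?d \<kappa>)"
    proof (intro sum.cong refl)
      fix \<kappa> assume "\<kappa> \<in> Poly_Mapping.keys f"
      then have "Poly_Mapping.keys \<kappa> \<subseteq> {..<n}" using f by (auto simp: poly_ring_def)
      from eval_monom_scale[OF this v]
      show "Poly_Mapping.lookup f \<kappa> * eval_monom \<kappa> (map ((*) t) v) = ?c \<kappa> * t ^ ?d \<kappa>"
        by (simp add: mult_ac)
    qed
    finally show "poly r t = poly (\<Sum>\<kappa>\<in>Poly_Mapping.keys f. monom (?c \<kappa>) (?d \<kappa>)) t"
      by (simp add: poly_sum poly_monom)
  qed
  then have coeff: "coeff r j = (\<Sum>\<kappa>\<in>{\<kappa> \<in> Poly_Mapping.keys f. ?d \<kappa> = j}. ?c \<kappa>)" for j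
    by (simp add: coeff_sum sum.If_cases Int_def)
  have "map ((*) 1) v = v" by (simp add: map_idI)
  then have "eval f v = poly r 1" using r(2)[of 1] by simp
  also have "\<dots> = (\<Sum>j\<le>D. coeff r j)"
    using r(1) by (simp add: poly_altdef) (intro sum.mono_neutral_left, auto simp: coeff_eq_0)
  also have "\<dots> = (\<Sum>j\<le>D. \<Sum>\<kappa>\<in>{\<kappa> \<in> K. ?d \<kappa> = j}. ?c \<kappa>)"
    unfolding coeff by (intro sum.cong refl arg_cong2[of _ _ _ _ sum]) (auto simp: K_def)
  also have "\<dots> = (\<Sum>\<kappa>\<in>K. ?c \<kappa>)"
    by (rule sum.group) (auto simp: K_def)
  also have "\<dots> = eval (\<Sum>\<kappa>\<in>K. Poly_Mapping.single \<kappa> (Poly_Mapping.lookup f \<kappa>)) v"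
    by (simp add: eval_sum eval_single)
  finally show ?thesis .
qed

text \<open>For \<open>i > 0\<close> a monomial of \<open>h\<close> of total degree at most
  \<open>D\<close> is a product of at most \<open>D\<close> variables of index below
  \<open>i\<close>, each of weight at most \<open>D ^ (i - 1)\<close>; the remaining term is the
  variable of weight \<open>D ^ i\<close> itself. The representing polynomial is the truncation
  \<open>g\<close>, whose monomials are among those of \<open>fs ! i\<close>.\<close>

lemma triangular_weighted_degree:
  fixes F :: "'k::alg_closed_field list \<Rightarrow> 'k list"
  assumes tri: "triangular n F" and i: "i < n" and D: "D \<ge> 1"
    and deg: "line_degree_le n D (\<lambda>a. F a ! i)"
  shows "wpolyfun n (\<lambda>j. D ^ j) (D ^ i) (\<lambda>a. F a ! i)"
proof -
  obtain fs l h where fs: "length fs = n" "set fs \<subseteq> poly_ring n"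
    "\<And>a. length a = n \<Longrightarrow> F a = map (\<lambda>f. eval f a) fs" and
    h: "h \<in> poly_ring i" "fs ! i = Poly_Mapping.single (Poly_Mapping.single i 1) l + h"
    using tri i unfolding triangular_def coordinate_tuple_def by auto
  define f where "f = fs ! i"
  define K where "K = {\<kappa> \<in> Poly_Mapping.keys f. (\<Sum>j<n. Poly_Mapping.lookup \<kappa> j) \<le> D}"
  define g where "g = (\<Sum>\<kappa>\<in>K. Poly_Mapping.single \<kappa> (Poly_Mapping.lookup f \<kappa>))"
  have f: "f \<in> poly_ring n" using fs(1,2) i by (auto simp: f_def)
  have Ff: "F a ! i = eval f a" if "length a = n" for a using fs(1,3) i that by (simp add: f_def)
  then have "line_degree_le n D (eval f)"
    using deg by (simp add: line_degree_le_def)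
  from eval_truncate_degree[OF f this] have "F a ! i = eval g a" if "length a = n" for a
    using that Ff by (simp add: g_def K_def)
  moreover have "Poly_Mapping.keys g \<subseteq> wmonoms n (\<lambda>j. D ^ j) (D ^ i)"
  proof
    fix \<kappa> assume "\<kappa> \<in> Poly_Mapping.keys g"
    moreover have "Poly_Mapping.keys g \<subseteq> (\<Union>\<kappa>\<in>K. Poly_Mapping.keys (Poly_Mapping.single \<kappa> (Poly_Mapping.lookup f \<kappa>)))"
      unfolding g_def by (rule Poly_Mapping.keys_sum)
    ultimately have "\<kappa> \<in> K" by (auto split: if_splits)
    then have \<kappa>: "\<kappa> \<in> Poly_Mapping.keys f" "(\<Sum>j<n. Poly_Mapping.lookup \<kappa> j) \<le> D" by (auto simp: K_def)
    have kn: "Poly_Mapping.keys \<kappa> \<subseteq> {..<n}" using f \<kappa>(1) by (auto simp: poly_ring_def)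
    have "\<kappa> = Poly_Mapping.single i 1 \<or> \<kappa> \<in> Poly_Mapping.keys h"
      using \<kappa>(1) Poly_Mapping.keys_add[of "Poly_Mapping.single (Poly_Mapping.single i 1) l" h] h(2)
      by (auto simp: f_def split: if_splits)
    then have "(\<Sum>j<n. D ^ j * Poly_Mapping.lookup \<kappa> j) \<le> D ^ i"
    proof
      assume "\<kappa> = Poly_Mapping.single i 1"
      then show ?thesis using i
        by (simp add: lookup_single when_def if_distrib[of "\<lambda>x. D ^ _ * x"] cong: if_cong)
    next
      assume "\<kappa> \<in> Poly_Mapping.keys h"
      then have ki: "Poly_Mapping.keys \<kappa> \<subseteq> {..<i}" using h(1) by (auto simp: poly_ring_def)
      show ?thesis
      proof (cases i)
        case 0
        then have "Poly_Mapping.lookup \<kappa> j = 0" for j using ki by (auto simp: in_keys_iff)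
        then show ?thesis by simp
      next
        case (Suc i')
        have "(\<Sum>j<n. D ^ j * Poly_Mapping.lookup \<kappa> j) \<le> (\<Sum>j<n. D ^ i' * Poly_Mapping.lookup \<kappa> j)"
        proof (rule sum_mono)
          fix j
          show "D ^ j * Poly_Mapping.lookup \<kappa> j \<le> D ^ i' * Poly_Mapping.lookup \<kappa> j"
          proof (cases "j < i")
            case True
            then show ?thesis using D Suc by (intro mult_right_mono power_increasing) auto
          next
            case False
            then have "Poly_Mapping.lookup \<kappa> j = 0" using ki by (auto simp: in_keys_iff)
            then show ?thesis by simp
          qed
        qed
        also have "\<dots> = D ^ i' * (\<Sum>j<n. Poly_Mapping.lookup \<kappa> j)" by (simp add: sum_distrib_left)
        also have "\<dots> \<le> D ^ i' * D" using \<kappa>(2) by (rule mult_le_mono2)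
        finally show ?thesis using Suc by (simp add: mult.commute)
      qed
    qed
    then show "\<kappa> \<in> wmonoms n (\<lambda>j. D ^ j) (D ^ i)" using kn by (simp add: wmonoms_def)
  qed
  ultimately show ?thesis unfolding wpolyfun_def by auto
qed

section \<open>Varieties with a single chart\<close>

definition closed_variety :: "'x set \<Rightarrow> nat \<Rightarrow> ('x \<Rightarrow> 'k list) \<Rightarrow> ('x, 'k) variety" where
  "closed_variety D m \<phi> = \<lparr>points = D, charts = {\<lparr>chart_dom = D, chart_dim = m, chart_coord = \<phi>\<rparr>}\<rparr>"

lemma regular_map_polymap:
  fixes W :: "'k::field list set"
  assumes "W \<subseteq> affine_space m" "polymap m k G" "\<And>a. a \<in> W \<Longrightarrow> F a = G a"
  shows "regular_map m W k F"
  unfolding regular_map_def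
proof (intro conjI ballI allI impI)
  fix a assume "a \<in> W"
  then show "F a \<in> affine_space k" using assms polymap_length[OF assms(2), of a] by auto
next
  fix i assume "i < k"
  then have "polyfun m (\<lambda>a. G a ! i)" using assms(2) by (simp add: polymap_def)
  from regular_function_polyfun[OF assms(1) this]
  show "regular_function m W (\<lambda>a. F a ! i)"
    by (rule regular_function_cong) (simp add: assms(3))
qed

text \<open>Separation holds because the diagonal is cut out by the equality of the two halves
  together with membership of one half in the closed image.\<close>

lemma is_variety_closed_variety:
  fixes \<phi> :: "'x \<Rightarrow> 'k::field list"
  assumes inj: "inj_on \<phi> D" and cl: "closedin (zariski m) (\<phi> ` D)"
  shows "is_variety (closed_variety D m \<phi>)"
proof -
  have W: "\<phi> ` D \<subseteq> affine_space m" using closedin_subset[OF cl] by simp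
  let ?S = "(\<lambda>x. \<phi> x @ \<phi> x) ` D"
  have SA: "?S \<subseteq> affine_space (m + m)" using W by auto
  have "zcl (m + m) ?S \<subseteq> ?S"
  proof
    fix w assume w: "w \<in> zcl (m + m) ?S"
    have eq: "take m w = drop m w"
      by (rule zcl_polymap_eq[OF polymap_take polymap_drop _ w]) (use W in auto)
    have "take m w \<in> zcl m (\<phi> ` D)"
    proof (rule zcl_polymap[OF polymap_take w])
      fix s assume "s \<in> ?S"
      then have "take m s \<in> \<phi> ` D" using W by auto
      then show "take m s \<in> zcl m (\<phi> ` D)" using zcl_superset[OF W] by blast
    qed simp
    then obtain x where x: "x \<in> D" "take m w = \<phi> x"
      using closedin_zariski_zcl[OF cl] by auto
    have "w = take m w @ drop m w" by simp
    then have "w = \<phi> x @ \<phi> x" using eq x(2) by simp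
    then show "w \<in> ?S" using x(1) by blast
  qed
  then have "zcl (m + m) ?S = ?S" using zcl_superset[OF SA] by blast
  then have "closedin (zariski (m + m)) ?S" using closedin_zcl[OF SA] by simp
  moreover have "regular_map m (\<phi> ` D) m (\<phi> \<circ> inv_into D \<phi>)"
    by (rule regular_map_polymap[OF W polymap_id]) (auto simp: inj)
  ultimately show ?thesis
    using inj cl W by (simp add: is_variety_def closed_variety_def openin_subtopology_refl)
qed

lemma variety_morphism_single_chart:
  fixes X :: "('x, 'k::field) variety" and Y :: "('y, 'k) variety"
  assumes X: "charts X = {c}" "points X = chart_dom c" and Y: "charts Y = {d}" "points Y = chart_dom d"
    and inj: "inj_on (chart_coord c) (chart_dom c)"
    and W: "\<And>x. x \<in> chart_dom c \<Longrightarrow> length (chart_coord c x) = chart_dim c"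
    and f: "\<And>x. x \<in> chart_dom c \<Longrightarrow> f x \<in> chart_dom d"
    and G: "polymap (chart_dim c) (chart_dim d) G"
      "\<And>x. x \<in> chart_dom c \<Longrightarrow> chart_coord d (f x) = G (chart_coord c x)"
  shows "variety_morphism X Y f"
proof -
  have WA: "chart_image c \<subseteq> affine_space (chart_dim c)" using W by auto
  have "chart_dom c \<inter> f -` chart_dom d = chart_dom c" using f by auto
  moreover have "openin (chart_topology c) (chart_image c)"
    using WA by (simp add: openin_subtopology_refl)
  moreover have "regular_map (chart_dim c) (chart_image c) (chart_dim d) (chart_coord d \<circ> f \<circ> chart_inv c)"
    by (rule regular_map_polymap[OF WA G(1)]) (auto simp: inj G(2))
  ultimately show ?thesis
    unfolding variety_morphism_def X Y using f by auto
qed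

text \<open>Every nonempty open set contains the nonempty nonvanishing locus of some polynomial
  function, and on an irreducible set two such loci always meet.\<close>

lemma connected_closed_variety:
  fixes \<phi> :: "'x \<Rightarrow> 'k::field list"
  assumes inj: "inj_on \<phi> D" and cl: "closedin (zariski m) (\<phi> ` D)" and irr: "irr m (\<phi> ` D)"
  shows "connected_space (variety_topology (closed_variety D m \<phi>))"
  unfolding connected_space_def
proof (rule notI, elim exE conjE)
  let ?X = "closed_variety D m \<phi>"
  note X = is_variety_closed_variety[OF inj cl]
  have W: "\<phi> ` D \<subseteq> affine_space m" using closedin_subset[OF cl] by simp
  fix U V
  assume UV: "openin (variety_topology ?X) U" "openin (variety_topology ?X) V"
    "U \<inter> V = {}" "U \<noteq> {}" "V \<noteq> {}"
  have basic: "\<exists>s. polyfun m s \<and> (\<exists>a\<in>\<phi> ` D. s a \<noteq> 0) \<and> (\<forall>y\<in>D. s (\<phi> y) \<noteq> 0 \<longrightarrow> y \<in> U)"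
    if U: "openin (variety_topology ?X) U" "U \<noteq> {}" for U
  proof -
    have UD: "U \<subseteq> D" and "openin (subtopology (zariski m) (\<phi> ` D)) (\<phi> ` (U \<inter> D))"
      using U(1) unfolding openin_variety_topology[OF X] variety_open_def
      by (auto simp: closed_variety_def)
    then obtain T where T: "openin (zariski m) T" "\<phi> ` (U \<inter> D) = T \<inter> \<phi> ` D"
      by (auto simp: openin_subtopology)
    obtain x where x: "x \<in> U" using U(2) by blast
    then have "\<phi> x \<in> T" using T(2) UD by blast
    obtain s where s: "polyfun m s" "s (\<phi> x) \<noteq> 0" "\<And>b. length b = m \<Longrightarrow> s b \<noteq> 0 \<Longrightarrow> b \<in> T"
      using zariski_basic_open[OF T(1) \<open>\<phi> x \<in> T\<close>] by metis
    have "y \<in> U" if y: "y \<in> D" "s (\<phi> y) \<noteq> 0" for y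
    proof -
      have "\<phi> y \<in> T" using s(3) y W by auto
      then have "\<phi> y \<in> \<phi> ` (U \<inter> D)" using T(2) y(1) by blast
      then show ?thesis using inj y(1) by (auto dest: inj_onD)
    qed
    then show ?thesis using s(1,2) x UD by blast
  qed
  obtain s a where s: "polyfun m s" "a \<in> \<phi> ` D" "s a \<noteq> 0" "\<And>y. y \<in> D \<Longrightarrow> s (\<phi> y) \<noteq> 0 \<Longrightarrow> y \<in> U"
    using basic[OF UV(1,4)] by blast
  obtain t b where t: "polyfun m t" "b \<in> \<phi> ` D" "t b \<noteq> 0" "\<And>y. y \<in> D \<Longrightarrow> t (\<phi> y) \<noteq> 0 \<Longrightarrow> y \<in> V"
    using basic[OF UV(2,5)] by blast
  obtain u where "u \<in> \<phi> ` D" "s u \<noteq> 0" "t u \<noteq> 0"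
    using irrD[OF irr s(1) t(1) s(2,3) t(2,3)] by blast
  then show False using s(4) t(4) UV(3) by blast
qed

section \<open>Coordinates on groups of bounded degree\<close>

text \<open>Interpolation: functions from a finite-dimensional space are determined by their values
  at finitely many points, and the dual functions \<open>L j\<close> reconstruct them. If
  \<open>g k\<close> is not yet reproduced, a point \<open>p\<close> where the error
  \<open>h\<close> is nonzero is added.\<close>

lemma exists_dual_points:
  fixes g :: "'i \<Rightarrow> 'k::field list \<Rightarrow> 'k"
  assumes "finite I" "\<And>k. k \<in> I \<Longrightarrow> polyfun n (g k)"
  shows "\<exists>(r::nat) ps L. (\<forall>j<r. length (ps j) = n \<and> polyfun n (L j)) \<and>
    (\<forall>k\<in>I. \<forall>a. length a = n \<longrightarrow> g k a = (\<Sum>j<r. g k (ps j) * L j a))"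
  using assms
proof (induction I rule: finite_induct)
  case empty
  show ?case by (rule exI[of _ 0]) auto
next
  case (insert k I)
  then obtain r :: nat and ps L where *: "\<forall>j<r. length (ps j) = n \<and> polyfun n (L j)"
    "\<forall>k\<in>I. \<forall>a. length a = n \<longrightarrow> g k a = (\<Sum>j<r. g k (ps j) * L j a)" by blast
  then have IH: "\<And>j. j < r \<Longrightarrow> length (ps j) = n" "\<And>j. j < r \<Longrightarrow> polyfun n (L j)"
    "\<And>k a. k \<in> I \<Longrightarrow> length a = n \<Longrightarrow> g k a = (\<Sum>j<r. g k (ps j) * L j a)" by (blast+)
  define h where "h a = g k a - (\<Sum>j<r. g k (ps j) * L j a)" for a
  show ?case
  proof (cases "\<forall>a. length a = n \<longrightarrow> h a = 0")
    case True
    then have "g k a = (\<Sum>j<r. g k (ps j) * L j a)" if "length a = n" for a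
      using that by (simp add: h_def)
    then show ?thesis using * by (intro exI[of _ r] exI[of _ ps] exI[of _ L]) blast
  next
    case False
    then obtain p where p: "length p = n" "h p \<noteq> 0" by blast
    \<comment> \<open>Normalised to 1 at \<open>p\<close>. The old \<open>L j\<close> are corrected
      by multiples of \<open>R\<close> so as to vanish at \<open>p\<close>; for a function
      reproduced before, the corrections add up to exactly the opposite of the new term.\<close>
    define R where "R a = inverse (h p) * h a" for a
    define ps' where "ps' = ps(r := p)"
    define L' where "L' = (\<lambda>j a. if j < r then L j a - L j p * R a else R a)"
    have "polyfun n h"
      unfolding h_def using insert.prems IH(2) by (auto intro!: polyfun_intros)
    then have R: "polyfun n R" unfolding R_def by (intro polyfun_intros)
    have "polyfun n (L' j)" if "j < Suc r" for j
    proof (cases "j < r")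
      case True
      then have "L' j = (\<lambda>a. L j a - L j p * R a)" by (simp add: L'_def)
      then show ?thesis using IH(2)[OF True] R by (simp add: polyfun_diff polyfun_mult polyfun_const)
    next
      case False
      then have "L' j = R" by (simp add: L'_def)
      then show ?thesis using R by simp
    qed
    moreover have "length (ps' j) = n" if "j < Suc r" for j
      using that IH(1) p(1) by (auto simp: ps'_def less_Suc_eq)
    moreover have "g k' a = (\<Sum>j<Suc r. g k' (ps' j) * L' j a)" if k': "k' \<in> insert k I" and a: "length a = n"
      for k' a
    proof -
      let ?s = "\<lambda>a. \<Sum>j<r. g k' (ps j) * L j a"
      have "(\<Sum>j<Suc r. g k' (ps' j) * L' j a) =
          (\<Sum>j<r. g k' (ps j) * (L j a - L j p * R a)) + g k' p * R a"
        by (simp add: ps'_def L'_def)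
      also have "(\<Sum>j<r. g k' (ps j) * (L j a - L j p * R a)) = ?s a - ?s p * R a"
        by (simp add: right_diff_distrib sum_subtractf sum_distrib_right mult.assoc)
      finally have eq: "(\<Sum>j<Suc r. g k' (ps' j) * L' j a) = ?s a - ?s p * R a + g k' p * R a" .
      show ?thesis
      proof (cases "k' \<in> I")
        case True
        then show ?thesis unfolding eq using IH(3)[OF True a] IH(3)[OF True p(1)] by simp
      next
        case False
        then have "k' = k" using k' by simp
        then have "?s a = g k' a - h a" "?s p = g k' p - h p" by (simp_all add: h_def)
        then show ?thesis unfolding eq using p(2) by (simp add: R_def left_diff_distrib)
      qed
    qed
    ultimately show ?thesis
      by (intro exI[of _ "Suc r"] exI[of _ ps'] exI[of _ L']) blast
  qed
qed

text \<open>The condition is linear in the function, so it suffices to interpolate the monomials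
  within the bound.\<close>

lemma exists_dual_points_wpolyfun:
  assumes "\<And>i. i < n \<Longrightarrow> w i \<ge> 1"
  shows "\<exists>(r::nat) ps L. (\<forall>j<r. length (ps j) = n \<and> polyfun n (L j)) \<and>
    (\<forall>f :: 'k::field list \<Rightarrow> 'k. wpolyfun n w e f \<longrightarrow>
       (\<forall>a. length a = n \<longrightarrow> f a = (\<Sum>j<r. f (ps j) * L j a)))"
proof -
  let ?K = "wmonoms n w e"
  have mono: "polyfun n (eval_monom \<kappa> :: 'k list \<Rightarrow> 'k)" if "\<kappa> \<in> ?K" for \<kappa>
    unfolding eval_monom_def using that
    by (intro polyfun_prod polyfun_power polyfun_nth) (auto simp: wmonoms_def)
  have "finite ?K" using assms by (rule finite_wmonoms(1))
  then have "\<exists>(r::nat) ps (L :: nat \<Rightarrow> 'k list \<Rightarrow> 'k). (\<forall>j<r. length (ps j) = n \<and> polyfun n (L j)) \<and>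
      (\<forall>k\<in>?K. \<forall>a. length a = n \<longrightarrow> eval_monom k a = (\<Sum>j<r. eval_monom k (ps j) * L j a))"
    by (rule exists_dual_points) (rule mono)
  then obtain r :: nat and ps and L :: "nat \<Rightarrow> 'k list \<Rightarrow> 'k" where
    *: "\<forall>j<r. length (ps j) = n \<and> polyfun n (L j)"
    "\<forall>k\<in>?K. \<forall>a. length a = n \<longrightarrow> eval_monom k a = (\<Sum>j<r. eval_monom k (ps j) * L j a)"
    by blast
  have "f a = (\<Sum>j<r. f (ps j) * L j a)" if f: "wpolyfun n w e f" and a: "length a = n"
    for f :: "'k list \<Rightarrow> 'k" and a
  proof -
    obtain c where c: "\<And>a. length a = n \<Longrightarrow> f a = (\<Sum>k\<in>?K. c k * eval_monom k a)"
      using wpolyfunE[OF f assms] by blast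
    have "f a = (\<Sum>k\<in>?K. \<Sum>j<r. c k * eval_monom k (ps j) * L j a)"
      unfolding c[OF a] using *(2) a
      by (intro sum.cong refl) (simp add: sum_distrib_left mult.assoc)
    also have "\<dots> = (\<Sum>j<r. (\<Sum>k\<in>?K. c k * eval_monom k (ps j)) * L j a)"
      by (subst sum.swap) (simp add: sum_distrib_right)
    also have "\<dots> = (\<Sum>j<r. f (ps j) * L j a)"
      using *(1) by (intro sum.cong refl) (simp add: c)
    finally show ?thesis .
  qed
  then show ?thesis using *(1) by (intro exI[of _ r] exI[of _ ps] exI[of _ L]) blast
qed

text \<open>An automorphism is recorded by its values at finitely many points, followed by the values of its
  inverse; \<open>act u\<close> reconstructs the automorphism from the first half of the code \<open>u\<close>.\<close>

locale evaluation_frame =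
  fixes n r :: nat and ps :: "nat \<Rightarrow> 'k::alg_closed_field list" and L :: "nat \<Rightarrow> 'k list \<Rightarrow> 'k"
    and H :: "('k list \<Rightarrow> 'k list) set"
  assumes ps_length: "j < r \<Longrightarrow> length (ps j) = n"
    and L_poly: "j < r \<Longrightarrow> polyfun n (L j)"
    and H: "subgroup H (Aut_affine n)"
    and rep: "F \<in> H \<Longrightarrow> i < n \<Longrightarrow> length a = n \<Longrightarrow> F a ! i = (\<Sum>j<r. F (ps j) ! i * L j a)"
begin

abbreviation "A \<equiv> Aut_affine n :: ('k list \<Rightarrow> 'k list) monoid"
abbreviation "N \<equiv> r * n"
abbreviation "M \<equiv> N + N"

text \<open>Entry \<open>j * n + i\<close> is coordinate \<open>i\<close> of the value at
  \<open>ps j\<close>.\<close>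

definition code :: "('k list \<Rightarrow> 'k list) \<Rightarrow> 'k list" where
  "code F = map (\<lambda>k. F (ps (k div n)) ! (k mod n)) [0..<N]"

definition act :: "'k list \<Rightarrow> 'k list \<Rightarrow> 'k list" where
  "act u a = map (\<lambda>i. \<Sum>j<r. u ! (j * n + i) * L j a) [0..<n]"

definition emb :: "('k list \<Rightarrow> 'k list) \<Rightarrow> 'k list" where
  "emb F = code F @ code (inv\<^bsub>A\<^esub> F)"

text \<open>Defined on arbitrary lists, since it has to be polynomial on the whole space. As
  \<open>act\<close> reads only the first \<open>N\<close> entries, \<open>drop N\<close> selects
  the inverse; the second half composes the inverses in reversed order.\<close>

definition mul :: "'k list \<Rightarrow> 'k list \<Rightarrow> 'k list" where
  "mul u v = code (\<lambda>a. act u (act v a)) @ code (\<lambda>a. act (drop N v) (act (drop N u) a))"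

definition iv :: "'k list \<Rightarrow> 'k list" where
  "iv u = drop N u @ take N u"

lemma carrier: "F \<in> H \<Longrightarrow> F \<in> carrier A"
  using subgroup.mem_carrier[OF H] .

lemma inv_H: "F \<in> H \<Longrightarrow> inv\<^bsub>A\<^esub> F \<in> H"
  using subgroup.m_inv_closed[OF H] .

lemma mult_H: "F \<in> H \<Longrightarrow> G \<in> H \<Longrightarrow> F \<otimes>\<^bsub>A\<^esub> G \<in> H"
  using subgroup.m_closed[OF H] .

lemma length_code [simp]: "length (code F) = N"
  by (simp add: code_def)

lemma length_emb [simp]: "length (emb F) = M"
  by (simp add: emb_def)

lemma pos_if_less: "k < N \<Longrightarrow> n > 0"
  by (cases n) auto

lemma code_index:
  assumes "j < r" "i < n"
  shows "j * n + i < N" "(code F @ v) ! (j * n + i) = F (ps j) ! i"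
proof -
  have "j * n + i < Suc j * n" using assms(2) by simp
  also have "\<dots> \<le> N" using assms(1) by (intro mult_le_mono1) simp
  finally show *: "j * n + i < N" .
  show "(code F @ v) ! (j * n + i) = F (ps j) ! i"
    using * assms(2) by (simp add: nth_append code_def)
qed

lemma code_cong:
  assumes "\<And>a. length a = n \<Longrightarrow> F a = G a" shows "code F = code G"
  unfolding code_def
proof (intro map_cong refl)
  fix k assume "k \<in> set [0..<N]"
  then have "k div n < r" by (simp add: less_mult_imp_div_less)
  then show "F (ps (k div n)) ! (k mod n) = G (ps (k div n)) ! (k mod n)"
    using assms ps_length by simp
qed

lemma act_code:
  assumes "F \<in> H" "length a = n"
  shows "act (code F @ v) a = F a"
proof (rule nth_equalityI)
  show "length (act (code F @ v) a) = length (F a)"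
    using Aut_affine_length[OF carrier] assms by (simp add: act_def)
  fix i assume "i < length (act (code F @ v) a)"
  then have i: "i < n" by (simp add: act_def)
  have "act (code F @ v) a ! i = (\<Sum>j<r. (code F @ v) ! (j * n + i) * L j a)"
    using i by (simp add: act_def)
  also have "\<dots> = (\<Sum>j<r. F (ps j) ! i * L j a)"
    by (intro sum.cong refl) (simp add: code_index(2)[OF _ i])
  also have "\<dots> = F a ! i" using rep[OF assms(1) i assms(2)] by simp
  finally show "act (code F @ v) a ! i = F a ! i" .
qed

lemma act_emb: "F \<in> H \<Longrightarrow> length a = n \<Longrightarrow> act (emb F) a = F a"
  unfolding emb_def by (rule act_code)

lemma act_drop_emb: "F \<in> H \<Longrightarrow> length a = n \<Longrightarrow> act (drop N (emb F)) a = (inv\<^bsub>A\<^esub> F) a"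
  unfolding emb_def using act_code[OF inv_H, of F a "[]"] by simp

lemma emb_inj: "inj_on emb H"
proof (rule inj_onI)
  fix F G assume FG: "F \<in> H" "G \<in> H" "emb F = emb G"
  show "F = G"
  proof (rule Aut_affine_eqI[OF carrier[OF FG(1)] carrier[OF FG(2)]])
    fix a :: "'k list" assume "length a = n"
    then show "F a = G a" using act_emb[OF FG(1), of a] act_emb[OF FG(2), of a] FG(3) by simp
  qed
qed

lemma mul_emb:
  assumes F: "F \<in> H" and G: "G \<in> H"
  shows "mul (emb F) (emb G) = emb (F \<otimes>\<^bsub>A\<^esub> G)"
proof -
  interpret group A by (rule group_Aut_affine)
  have "code (\<lambda>a. act (emb F) (act (emb G) a)) = code (F \<otimes>\<^bsub>A\<^esub> G)"
    by (rule code_cong)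
       (simp add: act_emb F G Aut_affine_length[OF carrier] Aut_affine_mult_apply[OF carrier carrier])
  moreover have "code (\<lambda>a. act (drop N (emb G)) (act (drop N (emb F)) a)) = code (inv\<^bsub>A\<^esub> (F \<otimes>\<^bsub>A\<^esub> G))"
  proof (rule code_cong)
    fix a :: "'k list" assume a: "length a = n"
    have "inv\<^bsub>A\<^esub> (F \<otimes>\<^bsub>A\<^esub> G) = inv\<^bsub>A\<^esub> G \<otimes>\<^bsub>A\<^esub> inv\<^bsub>A\<^esub> F"
      using F G carrier by (simp add: inv_mult_group)
    then show "act (drop N (emb G)) (act (drop N (emb F)) a) = (inv\<^bsub>A\<^esub> (F \<otimes>\<^bsub>A\<^esub> G)) a"
      using a by (simp add: act_drop_emb F G Aut_affine_length[OF carrier] inv_H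
          Aut_affine_mult_apply[OF carrier carrier])
  qed
  ultimately show ?thesis by (simp only: mul_def emb_def[of "F \<otimes>\<^bsub>A\<^esub> G"])
qed

lemma iv_emb:
  assumes F: "F \<in> H"
  shows "iv (emb F) = emb (inv\<^bsub>A\<^esub> F)"
proof -
  interpret group A by (rule group_Aut_affine)
  show ?thesis using carrier[OF F] by (simp add: iv_def emb_def)
qed

lemma polymap_act:
  assumes "polymap m K U" "N \<le> K" "polymap m n B"
  shows "polymap m n (\<lambda>w. act (U w) (B w))"
  unfolding act_def
proof (intro polymap_map polyfun_sum polyfun_mult)
  fix i j assume "i < n" "j \<in> {..<r}"
  then have "j * n + i < K" using code_index(1)[of j i] assms(2) by simp
  then show "polyfun m (\<lambda>w. U w ! (j * n + i))" using assms(1) by (simp add: polymap_def)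
  show "polyfun m (\<lambda>w. L j (B w))"
    using \<open>j \<in> {..<r}\<close> by (intro polyfun_compose[OF L_poly assms(3)]) simp
qed

lemma polymap_code:
  assumes "\<And>a. length a = n \<Longrightarrow> polymap m n (\<lambda>w. \<Phi> w a)"
  shows "polymap m N (\<lambda>w. code (\<Phi> w))"
  unfolding code_def
proof (rule polymap_map)
  fix k assume k: "k < N"
  then have "length (ps (k div n)) = n" by (intro ps_length) (simp add: less_mult_imp_div_less)
  moreover have "k mod n < n" using pos_if_less[OF k] by simp
  ultimately show "polyfun m (\<lambda>w. \<Phi> w (ps (k div n)) ! (k mod n))"
    using assms by (simp add: polymap_def)
qed

lemma polymap_mul_code: "polymap (M + M) M (\<lambda>w. mul (take M w) (drop M w))"
proof -
  have t: "polymap (M + M) M (take M)" by (rule polymap_take) simp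
  have d: "polymap (M + M) M (drop M)" by (rule polymap_drop)
  have dN: "polymap M N (drop N)" by (rule polymap_drop)
  show ?thesis
    unfolding mul_def
  proof (rule polymap_append)
    show "polymap (M + M) N (\<lambda>w. code (\<lambda>a. act (take M w) (act (drop M w) a)))"
      by (intro polymap_code polymap_act[OF t] polymap_act[OF d] polymap_const) auto
    show "polymap (M + M) N (\<lambda>w. code (\<lambda>a. act (drop N (drop M w)) (act (drop N (take M w)) a)))"
      by (intro polymap_code polymap_act[OF polymap_compose[OF dN d]]
          polymap_act[OF polymap_compose[OF dN t]] polymap_const) auto
  qed
qed

lemma polymap_iv_code: "polymap M M iv"
  unfolding iv_def by (rule polymap_append[OF polymap_drop polymap_take]) simp

sublocale polynomial_group M mul iv "emb \<one>\<^bsub>A\<^esub>" "emb ` H"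
proof
  interpret group A by (rule group_Aut_affine)
  show "emb ` H \<subseteq> affine_space M" by auto
  show "polymap (M + M) M (\<lambda>w. mul (take M w) (drop M w))" by (rule polymap_mul_code)
  show "polymap M M iv" by (rule polymap_iv_code)
  note one = subgroup.one_closed[OF H]
  show "emb \<one>\<^bsub>A\<^esub> \<in> emb ` H" using one by blast
  fix x assume "x \<in> emb ` H"
  then obtain F where F: "F \<in> H" "x = emb F" by blast
  show "iv x \<in> emb ` H" using F inv_H by (auto simp: iv_emb)
  show "mul (emb \<one>\<^bsub>A\<^esub>) x = x" "mul x (emb \<one>\<^bsub>A\<^esub>) = x"
    using F one carrier by (simp_all add: mul_emb)
  show "mul (iv x) x = emb \<one>\<^bsub>A\<^esub>" "mul x (iv x) = emb \<one>\<^bsub>A\<^esub>"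
    using F inv_H carrier by (simp_all add: iv_emb mul_emb)
  fix y assume "y \<in> emb ` H"
  then obtain G where G: "G \<in> H" "y = emb G" by blast
  show "mul x y \<in> emb ` H" using F G mult_H by (auto simp: mul_emb)
  fix z assume "z \<in> emb ` H"
  then obtain K where K: "K \<in> H" "z = emb K" by blast
  show "mul (mul x y) z = mul x (mul y z)"
    using F G K mult_H carrier by (simp add: mul_emb m_assoc)
qed

text \<open>In the chart \<open>emb\<close> the multiplication, the inversion and the action are
  restrictions of polynomial maps built from \<open>mul\<close>, \<open>iv\<close> and
  \<open>act\<close>; closedness of the image makes it a legitimate chart.\<close>

lemma algebraic_structure_emb:
  assumes cl: "closedin (zariski M) (emb ` H)"
  shows "algebraic_structure n H (closed_variety H M emb)"
proof -
  interpret group A by (rule group_Aut_affine)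
  let ?X = "closed_variety H M emb"
  define c where "c = \<lparr>chart_dom = H, chart_dim = M, chart_coord = emb\<rparr>"
  define ac :: "('k list, 'k) chart" where
    "ac = \<lparr>chart_dom = affine_space n, chart_dim = n, chart_coord = (\<lambda>a. a)\<rparr>"
  have X: "charts ?X = {c}" "points ?X = chart_dom c"
    by (simp_all add: closed_variety_def c_def)
  have Y: "charts (affine_space_variety n) = {ac}" "points (affine_space_variety n) = chart_dom ac"
    by (simp_all add: affine_space_variety_def ac_def)
  have XX: "charts (product_variety ?X ?X) = {product_chart c c}"
    "points (product_variety ?X ?X) = chart_dom (product_chart c c)"
    using X by (simp_all add: product_variety_def product_chart_def)
  have XY: "charts (product_variety ?X (affine_space_variety n)) = {product_chart c ac}"
    "points (product_variety ?X (affine_space_variety n)) = chart_dom (product_chart c ac)"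
    using X Y by (simp_all add: product_variety_def product_chart_def)
  have group: "group (A\<lparr>carrier := H\<rparr>)" by (rule subgroup.subgroup_is_group[OF H group_Aut_affine])
  have m1: "variety_morphism (product_variety ?X ?X) ?X (\<lambda>(g, h). g \<otimes>\<^bsub>A\<lparr>carrier := H\<rparr>\<^esub> h)"
  proof (rule variety_morphism_single_chart[OF XX X])
    show "inj_on (chart_coord (product_chart c c)) (chart_dom (product_chart c c))"
      using emb_inj by (auto simp: inj_on_def product_chart_def c_def)
    show "polymap (chart_dim (product_chart c c)) (chart_dim c) (\<lambda>w. mul (take M w) (drop M w))"
      using polymap_mul_code by (simp add: product_chart_def c_def)
  qed (auto simp: product_chart_def c_def mul_emb mult_H)
  have m2: "variety_morphism ?X ?X (\<lambda>g. inv\<^bsub>A\<lparr>carrier := H\<rparr>\<^esub> g)"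
  proof (rule variety_morphism_single_chart[OF X X])
    show "inj_on (chart_coord c) (chart_dom c)" using emb_inj by (simp add: c_def)
    show "polymap (chart_dim c) (chart_dim c) iv" using polymap_iv_code by (simp add: c_def)
  qed (auto simp: c_def m_inv_consistent[OF H] inv_H iv_emb)
  have m3: "variety_morphism (product_variety ?X (affine_space_variety n)) (affine_space_variety n)
      (\<lambda>(F, a). F a)"
  proof (rule variety_morphism_single_chart[OF XY Y])
    show "inj_on (chart_coord (product_chart c ac)) (chart_dom (product_chart c ac))"
      using emb_inj by (auto simp: inj_on_def product_chart_def c_def ac_def)
    have "polymap (M + n) n (\<lambda>w. act (take M w) (drop M w))"
      by (rule polymap_act[OF polymap_take _ polymap_drop]) auto
    then show "polymap (chart_dim (product_chart c ac)) (chart_dim ac) (\<lambda>w. act (take M w) (drop M w))"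
      by (simp add: product_chart_def c_def ac_def)
  qed (auto simp: product_chart_def c_def ac_def act_emb Aut_affine_length[OF carrier])
  show ?thesis
    unfolding algebraic_structure_def algebraic_group_def
    using group m1 m2 m3 is_variety_closed_variety[OF emb_inj cl]
    by (simp add: closed_variety_def)
qed

lemma regular_on_emb:
  assumes alg: "algebraic_structure n H' X" and H': "subgroup H' A" and k: "k < M"
  shows "regular_on X (\<lambda>F. emb F ! k)"
proof (cases "k < N")
  case True
  have "regular_on X (\<lambda>F. F (ps (k div n)) ! (k mod n))"
    using True pos_if_less[OF True]
    by (intro regular_on_apply[OF alg subgroup.subset[OF H']] ps_length)
       (simp_all add: less_mult_imp_div_less)
  then show ?thesis using True by (simp add: emb_def nth_append code_def)
next
  case False
  define l where "l = k - N"
  have l: "l < N" using False k by (simp add: l_def)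
  have "regular_on X (\<lambda>F. (inv\<^bsub>A\<^esub> F) (ps (l div n)) ! (l mod n))"
    using pos_if_less[OF l] l
    by (intro regular_on_inv_apply[OF alg H'] ps_length) (simp_all add: less_mult_imp_div_less)
  then show ?thesis using False l by (simp add: emb_def nth_append code_def l_def)
qed

text \<open>The given structure on \<open>H'\<close> is an abstract variety with no prior relation
  to the code; regularity of the coordinates of \<open>emb\<close> on it is the only link between
  the two.\<close>

lemma good_emb:
  assumes conn: "connected_algebraic_subgroup n H'" and sub: "H' \<subseteq> H"
  shows "good (emb ` H')"
proof -
  obtain X where X: "subgroup H' A" "algebraic_structure n H' X" "connected_space (variety_topology X)"
    using conn unfolding connected_algebraic_subgroup_def by blast
  note alg = algebraic_structureD[OF X(2)]
  note reg = regular_on_emb[OF X(2,1)]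
  have "constr M (emb ` points X)"
    by (rule constr_regular_on_image[OF alg(1) reg]) auto
  then have constr: "constr M (emb ` H')" by (simp add: alg(2))
  have one: "\<one>\<^bsub>A\<^esub> \<in> H'" by (rule subgroup.one_closed[OF X(1)])
  have "irr M (emb ` H')"
  proof (rule subgroup_disjoint_components[of "emb ` H'"])
    show "emb ` H' \<subseteq> emb ` H" using sub by blast
    show "mul x y \<in> emb ` H'" if xy: "x \<in> emb ` H'" "y \<in> emb ` H'" for x y
    proof -
      obtain F G where "F \<in> H'" "G \<in> H'" "x = emb F" "y = emb G" using xy by blast
      then show ?thesis
        using sub subgroup.m_closed[OF X(1), of F G] mul_emb[of F G] by blast
    qed
    show "iv x \<in> emb ` H'" if x: "x \<in> emb ` H'" for x
    proof -
      obtain F where "F \<in> H'" "x = emb F" using x by blast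
      then show ?thesis
        using sub subgroup.m_inv_closed[OF X(1), of F] iv_emb[of F] by blast
    qed
    fix \<C> assume C: "finite \<C>" "\<Union>\<C> = emb ` H'" "\<And>C. C \<in> \<C> \<Longrightarrow> irr M C"
      "\<And>C. C \<in> \<C> \<Longrightarrow> C = emb ` H' \<inter> zcl M C"
      "\<And>C D. C \<in> \<C> \<Longrightarrow> D \<in> \<C> \<Longrightarrow> C \<inter> D \<noteq> {} \<Longrightarrow> C = D"
    have "irr M (emb ` points X)"
    proof (rule connected_image_irr[OF alg(1) X(3)])
      show "points X \<noteq> {}" using one alg(2) by blast
      show "regular_on X (\<lambda>F. emb F ! k)" if "k < M" for k by (rule reg[OF that])
      show "length (emb F) = M" for F by simp
      show "finite \<C>" by (rule C(1))
      show "\<Union>\<C> = emb ` points X" unfolding alg(2) by (rule C(2))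
      show "irr M C" if "C \<in> \<C>" for C by (rule C(3)[OF that])
      show "C = emb ` points X \<inter> zcl M C" if "C \<in> \<C>" for C unfolding alg(2) by (rule C(4)[OF that])
      show "C = D" if "C \<in> \<C>" "D \<in> \<C>" "C \<inter> D \<noteq> {}" for C D by (rule C(5)[OF that])
    qed
    then show "irr M (emb ` H')" by (simp only: alg(2))
  qed
  then show ?thesis using constr one sub unfolding good_def by blast
qed

end

section \<open>Solvability of triangular groups\<close>

text \<open>The diagonal coefficient \<open>\<lambda>\<^sub>i\<close> as a difference quotient
  between points that agree before \<open>i\<close>. Stated for functions, it can be followed
  through compositions without reference to polynomials.\<close>

definition triangular_slope :: "nat \<Rightarrow> ('k::field list \<Rightarrow> 'k list) \<Rightarrow> nat \<Rightarrow> 'k \<Rightarrow> bool" where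
  "triangular_slope n F i l \<longleftrightarrow> (\<forall>a b. length a = n \<longrightarrow> length b = n \<longrightarrow> take i a = take i b \<longrightarrow>
     F a ! i - F b ! i = l * (a ! i - b ! i))"

lemma triangular_slopeD:
  "triangular_slope n F i l \<Longrightarrow> length a = n \<Longrightarrow> length b = n \<Longrightarrow> take i a = take i b \<Longrightarrow>
     F a ! i - F b ! i = l * (a ! i - b ! i)"
  by (simp add: triangular_slope_def)

lemma eval_take:
  assumes "h \<in> poly_ring i" shows "eval h (take i a) = eval h a"
  unfolding eval_def eval_monom_def
  using assms by (intro sum.cong prod.cong refl arg_cong2[of _ _ _ _ "(*)"])
    (auto simp: poly_ring_def subset_iff)

lemma triangular_imp_slope:
  assumes "triangular n F" "i < n"
  shows "\<exists>l. triangular_slope n F i l"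
proof -
  obtain fs l h where fs: "length fs = n" "\<And>a. length a = n \<Longrightarrow> F a = map (\<lambda>f. eval f a) fs" and
    h: "h \<in> poly_ring i" "fs ! i = Poly_Mapping.single (Poly_Mapping.single i 1) l + h"
    using assms unfolding triangular_def coordinate_tuple_def by auto
  have F: "F a ! i = l * a ! i + eval h (take i a)" if "length a = n" for a
    using that fs assms(2) h by (simp add: eval_add eval_single eval_monom_single eval_take)
  have "triangular_slope n F i l"
    unfolding triangular_slope_def
  proof (intro allI impI)
    fix a b :: "'a list" assume ab: "length a = n" "length b = n" "take i a = take i b"
    then show "F a ! i - F b ! i = l * (a ! i - b ! i)"
      by (simp add: F[OF ab(1)] F[OF ab(2)] right_diff_distrib)
  qed
  then show ?thesis by blast
qed

lemma triangular_slope_unique: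
  assumes "triangular_slope n F i l" "triangular_slope n F i l'" "i < n"
  shows "l = (l' :: 'k::field)"
proof -
  let ?a = "(replicate n 0)[i := 1] :: 'k list" and ?b = "replicate n 0 :: 'k list"
  have "take i ?a = take i ?b" by simp
  from triangular_slopeD[OF assms(1) _ _ this] triangular_slopeD[OF assms(2) _ _ this]
  show ?thesis using assms(3) by simp
qed

text \<open>A map with a slope at every coordinate induces a map on the first \<open>i\<close>
  coordinates; this allows slopes to be multiplied along a composition.\<close>

lemma take_apply_slope:
  assumes slope: "\<And>j. j < n \<Longrightarrow> \<exists>l. triangular_slope n F j l"
    and len: "\<And>a. length a = n \<Longrightarrow> length (F a) = n"
    and i: "i \<le> n" and ab: "length a = n" "length b = n" "take i a = take i b"
  shows "take i (F a) = take i (F b)"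
proof (rule nth_equalityI)
  show "length (take i (F a)) = length (take i (F b))" using len ab by simp
  fix j assume "j < length (take i (F a))"
  then have j: "j < i" by simp
  obtain l where l: "triangular_slope n F j l" using slope[of j] j i by auto
  have "take j a = take j (take i a)" using j by simp
  also have "\<dots> = take j b" using j ab(3) by simp
  finally have "F a ! j - F b ! j = l * (a ! j - b ! j)" by (rule triangular_slopeD[OF l ab(1,2)])
  moreover have "a ! j = b ! j" using arg_cong[OF ab(3), of "\<lambda>c. c ! j"] j by simp
  ultimately show "take i (F a) ! j = take i (F b) ! j" using j by simp
qed

lemma triangular_slope_mult:
  assumes F: "F \<in> carrier (Aut_affine n)" and G: "G \<in> carrier (Aut_affine n)"
    and slope: "\<And>j. j < n \<Longrightarrow> \<exists>l. triangular_slope n G j l" and i: "i < n"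
    and l: "triangular_slope n F i l" and m: "triangular_slope n G i m"
  shows "triangular_slope n (F \<otimes>\<^bsub>Aut_affine n\<^esub> G) i (l * m)"
  unfolding triangular_slope_def
proof (intro allI impI)
  fix a b :: "'a list" assume ab: "length a = n" "length b = n" "take i a = take i b"
  have "F (G a) ! i - F (G b) ! i = l * (G a ! i - G b ! i)"
    using i ab by (intro triangular_slopeD[OF l] take_apply_slope[OF slope] Aut_affine_length[OF G]) auto
  also have "\<dots> = l * (m * (a ! i - b ! i))" using triangular_slopeD[OF m ab] by simp
  finally show "(F \<otimes>\<^bsub>Aut_affine n\<^esub> G) a ! i - (F \<otimes>\<^bsub>Aut_affine n\<^esub> G) b ! i = l * m * (a ! i - b ! i)"
    using Aut_affine_mult_apply[OF F G] ab by (simp add: mult.assoc)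
qed

locale triangular_group =
  fixes n :: nat and H :: "('k::field list \<Rightarrow> 'k list) set"
  assumes H: "subgroup H (Aut_affine n)"
    and slope: "F \<in> H \<Longrightarrow> i < n \<Longrightarrow> \<exists>l. triangular_slope n F i l"
begin

abbreviation "A \<equiv> Aut_affine n :: ('k list \<Rightarrow> 'k list) monoid"

sublocale group A by (rule group_Aut_affine)

text \<open>Starting from \<open>H\<close> itself at \<open>i = 0\<close>, these groups end with the
  trivial one at \<open>n\<close>; \<open>unipotent i\<close> is the intermediate term with diagonal
  coefficient 1 at coordinate \<open>i\<close>.\<close>

definition fixing :: "nat \<Rightarrow> ('k list \<Rightarrow> 'k list) set" where
  "fixing i = {F \<in> H. \<forall>a. length a = n \<longrightarrow> take i (F a) = take i a}"

definition unipotent :: "nat \<Rightarrow> ('k list \<Rightarrow> 'k list) set" where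
  "unipotent i = {F \<in> fixing i. triangular_slope n F i 1}"

lemma carrier: "F \<in> H \<Longrightarrow> F \<in> carrier A"
  using subgroup.mem_carrier[OF H] .

lemma apply_simps:
  assumes "F \<in> H" "G \<in> H" "length a = n"
  shows "(F \<otimes>\<^bsub>A\<^esub> G) a = F (G a)" "length (F a) = n" "(inv\<^bsub>A\<^esub> F) (F a) = a" "F ((inv\<^bsub>A\<^esub> F) a) = a"
  using Aut_affine_mult_apply[OF carrier carrier] Aut_affine_length[OF carrier]
    Aut_affine_inv_apply[OF carrier] assms by auto

lemma slope_mult:
  assumes "F \<in> H" "G \<in> H" "i < n" "triangular_slope n F i l" "triangular_slope n G i m"
  shows "triangular_slope n (F \<otimes>\<^bsub>A\<^esub> G) i (l * m)"
  by (rule triangular_slope_mult[OF carrier carrier slope]) (use assms in auto)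

lemma slope_inv:
  assumes F: "F \<in> H" and i: "i < n" and l: "triangular_slope n F i l"
    and m: "triangular_slope n (inv\<^bsub>A\<^esub> F) i m"
  shows "l * m = 1"
proof -
  have "triangular_slope n (F \<otimes>\<^bsub>A\<^esub> inv\<^bsub>A\<^esub> F) i (l * m)"
    using slope_mult[OF F subgroup.m_inv_closed[OF H F] i l m] .
  moreover have "F \<otimes>\<^bsub>A\<^esub> inv\<^bsub>A\<^esub> F = \<one>\<^bsub>A\<^esub>" using carrier[OF F] by simp
  moreover have "triangular_slope n \<one>\<^bsub>A\<^esub> i 1"
    by (simp add: triangular_slope_def Aut_affine_one_apply)
  ultimately show ?thesis using triangular_slope_unique i by metis
qed

lemma fixing_subset: "fixing i \<subseteq> H"
  by (auto simp: fixing_def)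

lemma subgroup_fixing: "subgroup (fixing i) A"
proof (rule subgroupI)
  show "fixing i \<subseteq> carrier A" using carrier fixing_subset by blast
  have "\<one>\<^bsub>A\<^esub> \<in> fixing i"
    using subgroup.one_closed[OF H] by (simp add: fixing_def Aut_affine_one_apply)
  then show "fixing i \<noteq> {}" by blast
  fix F assume F: "F \<in> fixing i"
  then have FH: "F \<in> H" by (simp add: fixing_def)
  note IH = subgroup.m_inv_closed[OF H FH]
  have "take i ((inv\<^bsub>A\<^esub> F) a) = take i a" if a: "length a = n" for a
  proof -
    have "take i (F ((inv\<^bsub>A\<^esub> F) a)) = take i ((inv\<^bsub>A\<^esub> F) a)"
      using F apply_simps(2)[OF IH IH a] by (simp add: fixing_def)
    then show ?thesis using apply_simps(4)[OF FH FH a] by simp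
  qed
  then show "inv\<^bsub>A\<^esub> F \<in> fixing i" using IH by (simp add: fixing_def)
  fix G assume G: "G \<in> fixing i"
  then show "F \<otimes>\<^bsub>A\<^esub> G \<in> fixing i"
    using F FH subgroup.m_closed[OF H FH, of G] by (auto simp: fixing_def apply_simps)
qed

lemma subgroup_unipotent:
  assumes i: "i < n" shows "subgroup (unipotent i) A"
proof (rule subgroupI)
  show "unipotent i \<subseteq> carrier A" using carrier fixing_subset by (auto simp: unipotent_def)
  have "\<one>\<^bsub>A\<^esub> \<in> unipotent i"
    using subgroup.one_closed[OF subgroup_fixing]
    by (simp add: unipotent_def triangular_slope_def Aut_affine_one_apply)
  then show "unipotent i \<noteq> {}" by blast
  fix F assume F: "F \<in> unipotent i"
  then have FH: "F \<in> H" "F \<in> fixing i" "triangular_slope n F i 1"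
    using fixing_subset by (auto simp: unipotent_def)
  obtain m where m: "triangular_slope n (inv\<^bsub>A\<^esub> F) i m"
    using slope[OF subgroup.m_inv_closed[OF H FH(1)] i] by blast
  then have "m = 1" using slope_inv[OF FH(1) i FH(3) m] by simp
  then show "inv\<^bsub>A\<^esub> F \<in> unipotent i"
    using m subgroup.m_inv_closed[OF subgroup_fixing FH(2)] by (simp add: unipotent_def)
  fix G assume G: "G \<in> unipotent i"
  then have GH: "G \<in> H" "G \<in> fixing i" "triangular_slope n G i 1"
    using fixing_subset by (auto simp: unipotent_def)
  show "F \<otimes>\<^bsub>A\<^esub> G \<in> unipotent i"
    using slope_mult[OF FH(1) GH(1) i FH(3) GH(3)] subgroup.m_closed[OF subgroup_fixing FH(2) GH(2)]
    by (simp add: unipotent_def)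
qed

text \<open>Diagonal coefficients multiply in a commutative field, so they cancel in a
  commutator.\<close>

lemma derived_fixing:
  assumes i: "i < n" shows "derived A (fixing i) \<subseteq> unipotent i"
  unfolding derived_def
proof (rule generate_subgroup_incl[OF _ subgroup_unipotent[OF i]], clarsimp)
  fix F G assume F: "F \<in> fixing i" and G: "G \<in> fixing i"
  have FG: "F \<in> H" "G \<in> H" "inv\<^bsub>A\<^esub> F \<in> H" "inv\<^bsub>A\<^esub> G \<in> H"
    using F G fixing_subset subgroup.m_inv_closed[OF H] by auto
  obtain l l' m m' where s: "triangular_slope n F i l" "triangular_slope n (inv\<^bsub>A\<^esub> F) i l'"
    "triangular_slope n G i m" "triangular_slope n (inv\<^bsub>A\<^esub> G) i m'"
    using slope[OF _ i] FG by meson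
  have "l * l' = 1" "m * m' = 1" using slope_inv[OF _ i] FG s by auto
  have "triangular_slope n (F \<otimes>\<^bsub>A\<^esub> G \<otimes>\<^bsub>A\<^esub> inv\<^bsub>A\<^esub> F \<otimes>\<^bsub>A\<^esub> inv\<^bsub>A\<^esub> G) i (l * m * l' * m')"
    using FG s by (intro slope_mult[OF _ _ i] subgroup.m_closed[OF H])
  moreover have "l * m * l' * m' = (l * l') * (m * m')" by (simp only: mult_ac)
  ultimately have "triangular_slope n (F \<otimes>\<^bsub>A\<^esub> G \<otimes>\<^bsub>A\<^esub> inv\<^bsub>A\<^esub> F \<otimes>\<^bsub>A\<^esub> inv\<^bsub>A\<^esub> G) i 1"
    using \<open>l * l' = 1\<close> \<open>m * m' = 1\<close> by simp
  moreover have "F \<otimes>\<^bsub>A\<^esub> G \<otimes>\<^bsub>A\<^esub> inv\<^bsub>A\<^esub> F \<otimes>\<^bsub>A\<^esub> inv\<^bsub>A\<^esub> G \<in> fixing i"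
    using F G by (intro subgroup.m_closed[OF subgroup_fixing] subgroup.m_inv_closed[OF subgroup_fixing])
  ultimately show "F \<otimes>\<^bsub>A\<^esub> G \<otimes>\<^bsub>A\<^esub> inv\<^bsub>A\<^esub> F \<otimes>\<^bsub>A\<^esub> inv\<^bsub>A\<^esub> G \<in> unipotent i"
    by (simp add: unipotent_def)
qed

text \<open>An element of \<open>unipotent i\<close> shifts coordinate \<open>i\<close> by an amount
  depending only on the first \<open>i\<close> coordinates, and these it fixes. Two such shifts
  commute, so a commutator fixes coordinate \<open>i\<close> as well.\<close>

lemma derived_unipotent:
  assumes i: "i < n" shows "derived A (unipotent i) \<subseteq> fixing (Suc i)"
  unfolding derived_def
proof (rule generate_subgroup_incl[OF _ subgroup_fixing], clarsimp)
  fix F G assume F: "F \<in> unipotent i" and G: "G \<in> unipotent i"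
  have Ff: "F \<in> fixing i" "G \<in> fixing i" and s: "triangular_slope n F i 1" "triangular_slope n G i 1"
    using F G by (auto simp: unipotent_def)
  have FG: "F \<in> H" "G \<in> H" "inv\<^bsub>A\<^esub> F \<in> H" "inv\<^bsub>A\<^esub> G \<in> H"
    using Ff fixing_subset subgroup.m_inv_closed[OF H] by auto
  let ?C = "F \<otimes>\<^bsub>A\<^esub> G \<otimes>\<^bsub>A\<^esub> inv\<^bsub>A\<^esub> F \<otimes>\<^bsub>A\<^esub> inv\<^bsub>A\<^esub> G"
  have C: "?C \<in> fixing i"
    using Ff by (intro subgroup.m_closed[OF subgroup_fixing] subgroup.m_inv_closed[OF subgroup_fixing])
  then have CH: "?C \<in> H" using fixing_subset by blast
  have commute: "F (G b) ! i = G (F b) ! i" if b: "length b = n" for b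
  proof -
    have "F (G b) ! i - F b ! i = 1 * (G b ! i - b ! i)"
      by (rule triangular_slopeD[OF s(1)])
         (use b Ff apply_simps(2)[OF FG(2,2)] in \<open>auto simp: fixing_def\<close>)
    moreover have "G (F b) ! i - G b ! i = 1 * (F b ! i - b ! i)"
      by (rule triangular_slopeD[OF s(2)])
         (use b Ff apply_simps(2)[OF FG(1,1)] in \<open>auto simp: fixing_def\<close>)
    ultimately show ?thesis by algebra
  qed
  have "take (Suc i) (?C a) = take (Suc i) a" if a: "length a = n" for a
  proof -
    \<comment> \<open>With this point the commutator sends \<open>a = G (F b)\<close> to
      \<open>F (G b)\<close>.\<close>
    define b where "b = (inv\<^bsub>A\<^esub> F) ((inv\<^bsub>A\<^esub> G) a)"
    have la: "length ((inv\<^bsub>A\<^esub> G) a) = n" by (rule apply_simps(2)[OF FG(4,4) a])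
    have b: "length b = n" unfolding b_def by (rule apply_simps(2)[OF FG(3,3) la])
    have "?C a = F (G b)"
      using a la b FG by (simp add: apply_simps(1) subgroup.m_closed[OF H] b_def)
    moreover have "G (F b) = a"
      unfolding b_def using apply_simps(4)[OF FG(1,1) la] apply_simps(4)[OF FG(2,2) a] by simp
    ultimately have "?C a ! i = a ! i" using commute[OF b] by simp
    moreover have "take i (?C a) = take i a" using C a by (simp add: fixing_def)
    ultimately show ?thesis using a i apply_simps(2)[OF CH CH a] by (simp add: take_Suc_conv_app_nth)
  qed
  then show "?C \<in> fixing (Suc i)" using CH by (simp add: fixing_def)
qed

lemma derived_series_fixing: "i \<le> n \<Longrightarrow> (derived A ^^ (2 * i)) H \<subseteq> fixing i"
proof (induction i)
  case 0
  show ?case by (simp add: fixing_def)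
next
  case (Suc i)
  then have i: "i < n" and IH: "(derived A ^^ (2 * i)) H \<subseteq> fixing i" by auto
  have "derived A (derived A ((derived A ^^ (2 * i)) H)) \<subseteq> derived A (derived A (fixing i))"
    by (intro mono_derived IH)
  also have "\<dots> \<subseteq> derived A (unipotent i)" by (intro mono_derived derived_fixing i)
  also have "\<dots> \<subseteq> fixing (Suc i)" by (rule derived_unipotent[OF i])
  finally show ?case by simp
qed

theorem solvable_triangular: "solvable (A\<lparr>carrier := H\<rparr>)"
proof -
  let ?B = "A\<lparr>carrier := H\<rparr>"
  interpret B: group ?B by (rule subgroup.subgroup_is_group[OF H group_Aut_affine])
  \<comment> \<open>The series formed inside \<open>H\<close> agrees with the one formed in the
    ambient group, where the inclusions were proved. Containment in \<open>H\<close> is proved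
    along, since the comparison of a single step asks for it.\<close>
  have "(derived A ^^ k) H \<subseteq> H \<and> (derived ?B ^^ k) H = (derived A ^^ k) H" for k
    by (induction k) (auto simp: derived_consistent[OF _ H] dest: derived_incl[OF _ H, THEN subsetD])
  then have "(derived ?B ^^ (2 * n)) (carrier ?B) = (derived A ^^ (2 * n)) H" by simp
  moreover have "(derived A ^^ (2 * n)) H \<subseteq> {\<one>\<^bsub>A\<^esub>}"
  proof
    fix F assume "F \<in> (derived A ^^ (2 * n)) H"
    then have F: "F \<in> fixing n" using derived_series_fixing[of n] by auto
    then have FH: "F \<in> H" using fixing_subset by blast
    have "F = \<one>\<^bsub>A\<^esub>"
    proof (rule Aut_affine_eqI[OF carrier[OF FH] one_closed])
      fix a :: "'k list" assume a: "length a = n"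
      then have "take n (F a) = take n a" using F by (simp add: fixing_def)
      then show "F a = \<one>\<^bsub>A\<^esub> a" using a apply_simps(2)[OF FH FH a] by (simp add: Aut_affine_one_apply)
    qed
    then show "F \<in> {\<one>\<^bsub>A\<^esub>}" by simp
  qed
  moreover have "\<one>\<^bsub>A\<^esub> \<in> (derived A ^^ (2 * n)) H"
    using subgroup.one_closed[OF exp_of_derived_is_subgroup[OF H]] .
  ultimately have "(derived ?B ^^ (2 * n)) (carrier ?B) = {\<one>\<^bsub>?B\<^esub>}" by auto
  then show ?thesis using B.solvable_iff_trivial_derived_seq by blast
qed

end

section \<open>Properties inherited by the generated group\<close>

lemma generate_triangular_slope:
  fixes S :: "('k::field list \<Rightarrow> 'k list) set"
  assumes S: "S \<subseteq> carrier (Aut_affine n)" "\<And>F. F \<in> S \<Longrightarrow> inv\<^bsub>Aut_affine n\<^esub> F \<in> S"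
    and slope: "\<And>F i. F \<in> S \<Longrightarrow> i < n \<Longrightarrow> \<exists>l. triangular_slope n F i l"
  shows "triangular_group n (generate (Aut_affine n) S)"
proof (rule triangular_group.intro)
  let ?A = "Aut_affine n :: ('k list \<Rightarrow> 'k list) monoid"
  interpret group ?A by (rule group_Aut_affine)
  show "subgroup (generate ?A S) ?A" by (rule generate_is_subgroup[OF S(1)])
  have "\<forall>i<n. \<exists>l. triangular_slope n F i l" if "F \<in> generate ?A S" for F
    using that
  proof (induction rule: generate.induct)
    case one
    have "triangular_slope n \<one>\<^bsub>?A\<^esub> i 1" for i
      by (simp add: triangular_slope_def Aut_affine_one_apply)
    then show ?case by blast
  next
    case (incl F)
    then show ?case using slope by blast
  next
    case (inv F)
    then show ?case using slope S(2) by blast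
  next
    case (eng F G)
    have FG: "F \<in> carrier ?A" "G \<in> carrier ?A"
      using eng.hyps generate_in_carrier[OF S(1)] by auto
    show ?case
    proof (intro allI impI)
      fix i assume i: "i < n"
      obtain l m where lm: "triangular_slope n F i l" "triangular_slope n G i m"
        using eng.IH i by blast
      have "triangular_slope n (F \<otimes>\<^bsub>?A\<^esub> G) i (l * m)"
        using eng.IH(2) by (intro triangular_slope_mult[OF FG _ i lm]) blast
      then show "\<exists>l. triangular_slope n (F \<otimes>\<^bsub>?A\<^esub> G) i l" by blast
    qed
  qed
  then show "\<exists>l. triangular_slope n F i l" if "F \<in> generate ?A S" "i < n" for F i
    using that by blast
qed

text \<open>Words of any length stay within the same bounds by \<open>wpolyfun_compose\<close>;
  inverses of generators are covered because \<open>S\<close> is closed under inversion.\<close>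

lemma generate_weighted_degree:
  fixes S :: "('k::field list \<Rightarrow> 'k list) set"
  assumes S: "S \<subseteq> carrier (Aut_affine n)" "\<And>F. F \<in> S \<Longrightarrow> inv\<^bsub>Aut_affine n\<^esub> F \<in> S"
    and w: "\<And>i. i < n \<Longrightarrow> w i \<ge> 1"
    and deg: "\<And>F i. F \<in> S \<Longrightarrow> i < n \<Longrightarrow> wpolyfun n w (w i) (\<lambda>a. F a ! i)"
    and F: "F \<in> generate (Aut_affine n) S"
  shows "\<forall>i<n. wpolyfun n w (w i) (\<lambda>a. F a ! i)"
  using F
proof (induction rule: generate.induct)
  case one
  show ?case
    by (auto intro!: wpolyfun_cong[OF wpolyfun_nth] simp: Aut_affine_one_apply)
next
  case (incl F)
  then show ?case using deg by blast
next
  case (inv F)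
  then show ?case using deg S(2) by blast
next
  case (eng F G)
  have FG: "F \<in> carrier (Aut_affine n)" "G \<in> carrier (Aut_affine n)"
    using eng.hyps group.generate_in_carrier[OF group_Aut_affine S(1)] by auto
  show ?case
  proof (intro allI impI)
    fix i assume i: "i < n"
    have "wpolyfun n w (w i) (\<lambda>a. F (G a) ! i)"
      by (rule wpolyfun_compose[where f = "\<lambda>a. F a ! i" and F = G and k = n and w = w])
         (use eng.IH i w Aut_affine_length[OF FG(2)] in auto)
    then show "wpolyfun n w (w i) (\<lambda>a. (F \<otimes>\<^bsub>Aut_affine n\<^esub> G) a ! i)"
      by (rule wpolyfun_cong) (simp add: Aut_affine_mult_apply[OF FG])
  qed
qed

section \<open>The generated group\<close>

context evaluation_frame
begin

theorem generated_connected_algebraic: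
  assumes gen: "H = generate A (\<Union>i\<in>I. G i)"
    and G: "\<And>i. i \<in> I \<Longrightarrow> connected_algebraic_subgroup n (G i)"
  shows "connected_algebraic_subgroup n H"
proof -
  interpret A: group A by (rule group_Aut_affine)
  have sub: "subgroup (G i) A" if "i \<in> I" for i
    using G[OF that] by (simp add: connected_algebraic_subgroup_def)
  have GH: "G i \<subseteq> H" if "i \<in> I" for i
    unfolding gen using that by (auto intro: generate.incl)
  have good: "good Y" if "Y \<in> (\<lambda>i. emb ` G i) ` I" for Y
    using that good_emb[OF G GH] by auto
  have generated: "emb ` H \<subseteq> S"
    if e: "emb \<one>\<^bsub>A\<^esub> \<in> S"
      and step: "\<And>z Y y. z \<in> S \<Longrightarrow> Y \<in> (\<lambda>i. emb ` G i) ` I \<Longrightarrow> y \<in> Y \<Longrightarrow> mul z y \<in> S" for S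
  proof -
    have one_step: "emb (K \<otimes>\<^bsub>A\<^esub> F) \<in> S" if "K \<in> H" "emb K \<in> S" "F \<in> G i" "i \<in> I" for K F i
      using step[of "emb K" "emb ` G i" "emb F"] that GH[OF that(4)] mul_emb[OF that(1), of F] by auto
    \<comment> \<open>The rules of \<open>generate\<close> multiply two generated elements, whereas
      \<open>S\<close> is only stable under right multiplication by single elements of some
      \<open>G i\<close>; quantifying over the left factor \<open>K\<close> bridges this.\<close>
    have "\<forall>K\<in>H. emb K \<in> S \<longrightarrow> emb (K \<otimes>\<^bsub>A\<^esub> F) \<in> S" if "F \<in> generate A (\<Union>i\<in>I. G i)" for F
      using that
    proof (induction rule: generate.induct)
      case one
      then show ?case using carrier by simp
    next
      case (incl F)
      then show ?case using one_step by blast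
    next
      case (inv F)
      then obtain i where "i \<in> I" "inv\<^bsub>A\<^esub> F \<in> G i" using subgroup.m_inv_closed[OF sub] by blast
      then show ?case using one_step by blast
    next
      case (eng F1 F2)
      have F: "F1 \<in> H" "F2 \<in> H" using eng.hyps by (simp_all add: gen)
      show ?case
      proof (intro ballI impI)
        fix K assume K: "K \<in> H" "emb K \<in> S"
        have "emb ((K \<otimes>\<^bsub>A\<^esub> F1) \<otimes>\<^bsub>A\<^esub> F2) \<in> S" using eng.IH K F mult_H by blast
        then show "emb (K \<otimes>\<^bsub>A\<^esub> (F1 \<otimes>\<^bsub>A\<^esub> F2)) \<in> S" using K F carrier by (simp add: A.m_assoc)
      qed
    qed
    from this[folded gen] show ?thesis
      using subgroup.one_closed[OF H] e carrier by (force dest: bspec[of H _ "\<one>\<^bsub>A\<^esub>"])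
  qed
  have closed: "irr M (emb ` H)" "zcl M (emb ` H) = emb ` H"
  proof -
    show "irr M (emb ` H)"
    proof (rule generated_closed_irr(1)[of "(\<lambda>i. emb ` G i) ` I"])
      show "good Y" if "Y \<in> (\<lambda>i. emb ` G i) ` I" for Y by (rule good[OF that])
      show "emb ` H \<subseteq> S" if "emb \<one>\<^bsub>A\<^esub> \<in> S"
        "\<And>z Y y. z \<in> S \<Longrightarrow> Y \<in> (\<lambda>i. emb ` G i) ` I \<Longrightarrow> y \<in> Y \<Longrightarrow> mul z y \<in> S" for S
        by (rule generated[OF that])
    qed
    show "zcl M (emb ` H) = emb ` H"
    proof (rule generated_closed_irr(2)[of "(\<lambda>i. emb ` G i) ` I"])
      show "good Y" if "Y \<in> (\<lambda>i. emb ` G i) ` I" for Y by (rule good[OF that])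
      show "emb ` H \<subseteq> S" if "emb \<one>\<^bsub>A\<^esub> \<in> S"
        "\<And>z Y y. z \<in> S \<Longrightarrow> Y \<in> (\<lambda>i. emb ` G i) ` I \<Longrightarrow> y \<in> Y \<Longrightarrow> mul z y \<in> S" for S
        by (rule generated[OF that])
    qed
  qed
  have "closedin (zariski M) (emb ` H)"
    using closedin_zcl[OF H_sub] closed(2) by simp
  then have "algebraic_structure n H (closed_variety H M emb)"
    "connected_space (variety_topology (closed_variety H M emb))"
    using algebraic_structure_emb connected_closed_variety[OF emb_inj _ closed(1)] by auto
  then show ?thesis
    using H unfolding connected_algebraic_subgroup_def by blast
qed

end

theorem theorem1:
  fixes n s :: nat
    and G :: "nat \<Rightarrow> ('k::alg_closed_field list \<Rightarrow> 'k list) set"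
  assumes "n \<ge> 1"
    and "\<And>i. i \<in> {1..s} \<Longrightarrow> connected_algebraic_subgroup n (G i)"
    and "\<And>i. i \<in> {1..s} \<Longrightarrow> triangular_subgroup n (G i)"
  shows "connected_algebraic_subgroup n (generate (Aut_affine n) (\<Union>i\<in>{1..s}. G i)) \<and>
    solvable (Aut_affine n\<lparr>carrier := generate (Aut_affine n) (\<Union>i\<in>{1..s}. G i)\<rparr>)"
proof -
  let ?A = "Aut_affine n :: ('k list \<Rightarrow> 'k list) monoid" and ?S = "\<Union>i\<in>{1..s}. G i"
  have sub: "subgroup (G i) ?A" if "i \<in> {1..s}" for i
    using assms(2)[OF that] by (simp add: connected_algebraic_subgroup_def)
  have S: "?S \<subseteq> carrier ?A" using subgroup.subset[OF sub] by blast
  have inv: "inv\<^bsub>?A\<^esub> F \<in> ?S" if "F \<in> ?S" for F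
    using that subgroup.m_inv_closed[OF sub] by blast
  have tri: "triangular n F" if "F \<in> ?S" for F
    using that assms(3) unfolding triangular_subgroup_def by blast
  have "triangular_group n (generate ?A ?S)"
  proof (rule generate_triangular_slope[OF S inv])
    show "\<exists>l. triangular_slope n F i l" if "F \<in> ?S" "i < n" for F i
      by (rule triangular_imp_slope[OF tri[OF that(1)] that(2)])
  qed
  then have solv: "solvable (?A\<lparr>carrier := generate ?A ?S\<rparr>)"
    by (rule triangular_group.solvable_triangular)
  have "\<exists>D. \<forall>i\<in>{1..s}. \<forall>F\<in>G i. \<forall>j<n. line_degree_le n D (\<lambda>a. F a ! j)"
  proof (rule finite_common_bound)
    show "\<exists>D. \<forall>F\<in>G i. \<forall>j<n. line_degree_le n D (\<lambda>a. F a ! j)" if i: "i \<in> {1..s}" for i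
    proof -
      obtain X where "algebraic_structure n (G i) X"
        using assms(2)[OF i] unfolding connected_algebraic_subgroup_def by blast
      then show ?thesis by (rule algebraic_subgroup_bounded[OF _ subgroup.subset[OF sub[OF i]]])
    qed
  qed (auto intro: line_degree_le_mono)
  then obtain D where D: "\<And>F j. F \<in> ?S \<Longrightarrow> j < n \<Longrightarrow> line_degree_le n D (\<lambda>a. F a ! j)" by blast
  \<comment> \<open>\<open>Suc D\<close> in place of \<open>D\<close> keeps the weights positive
    when \<open>D = 0\<close>.\<close>
  define w where "w = (\<lambda>j. Suc D ^ j)"
  have w: "w j \<ge> 1" for j by (simp add: w_def)
  have gen_deg: "wpolyfun n w (w j) (\<lambda>a. F a ! j)" if F: "F \<in> ?S" and j: "j < n" for F j
    unfolding w_def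
    by (rule triangular_weighted_degree[OF tri[OF F] j _ line_degree_le_mono[OF D[OF F j]]]) auto
  \<comment> \<open>The weights are at most \<open>Suc D ^ n\<close>, so all components of all
    elements lie in one space, for which a single set of interpolation points works.\<close>
  have deg: "wpolyfun n w (Suc D ^ n) (\<lambda>a. F a ! j)" if F: "F \<in> generate ?A ?S" and j: "j < n" for F j
  proof (rule wpolyfun_mono)
    show "wpolyfun n w (w j) (\<lambda>a. F a ! j)"
      using generate_weighted_degree[OF S inv w gen_deg F] j by blast
    show "w j \<le> Suc D ^ n" using j by (auto simp: w_def intro: power_increasing)
  qed
  obtain r :: nat and ps and L :: "nat \<Rightarrow> 'k list \<Rightarrow> 'k" where
    L: "\<forall>j<r. length (ps j) = n \<and> polyfun n (L j)"
      "\<forall>f. wpolyfun n w (Suc D ^ n) f \<longrightarrow> (\<forall>a. length a = n \<longrightarrow> f a = (\<Sum>j<r. f (ps j) * L j a))"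
    using exists_dual_points_wpolyfun[where 'k = 'k, of n w "Suc D ^ n", OF w] by blast
  interpret evaluation_frame n r ps L "generate ?A ?S"
  proof (rule evaluation_frame.intro)
    show "subgroup (generate ?A ?S) ?A" by (rule group.generate_is_subgroup[OF group_Aut_affine S])
    show "F a ! i = (\<Sum>j<r. F (ps j) ! i * L j a)"
      if "F \<in> generate ?A ?S" "i < n" "length a = n" for F i a
      using L(2) deg[OF that(1,2)] that(3) by blast
  qed (use L(1) in auto)
  have "connected_algebraic_subgroup n (generate ?A ?S)"
    by (rule generated_connected_algebraic[OF refl assms(2)])
  with solv show ?thesis by blast
qed

end
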